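(* Let $K:(0,\infty)\times(0,\infty)\to\mathbb{R}$ be a measurable function for which there is $\kappa_1>0$ such that $$0\le K(x,y)=K(y,x)\le \kappa_1(2+x+y),\qquad (x,y)\in(0,\infty)\times(0,\infty).$$ Let $f^{in}\in L^1_1(0,\infty)$ with $f^{in}\ge 0$ a.e. in $(0,\infty)$. Then there is a non-negative function $$f\in C([0,\infty);L^1(0,\infty))\cap L^\infty(0,\infty;L^1_1(0,\infty))$$ such that $$\int_0^\infty \vartheta(x)\left(f(t,x)-f^{in}(x)\right)dx=\frac12\int_0^t\int_0^\infty\int_0^\infty \tilde\vartheta(x,y)K(x,y)f(s,x)f(s,y)\,dy\,dx\,ds$$ for all $t>0$ and all $\vartheta\in L^\infty(0,\infty)$, and $$M_0(f(t))\le M_0(f^{in})\quad\text{and}\quad M_1(f(t))= M_1(f^{in}),\qquad t\ge 0 .$$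
   Context: For $\mu\in\mathbb{R}$, $L^1_\mu(0,\infty):=\{g\in L^1(0,\infty): \|g\|_{1,\mu}:=\int_0^\infty(1+x^\mu)|g(x)|\,dx<\infty\}$ and $M_\mu(g):=\int_0^\infty x^\mu g(x)\,dx$ for $g\in L^1_\mu(0,\infty)$. For $\vartheta\in L^\infty(0,\infty)$, $\tilde\vartheta(x,y):=\vartheta(x+y)-\vartheta(x)-\vartheta(y)$. (The displayed identity is the weak formulation of Smoluchowski's coagulation equation $\partial_t f(t,x)=\frac12\int_0^x K(y,x-y)f(t,y)f(t,x-y)\,dy-\int_0^\infty K(x,y)f(t,x)f(t,y)\,dy$ with $f(0)=f^{in}$.) *)

theory Defs
  imports "HOL-Analysis.Analysis"
begin

text \<open>
  Elements of the Lebesgue spaces over the half-line are represented by functions on the reals,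
  of which only the values on the half-line matter; identification almost everywhere is left
  implicit. Measurability is Lebesgue measurability throughout.
\<close>

abbreviation halfline :: "real measure" where
  "halfline \<equiv> lebesgue_on {0<..}"

abbreviation quadrant :: "(real \<times> real) measure" where
  "quadrant \<equiv> lebesgue_on ({0<..} \<times> {0<..})"

definition L1 :: "(real \<Rightarrow> real) set" where
  "L1 = {g. integrable halfline g}"

definition L1_norm :: "(real \<Rightarrow> real) \<Rightarrow> real" where
  "L1_norm g = (LINT x|halfline. \<bar>g x\<bar>)"

definition L1_weighted :: "real \<Rightarrow> (real \<Rightarrow> real) set" where
  "L1_weighted \<mu> = {g \<in> L1. integrable halfline (\<lambda>x. (1 + x powr \<mu>) * \<bar>g x\<bar>)}"

definition L1_weighted_norm :: "real \<Rightarrow> (real \<Rightarrow> real) \<Rightarrow> real" where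
  "L1_weighted_norm \<mu> g = (LINT x|halfline. (1 + x powr \<mu>) * \<bar>g x\<bar>)"

definition moment :: "real \<Rightarrow> (real \<Rightarrow> real) \<Rightarrow> real" where
  "moment \<mu> g = (LINT x|halfline. x powr \<mu> * g x)"

definition Linf :: "(real \<Rightarrow> real) set" where
  "Linf = {\<theta> \<in> borel_measurable halfline. \<exists>C. AE x in halfline. \<bar>\<theta> x\<bar> \<le> C}"

definition tilde :: "(real \<Rightarrow> real) \<Rightarrow> real \<Rightarrow> real \<Rightarrow> real" where
  "tilde \<theta> x y = \<theta> (x + y) - \<theta> x - \<theta> y"

definition continuous_L1 :: "(real \<Rightarrow> real \<Rightarrow> real) \<Rightarrow> bool" where
  "continuous_L1 u \<longleftrightarrow>
     (\<forall>t\<ge>0. u t \<in> L1 \<and>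
        ((\<lambda>s. L1_norm (\<lambda>x. u s x - u t x)) \<longlongrightarrow> 0) (at t within {0..}))"

text \<open>
  Strong (Bochner) measurability of a curve over the half-line of times: almost everywhere limit,
  in the weighted norm, of simple functions with values in the weighted space.
\<close>

definition strongly_measurable_L1_weighted :: "real \<Rightarrow> (real \<Rightarrow> real \<Rightarrow> real) \<Rightarrow> bool" where
  "strongly_measurable_L1_weighted \<mu> u \<longleftrightarrow>
     (\<exists>S :: nat \<Rightarrow> real \<Rightarrow> real \<Rightarrow> real.
        (\<forall>n. simple_function halfline (S n) \<and> (\<forall>t>0. S n t \<in> L1_weighted \<mu>)) \<and>
        (AE t in halfline. u t \<in> L1_weighted \<mu> \<and>
           (\<lambda>n. L1_weighted_norm \<mu> (\<lambda>x. S n t x - u t x)) \<longlonglongrightarrow> 0))"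

definition Linf_L1_weighted :: "real \<Rightarrow> (real \<Rightarrow> real \<Rightarrow> real) set" where
  "Linf_L1_weighted \<mu> =
     {u. strongly_measurable_L1_weighted \<mu> u \<and>
         (\<exists>C. AE t in halfline. L1_weighted_norm \<mu> (u t) \<le> C)}"

end

theory Submission
  imports Defs
begin

text \<open>
  The solution is obtained as a limit of explicit Euler schemes for kernels that are cut off at large sizes.
  For a bounded kernel and a small step, one Euler step maps nonnegative densities to nonnegative densities,
  and it satisfies the weak formulation exactly, with the time integral replaced by the length of the step
  (\<open>euler_step_density\<close>, \<open>euler_step_weak\<close>).  Inserting suitable test functions gives bounds that depend
  neither on the cut-off nor on the step: the number of clusters decreases (\<open>\<theta> = 1\<close>), the mass is constant
  (\<open>\<theta> x = x\<close>), moments for bounded test functions are Lipschitz in time (\<open>iter_lipschitz\<close>), the mass of large clusters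
  is small (\<open>\<phi>_moment\<close>), and so is the number of clusters in small sets of sizes (\<open>small_set_number\<close>).
  For the mass of large clusters the test function is \<open>x min (x / R) 1\<close>: by concavity of the second
  factor it obeys a Gronwall inequality whose data tend to \<open>0\<close> as \<open>R\<close> grows.  The at most linear growth of
  the kernel is decisive here, and this estimate is the reason why no mass escapes to infinity.

  The last two bounds are the equi-integrability of the Dunford--Pettis theorem.  Compactness is used in the
  following form.  Tychonoff's theorem provides a filter on the indices along which every bounded sequence of
  reals converges (\<open>ex_generalized_limit\<close>); no subsequences have to be extracted, and all times and all test
  functions are treated at once.  Along this filter the densities converge setwise, as measures; by
  equi-integrability the limit is countably additive (\<open>emeasure_limit_measure\<close>) and has a density by the
  Radon--Nikodym theorem.  Equi-integrability is inherited by the product of a family with itself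
  (\<open>uniformly_ac_square\<close>), so the products converge setwise as well, and their limit is the product of the
  limits because both agree on rectangles (\<open>limit_measure_square\<close>).  This settles the quadratic term for a
  kernel that is merely measurable; the tail bound removes the cut-off (\<open>tendsto_lim_square\<close>).

  Dominated convergence fails along a general filter, so the time integral is not treated as a limit of
  integrals.  Instead, the increments of a moment over short intervals are compared with the flux
  at one single time, uniformly in the approximation (\<open>lim_increment\<close>).  The limit inherits this estimate, which
  says that moments for bounded test functions are continuously differentiable with the expected derivative; the weak formulation
  is then the fundamental theorem of calculus (\<open>lim_weak\<close>).

  All of this is carried out for Borel functions on the line that vanish on the negative half-line.  Kernel, initial
  datum and test functions differ from such functions on null sets only, which affect neither side of
  the identity (\<open>lim_solution\<close>).
\<close>

section \<open>Generalized limits of bounded sequences\<close>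

text \<open>The values of all bounded sequences at the index \<open>n\<close> form a point \<open>e n\<close> of a product of compact intervals.  A
  cluster point \<open>x\<close> of these points yields a filter along which \<open>e\<close> converges to \<open>x\<close>, that is, along which
  every bounded sequence converges.\<close>
lemma ex_generalized_limit:
  "\<exists>F :: nat filter. F \<noteq> bot \<and> F \<le> sequentially \<and>
     (\<forall>a :: nat \<Rightarrow> real. Bseq a \<longrightarrow> (\<exists>l. (a \<longlongrightarrow> l) F))"
proof -
  \<comment> \<open>Unbounded sequences are sent to \<open>0\<close>, which keeps every factor of the product compact.\<close>
  define e :: "nat \<Rightarrow> (nat \<Rightarrow> real) \<Rightarrow> real" where "e n a = (if Bseq a then a n else 0)" for n a
  define c :: "(nat \<Rightarrow> real) \<Rightarrow> real" where "c a = (SOME C. \<forall>n. \<bar>e n a\<bar> \<le> C)" for a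
  have c: "\<bar>e n a\<bar> \<le> c a" for n a
  proof -
    have "\<exists>C. \<forall>n. \<bar>e n a\<bar> \<le> C"
    proof (cases "Bseq a")
      case True
      then obtain C where "\<forall>n. norm (a n) \<le> C" unfolding Bseq_def by blast
      thus ?thesis using True by (intro exI[of _ C]) (auto simp: e_def)
    qed (auto simp: e_def intro: exI[of _ 0])
    from someI_ex[OF this] show ?thesis unfolding c_def by blast
  qed
  define S where "S = Pi\<^sub>E UNIV (\<lambda>a. {- c a .. c a})"
  have "compactin (product_topology (\<lambda>_. euclidean) UNIV) S"
    unfolding S_def compactin_PiE by simp
  hence "compact S" by (simp add: euclidean_product_topology)
  moreover have "filtermap e sequentially \<noteq> bot" by (simp add: filtermap_bot_iff)
  moreover have "e n \<in> S" for n
    using c[of n] by (auto simp: S_def abs_le_iff minus_le_iff)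
  hence "eventually (\<lambda>x. x \<in> S) (filtermap e sequentially)" by (simp add: eventually_filtermap)
  ultimately obtain x where x: "inf (nhds x) (filtermap e sequentially) \<noteq> bot"
    unfolding compact_filter by blast
  \<comment> \<open>The coarsest filter that is finer than \<open>sequentially\<close> and along which \<open>e\<close> tends to \<open>x\<close>; it is nontrivial
    because \<open>x\<close> is a cluster point.\<close>
  define F where "F = inf (filtercomap e (nhds x)) sequentially"
  have "F \<noteq> bot"
  proof
    assume "F = bot"
    hence "eventually (\<lambda>_. False) F" by simp
    then obtain P Q where PQ: "eventually P (filtercomap e (nhds x))" "eventually Q sequentially"
        "\<And>n. P n \<Longrightarrow> Q n \<Longrightarrow> False"
      unfolding F_def eventually_inf by blast
    from PQ(1) obtain P' where P': "eventually P' (nhds x)" "\<And>n. P' (e n) \<Longrightarrow> P n"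
      unfolding eventually_filtercomap by blast
    have "eventually (\<lambda>y. \<exists>n. Q n \<and> y = e n) (filtermap e sequentially)"
      unfolding eventually_filtermap using PQ(2) by eventually_elim auto
    with P'(1) have "eventually (\<lambda>_. False) (inf (nhds x) (filtermap e sequentially))"
      unfolding eventually_inf using P'(2) PQ(3) by blast
    with x show False by (simp add: trivial_limit_def)
  qed
  moreover have "F \<le> sequentially" unfolding F_def by simp
  moreover have "\<exists>l. (a \<longlongrightarrow> l) F" if a: "Bseq a" for a :: "nat \<Rightarrow> real"
  proof -
    have e: "filterlim e (nhds x) F"
      unfolding F_def by (metis filterlim_filtercomap filterlim_mono inf.cobounded1 order_refl)
    have "continuous_on UNIV (\<lambda>f :: (nat \<Rightarrow> real) \<Rightarrow> real. f a)" by simp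
    hence "((\<lambda>f. f a) \<longlongrightarrow> x a) (nhds x)"
      using tendsto_at_iff_tendsto_nhds[of "\<lambda>f. f a" x] by (simp add: continuous_on_def)
    hence "((\<lambda>n. e n a) \<longlongrightarrow> x a) F" by (rule filterlim_compose[OF _ e])
    thus ?thesis using a by (auto simp: e_def)
  qed
  ultimately show ?thesis by blast
qed

locale generalized_limit =
  fixes F :: "nat filter"
  assumes F_nontriv: "F \<noteq> bot"
    and F_sequentially: "F \<le> sequentially"
    and F_converges: "\<And>a :: nat \<Rightarrow> real. Bseq a \<Longrightarrow> \<exists>l. (a \<longlongrightarrow> l) F"
begin

lemma tendsto_F: "a \<longlonglongrightarrow> l \<Longrightarrow> (a \<longlongrightarrow> l) F"
  using F_sequentially filterlim_mono by blast

lemma F_const: "((\<lambda>_. c :: real) \<longlongrightarrow> l) F \<Longrightarrow> c = l"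
  using F_nontriv tendsto_const_iff by blast

lemma F_unique: "(a \<longlongrightarrow> l) F \<Longrightarrow> (a \<longlongrightarrow> l') F \<Longrightarrow> l = (l' :: real)"
  using F_nontriv tendsto_unique by blast

lemma F_le:
  assumes "(a \<longlongrightarrow> l) F" "(b \<longlongrightarrow> l') F" "\<And>n. a n \<le> (b n :: real)"
  shows "l \<le> l'"
  using tendsto_le[OF F_nontriv assms(2,1)] assms(3) by simp

lemma F_upper: "(a \<longlongrightarrow> l) F \<Longrightarrow> (\<And>n. a n \<le> (c :: real)) \<Longrightarrow> l \<le> c"
  using F_le[OF _ tendsto_const] by blast

lemma F_lower: "(a \<longlongrightarrow> l) F \<Longrightarrow> (\<And>n. (c :: real) \<le> a n) \<Longrightarrow> c \<le> l"
  using F_le[OF tendsto_const] by blast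

lemma F_Lim:
  assumes "\<And>n. \<bar>a n\<bar> \<le> (C :: real)"
  shows "(a \<longlongrightarrow> Lim F a) F"
proof -
  have "Bseq a" using assms by (intro BseqI'[of _ C]) auto
  then obtain l where "(a \<longlongrightarrow> l) F" using F_converges by blast
  thus ?thesis using tendsto_Lim[OF F_nontriv] by auto
qed

text \<open>The approximants may change with the error, so that truncations and roundings are removed one error at a
  time.\<close>
lemma F_tendsto_approx:
  fixes a :: "nat \<Rightarrow> real"
  assumes "\<And>e. e > 0 \<Longrightarrow> \<exists>b l'. (b \<longlongrightarrow> l') F \<and> (\<forall>\<^sub>F n in F. \<bar>a n - b n\<bar> \<le> e) \<and> \<bar>l - l'\<bar> \<le> e"
  shows "(a \<longlongrightarrow> l) F"
proof (rule tendstoI)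
  fix e :: real assume "e > 0"
  then obtain b l' where b: "(b \<longlongrightarrow> l') F" "\<forall>\<^sub>F n in F. \<bar>a n - b n\<bar> \<le> e/4" "\<bar>l - l'\<bar> \<le> e/4"
    using assms[of "e/4"] by auto
  have "\<forall>\<^sub>F n in F. dist (b n) l' < e/4" using b(1) \<open>e > 0\<close> by (intro tendstoD) auto
  with b(2) show "\<forall>\<^sub>F n in F. dist (a n) l < e"
  proof eventually_elim
    case (elim n)
    have "\<bar>a n - l\<bar> \<le> \<bar>a n - b n\<bar> + \<bar>b n - l'\<bar> + \<bar>l - l'\<bar>" by linarith
    thus ?case using elim b(3) \<open>e > 0\<close> by (simp add: dist_real_def)
  qed
qed

end

section \<open>Setwise limits of measures\<close>

text \<open>The reference measure \<open>P\<close> will be finite; then smallness for \<open>P\<close> covers both sets of small Lebesgue measure and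
  sets far away, and uniform absolute continuity excludes concentration as well as escape to infinity.\<close>
definition uniformly_ac :: "'a measure \<Rightarrow> (nat \<Rightarrow> 'a measure) \<Rightarrow> bool" where
  "uniformly_ac P N \<longleftrightarrow> (\<forall>\<epsilon>>0. \<exists>\<delta>>0. \<forall>n. \<forall>A\<in>sets P. measure P A < \<delta> \<longrightarrow> measure (N n) A < (\<epsilon> :: real))"

locale measure_family = generalized_limit +
  fixes P :: "'a measure" and N :: "nat \<Rightarrow> 'a measure" and m :: real
  assumes P_finite: "finite_measure P"
    and N_finite: "\<And>n. finite_measure (N n)"
    and N_sets[measurable_cong]: "\<And>n. sets (N n) = sets P"
    and N_bound: "\<And>n. measure (N n) (space P) \<le> m"
    and N_uac: "uniformly_ac P N"
begin

sublocale P: finite_measure P by (rule P_finite)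

lemma N_space: "space (N n) = space P"
  using N_sets[of n] by (rule sets_eq_imp_space_eq)

lemma N_measure_le: "measure (N n) A \<le> m"
proof -
  interpret finite_measure "N n" by (rule N_finite)
  have "measure (N n) A \<le> measure (N n) (space (N n))" by (rule bounded_measure)
  thus ?thesis using N_bound[of n] by (simp add: N_space)
qed

lemma m_nonneg: "0 \<le> m"
  using N_measure_le[of 0 "{}"] by simp

definition limit_value :: "'a set \<Rightarrow> real" where
  "limit_value A = Lim F (\<lambda>n. measure (N n) A)"

lemma limit_value: "((\<lambda>n. measure (N n) A) \<longlongrightarrow> limit_value A) F"
  unfolding limit_value_def by (rule F_Lim[of _ m]) (simp add: N_measure_le)

lemma limit_value_nonneg: "0 \<le> limit_value A"
  by (rule F_lower[OF limit_value]) simp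

lemma limit_value_small:
  assumes "\<epsilon> > 0"
  shows "\<exists>\<delta>>0. \<forall>A\<in>sets P. measure P A < \<delta> \<longrightarrow> limit_value A \<le> \<epsilon>"
  using N_uac[unfolded uniformly_ac_def, rule_format, OF assms]
  by (metis F_upper[OF limit_value] less_imp_le)

definition limit_measure :: "'a measure" where
  "limit_measure = measure_of (space P) (sets P) (\<lambda>A. ennreal (limit_value A))"

lemma sets_limit_measure[simp, measurable_cong]: "sets limit_measure = sets P"
  unfolding limit_measure_def by simp

lemma space_limit_measure[simp]: "space limit_measure = space P"
  unfolding limit_measure_def by simp

text \<open>Setwise limits of measures are only finitely additive in general; it is the uniform
  absolute continuity that forbids mass to disappear along a decreasing sequence of sets.\<close>
lemma emeasure_limit_measure:
  assumes A: "A \<in> sets P"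
  shows "emeasure limit_measure A = ennreal (limit_value A)"
  unfolding limit_measure_def
proof (rule emeasure_measure_of_sigma[OF _ _ _ A])
  show "sigma_algebra (space P) (sets P)" by (rule sets.sigma_algebra_axioms)
  have empty: "limit_value {} = 0"
    using F_const[of 0] limit_value[of "{}"] by simp
  show pos: "positive (sets P) (\<lambda>A. ennreal (limit_value A))"
    by (simp add: positive_def empty)
  have add: "limit_value (A \<union> B) = limit_value A + limit_value B"
    if "A \<in> sets P" "B \<in> sets P" "A \<inter> B = {}" for A B
  proof -
    have "measure (N n) (A \<union> B) = measure (N n) A + measure (N n) B" for n
      using that N_finite finite_measure.finite_measure_Union N_sets by metis
    thus ?thesis
      using F_unique[OF limit_value[of "A \<union> B"]] tendsto_add[OF limit_value[of A] limit_value[of B]]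
      by simp
  qed
  show "countably_additive (sets P) (\<lambda>A. ennreal (limit_value A))"
  proof (rule sets.empty_continuous_imp_countably_additive[OF pos])
    show "additive (sets P) (\<lambda>A. ennreal (limit_value A))"
      by (auto simp: additive_def add ennreal_plus limit_value_nonneg simp del: ennreal_plus)
         (simp add: ennreal_plus limit_value_nonneg)
    show "\<forall>A\<in>sets P. ennreal (limit_value A) \<noteq> \<infinity>" by simp
    fix A :: "nat \<Rightarrow> 'a set"
    assume A: "range A \<subseteq> sets P" "decseq A" "(\<Inter>i. A i) = {}"
    have PA: "(\<lambda>i. measure P (A i)) \<longlonglongrightarrow> 0"
      using P.finite_Lim_measure_decseq[OF A(1,2)] A(3) by simp
    have "(\<lambda>i. limit_value (A i)) \<longlonglongrightarrow> 0"
    proof (rule LIMSEQ_I)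
      fix r :: real assume "r > 0"
      then obtain \<delta> where \<delta>: "\<delta> > 0" "\<And>A. A \<in> sets P \<Longrightarrow> measure P A < \<delta> \<Longrightarrow> limit_value A \<le> r/2"
        using limit_value_small[of "r/2"] by auto
      from LIMSEQ_D[OF PA \<delta>(1)] obtain n0 where "\<And>n. n \<ge> n0 \<Longrightarrow> measure P (A n) < \<delta>" by auto
      hence "norm (limit_value (A n) - 0) < r" if "n \<ge> n0" for n
        using \<delta>(2)[of "A n"] A(1) that limit_value_nonneg[of "A n"] \<open>r > 0\<close> by fastforce
      thus "\<exists>n0. \<forall>n\<ge>n0. norm (limit_value (A n) - 0) < r" by blast
    qed
    thus "(\<lambda>i. ennreal (limit_value (A i))) \<longlonglongrightarrow> 0"
      using tendsto_ennrealI by fastforce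
  qed
qed

lemma measure_limit_measure: "A \<in> sets P \<Longrightarrow> measure limit_measure A = limit_value A"
  by (simp add: measure_def emeasure_limit_measure limit_value_nonneg)

lemma finite_limit_measure: "finite_measure limit_measure"
  by (rule finite_measureI) (simp add: emeasure_limit_measure)

sublocale Q: finite_measure limit_measure by (rule finite_limit_measure)

lemma tendsto_measure:
  "A \<in> sets P \<Longrightarrow> ((\<lambda>n. measure (N n) A) \<longlongrightarrow> measure limit_measure A) F"
  by (simp add: measure_limit_measure limit_value)

lemma limit_measure_ac: "absolutely_continuous P limit_measure"
  unfolding absolutely_continuous_def null_sets_def
proof safe
  fix A assume A: "A \<in> sets P" "emeasure P A = 0"
  have "limit_value A \<le> \<epsilon>" if "\<epsilon> > 0" for \<epsilon>
    using limit_value_small[OF that] A by (auto simp: measure_def)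
  hence "limit_value A \<le> 0" by (rule field_le_epsilon) simp
  with A(1) limit_value_nonneg[of A] show "emeasure limit_measure A = 0"
    by (simp add: emeasure_limit_measure)
qed simp

text \<open>A bounded function is uniformly close to the function obtained by rounding its values down
  to multiples of \<open>\<epsilon>\<close>, which takes finitely many values.\<close>
lemma tendsto_integral_bounded:
  assumes \<theta>[measurable]: "\<theta> \<in> borel_measurable P" and bd: "\<And>x. \<bar>\<theta> x\<bar> \<le> (c :: real)"
  shows "((\<lambda>n. LINT x|N n. \<theta> x) \<longlongrightarrow> (LINT x|limit_measure. \<theta> x)) F"
proof (rule F_tendsto_approx)
  fix e :: real assume "e > 0"
  define \<epsilon> where "\<epsilon> = e / (m + 1)"
  have \<epsilon>: "\<epsilon> > 0" "m * \<epsilon> \<le> e" using \<open>e > 0\<close> m_nonneg by (auto simp: \<epsilon>_def field_simps)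
  define A where "A j = {x \<in> space P. \<lfloor>\<theta> x / \<epsilon>\<rfloor> = j}" for j
  have A[measurable]: "A j \<in> sets P" for j unfolding A_def by measurable
  define J where "J = {\<lfloor>- c / \<epsilon>\<rfloor> .. \<lfloor>c / \<epsilon>\<rfloor>}"
  define \<phi> where "\<phi> x = (\<Sum>j\<in>J. (\<epsilon> * of_int j) * indicator (A j) x)" for x
  have [measurable]: "\<phi> \<in> borel_measurable P" unfolding \<phi>_def by measurable
  have \<phi>: "\<phi> x = \<epsilon> * of_int \<lfloor>\<theta> x / \<epsilon>\<rfloor>" if x: "x \<in> space P" for x
  proof -
    have "\<lfloor>\<theta> x / \<epsilon>\<rfloor> \<in> J" unfolding J_def
      using bd[of x] \<epsilon>(1)
      by (auto intro!: floor_mono divide_right_mono simp: abs_le_iff minus_divide_left simp del: minus_divide_left[symmetric])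
    moreover have "(\<epsilon> * of_int j) * indicator (A j) x
        = (if j = \<lfloor>\<theta> x / \<epsilon>\<rfloor> then \<epsilon> * of_int \<lfloor>\<theta> x / \<epsilon>\<rfloor> else 0)" for j
      using x by (auto simp: A_def indicator_def)
    ultimately show ?thesis unfolding \<phi>_def by (simp add: J_def)
  qed
  have close: "\<bar>\<theta> x - \<phi> x\<bar> \<le> \<epsilon>" if "x \<in> space P" for x
  proof -
    have "\<epsilon> * of_int \<lfloor>\<theta> x / \<epsilon>\<rfloor> \<le> \<epsilon> * (\<theta> x / \<epsilon>)" "\<epsilon> * (\<theta> x / \<epsilon>) \<le> \<epsilon> * (of_int \<lfloor>\<theta> x / \<epsilon>\<rfloor> + 1)"
      using \<epsilon>(1) by (intro mult_left_mono; linarith)+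
    thus ?thesis unfolding \<phi>[OF that] using \<epsilon>(1) by (simp add: abs_le_iff distrib_left)
  qed
  have int\<phi>: "(LINT x|M. \<phi> x) = (\<Sum>j\<in>J. (\<epsilon> * of_int j) * measure M (A j))" 
    if M: "finite_measure M" "sets M = sets P" for M
  proof -
    interpret finite_measure M by (rule M(1))
    have [measurable]: "A j \<in> sets M" for j using M by simp
    have "(LINT x|M. \<phi> x) = (\<Sum>j\<in>J. LINT x|M. (\<epsilon> * of_int j) * indicator (A j) x)" unfolding \<phi>_def
      by (intro Bochner_Integration.integral_sum integrable_mult_right integrable_real_indicator)
         (auto simp: emeasure_eq_measure)
    thus ?thesis by (simp add: emeasure_eq_measure)
  qed
  have diff: "\<bar>(LINT x|M. \<theta> x) - (LINT x|M. \<phi> x)\<bar> \<le> e"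
    if M: "finite_measure M" "sets M = sets P" "measure M (space P) \<le> m" for M
  proof -
    interpret finite_measure M by (rule M(1))
    have sp: "space M = space P" using M(2) by (rule sets_eq_imp_space_eq)
    have [measurable_cong]: "sets M = sets P" by (rule M)
    have i\<theta>: "integrable M \<theta>" using bd by (intro integrable_const_bound[of _ c]) auto
    have i\<phi>: "integrable M \<phi>"
    proof (rule integrable_const_bound[of _ "c + \<epsilon>"])
      show "AE x in M. norm (\<phi> x) \<le> c + \<epsilon>"
      proof (rule AE_I2)
        fix x assume "x \<in> space M"
        thus "norm (\<phi> x) \<le> c + \<epsilon>" using close[of x] bd[of x] sp by (auto simp: abs_le_iff)
      qed
    qed measurable
    have "\<bar>(LINT x|M. \<theta> x) - (LINT x|M. \<phi> x)\<bar> = \<bar>LINT x|M. \<theta> x - \<phi> x\<bar>" using i\<theta> i\<phi> by simp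
    also have "\<dots> \<le> (LINT x|M. \<bar>\<theta> x - \<phi> x\<bar>)" by (rule integral_abs_bound)
    also have "\<dots> \<le> (LINT x|M. \<epsilon>)"
      using i\<theta> i\<phi> close sp by (intro integral_mono) auto
    also have "\<dots> = measure M (space P) * \<epsilon>" by (simp add: sp)
    also have "\<dots> \<le> m * \<epsilon>" using M(3) \<epsilon>(1) by (intro mult_right_mono) auto
    finally show ?thesis using \<epsilon>(2) by linarith
  qed
  have "measure limit_measure (space P) \<le> m"
    by (rule F_upper[OF tendsto_measure]) (auto simp: N_measure_le)
  hence "\<bar>(LINT x|limit_measure. \<theta> x) - (LINT x|limit_measure. \<phi> x)\<bar> \<le> e"
    by (intro diff) (auto intro: finite_limit_measure)
  moreover have "((\<lambda>n. LINT x|N n. \<phi> x) \<longlongrightarrow> (LINT x|limit_measure. \<phi> x)) F"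
    by (simp add: int\<phi> N_finite N_sets finite_limit_measure)
       (intro tendsto_sum tendsto_mult tendsto_const tendsto_measure, simp)
  moreover have "\<bar>(LINT x|N n. \<theta> x) - (LINT x|N n. \<phi> x)\<bar> \<le> e" for n
    by (intro diff N_finite N_sets N_bound)
  ultimately show "\<exists>b l'. (b \<longlongrightarrow> l') F \<and>
      (\<forall>\<^sub>F n in F. \<bar>(LINT x|N n. \<theta> x) - b n\<bar> \<le> e) \<and> \<bar>(LINT x|limit_measure. \<theta> x) - l'\<bar> \<le> e"
    by (intro exI conjI) auto
qed

text \<open>Where the weight exceeds a high level, both integrands contribute little, uniformly in \<open>n\<close>; below that level
  \<open>H\<close> is bounded and, for large \<open>n\<close>, equal to \<open>H' n\<close>.  Cut-off kernels enter as \<open>H'\<close>.\<close>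
lemma tendsto_integral_weight:
  assumes [measurable]: "w \<in> borel_measurable P" "H \<in> borel_measurable P"
      "\<And>n. H' n \<in> borel_measurable P"
    and H: "\<And>x. \<bar>H x\<bar> \<le> w x" "\<And>n x. \<bar>H' n x\<bar> \<le> (w x :: real)"
    and eq: "\<And>n x. w x \<le> real n \<Longrightarrow> H' n x = H x"
    and wN: "\<And>n. integrable (N n) w"
    and tail: "\<And>e. e > 0 \<Longrightarrow> \<exists>R. \<forall>n. (LINT x|N n. indicator {x. R < w x} x * w x) \<le> e"
  shows "integrable limit_measure w"
    and "((\<lambda>n. LINT x|N n. H' n x) \<longlongrightarrow> (LINT x|limit_measure. H x)) F"
proof -
  have w0: "0 \<le> w x" for x using H(1)[of x] by linarith
  have tail_mono: "\<exists>R\<ge>R0. \<forall>n. (LINT x|N n. indicator {x. R < w x} x * w x) \<le> e" if "e > 0" for e R0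
  proof -
    obtain R where R: "\<And>n. (LINT x|N n. indicator {x. R < w x} x * w x) \<le> e" using tail[OF \<open>e>0\<close>] by blast
    have "(LINT x|N n. indicator {x. max R R0 < w x} x * w x) \<le> (LINT x|N n. indicator {x. R < w x} x * w x)" for n
      using w0 by (intro integral_mono Bochner_Integration.integrable_bound[OF wN[of n]])
        (auto simp: indicator_def)
    thus ?thesis using R by (intro exI[of _ "max R R0"]) (auto intro: order_trans)
  qed
  obtain R1 where R1: "R1 \<ge> 0" "\<And>n. (LINT x|N n. indicator {x. R1 < w x} x * w x) \<le> 1"
    using tail_mono[of 1 0] by auto
  \<comment> \<open>The limit measure integrates the weight by monotone convergence of its truncations, whose integrals pass to the
    limit.\<close>
  have wbound: "(LINT x|N n. w x) \<le> R1 * m + 1" for n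
  proof -
    interpret finite_measure "N n" by (rule N_finite)
    have "(LINT x|N n. w x) \<le> (LINT x|N n. R1 + indicator {x. R1 < w x} x * w x)"
      using w0 R1(1) by (intro integral_mono wN Bochner_Integration.integrable_add integrable_const
           Bochner_Integration.integrable_bound[OF wN[of n]]) (auto simp: indicator_def)
    also have "\<dots> = measure (N n) (space P) * R1 + (LINT x|N n. indicator {x. R1 < w x} x * w x)"
      using w0 by (subst Bochner_Integration.integral_add)
         (auto simp: N_space indicator_def intro!: Bochner_Integration.integrable_bound[OF wN[of n]])
    also have "\<dots> \<le> m * R1 + 1"
      using N_bound[of n] R1 by (intro add_mono mult_right_mono) auto
    finally show ?thesis by (simp add: mult.commute)
  qed
  have trunc: "(LINT x|limit_measure. min (w x) (real k)) \<le> R1 * m + 1" for k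
  proof (rule F_upper[OF tendsto_integral_bounded[of _ "real k"]])
    fix n
    have "(LINT x|N n. min (w x) (real k)) \<le> (LINT x|N n. w x)"
      using w0 by (intro integral_mono Bochner_Integration.integrable_bound[OF wN[of n]] wN) auto
    thus "(LINT x|N n. min (w x) (real k)) \<le> R1 * m + 1" using wbound[of n] by linarith
  qed (use w0 in auto)
  have itr: "integrable limit_measure (\<lambda>x. min (w x) (real k))" for k
    using w0 by (intro Q.integrable_const_bound[of _ "real k"]) auto
  show wQ: "integrable limit_measure w"
  proof -
    have inc: "mono (\<lambda>k. LINT x|limit_measure. min (w x) (real k))"
      using itr by (intro monoI integral_mono) auto
    have "convergent (\<lambda>k. LINT x|limit_measure. min (w x) (real k))"
      using trunc inc by (intro Bseq_mono_convergent BseqI'[of _ "R1 * m + 1"])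
        (auto simp: mono_def abs_of_nonneg w0)
    then obtain L where L: "(\<lambda>k. LINT x|limit_measure. min (w x) (real k)) \<longlonglongrightarrow> L" 
      by (auto simp: convergent_def)
    show ?thesis
    proof (rule integrable_monotone_convergence[OF itr _ _ L])
      show "AE x in limit_measure. mono (\<lambda>k. min (w x) (real k))" by (auto simp: mono_def)
      show "AE x in limit_measure. (\<lambda>k. min (w x) (real k)) \<longlonglongrightarrow> w x"
      proof (rule AE_I2)
        fix x
        have "\<forall>\<^sub>F k in sequentially. min (w x) (real k) = w x"
          using eventually_ge_at_top[of "nat \<lceil>w x\<rceil>"] by eventually_elim (auto simp: min_def)
        thus "(\<lambda>k. min (w x) (real k)) \<longlonglongrightarrow> w x" by (rule tendsto_eventually)
      qed
    qed measurable
  qed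
  show "((\<lambda>n. LINT x|N n. H' n x) \<longlongrightarrow> (LINT x|limit_measure. H x)) F"
  proof (rule F_tendsto_approx)
    fix e :: real assume e: "e > 0"
    have "(\<lambda>k. LINT x|limit_measure. indicator {x. real k < w x} x * w x) \<longlonglongrightarrow> (LINT x|limit_measure. 0)"
    proof (rule integral_dominated_convergence[OF _ _ wQ])
      show "AE x in limit_measure. (\<lambda>k. indicator {x. real k < w x} x * w x) \<longlonglongrightarrow> 0"
      proof (rule AE_I2)
        fix x
        have "\<forall>\<^sub>F k in sequentially. indicator {x. real k < w x} x * w x = 0"
          using eventually_ge_at_top[of "nat \<lceil>w x\<rceil>"] by eventually_elim (auto simp: indicator_def; linarith)
        thus "(\<lambda>k. indicator {x. real k < w x} x * w x) \<longlonglongrightarrow> 0" by (rule tendsto_eventually)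
      qed
    qed (use w0 in \<open>auto simp: indicator_def\<close>)
    from LIMSEQ_D[OF this e] obtain k0 where
      "\<And>k. k \<ge> k0 \<Longrightarrow> \<bar>LINT x|limit_measure. indicator {x. real k < w x} x * w x\<bar> < e"
      by auto
    hence k0: "k \<ge> k0 \<Longrightarrow> (LINT x|limit_measure. indicator {x. real k < w x} x * w x) < e" for k
      using abs_less_iff by blast
    obtain R where R: "R \<ge> real k0" "\<And>n. (LINT x|N n. indicator {x. R < w x} x * w x) \<le> e"
      using tail_mono[OF e] by blast
    define k where "k = nat \<lceil>R\<rceil>"
    have k: "R \<le> real k" "k0 \<le> k" using R(1) unfolding k_def by linarith+
    define b where "b x = indicator {x. w x \<le> real k} x * H x" for x
    have [measurable]: "b \<in> borel_measurable P" unfolding b_def by measurable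
    have bb: "\<bar>b x\<bar> \<le> real k" for x using H(1)[of x] unfolding b_def indicator_def by auto
    have bw: "\<bar>b x\<bar> \<le> w x" for x using H(1)[of x] w0[of x] unfolding b_def indicator_def by auto
    have est: "\<bar>(LINT x|M. G x) - (LINT x|M. b x)\<bar> \<le> (LINT x|M. indicator {x. r < w x} x * w x)"
      if M[measurable_cong]: "sets M = sets P" "integrable M w" and G[measurable]: "G \<in> borel_measurable P"
        and G2: "\<And>x. \<bar>G x\<bar> \<le> w x" "\<And>x. w x \<le> real k \<Longrightarrow> G x = H x" and r: "r \<le> real k" for M G r
    proof -
      have iG: "integrable M G" 
        using G2(1) w0 by (intro Bochner_Integration.integrable_bound[OF M(2)]) auto
      have ib: "integrable M b" 
        using bw w0 by (intro Bochner_Integration.integrable_bound[OF M(2)]) auto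
      have it: "integrable M (\<lambda>x. indicator {x. r < w x} x * w x)"
        using w0 by (intro Bochner_Integration.integrable_bound[OF M(2)]) (auto simp: indicator_def)
      have "\<bar>(LINT x|M. G x) - (LINT x|M. b x)\<bar> = \<bar>LINT x|M. G x - b x\<bar>" using iG ib by simp
      also have "\<dots> \<le> (LINT x|M. \<bar>G x - b x\<bar>)" by (rule integral_abs_bound)
      also have "\<dots> \<le> (LINT x|M. indicator {x. r < w x} x * w x)"
      proof (intro integral_mono it)
        fix x
        show "\<bar>G x - b x\<bar> \<le> indicator {x. r < w x} x * w x"
          using G2[of x] r unfolding b_def indicator_def by auto
      qed (use iG ib in auto)
      finally show ?thesis .
    qed
    have "((\<lambda>n. LINT x|N n. b x) \<longlongrightarrow> (LINT x|limit_measure. b x)) F"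
      by (rule tendsto_integral_bounded[OF _ bb]) measurable
    moreover have "\<forall>\<^sub>F n in F. \<bar>(LINT x|N n. H' n x) - (LINT x|N n. b x)\<bar> \<le> e"
    proof -
      have "\<forall>\<^sub>F n in F. n \<ge> k" using F_sequentially eventually_ge_at_top filter_leD by blast
      thus ?thesis
      proof eventually_elim
        case (elim n)
        have "\<bar>(LINT x|N n. H' n x) - (LINT x|N n. b x)\<bar> \<le> (LINT x|N n. indicator {x. R < w x} x * w x)"
          by (rule est) (use wN N_sets H(2) eq elim k in \<open>auto\<close>)
        thus ?case using R(2)[of n] by linarith
      qed
    qed
    moreover have "\<bar>(LINT x|limit_measure. H x) - (LINT x|limit_measure. b x)\<bar> \<le> e"
      using est[of limit_measure H "real k"] wQ H(1) k0[OF k(2)] by fastforce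
    ultimately show "\<exists>b l'. (b \<longlongrightarrow> l') F \<and> (\<forall>\<^sub>F n in F. \<bar>(LINT x|N n. H' n x) - b n\<bar> \<le> e) \<and>
        \<bar>(LINT x|limit_measure. H x) - l'\<bar> \<le> e" by blast
  qed
qed

end

section \<open>Squares of measures\<close>

context measure_family
begin

text \<open>If \<open>A\<close> is small for \<open>P \<Otimes> P\<close>, then by Chebyshev's inequality all sections of \<open>A\<close>, except for
  those over a small set, are small for \<open>P\<close>.\<close>
lemma uniformly_ac_square: "uniformly_ac (P \<Otimes>\<^sub>M P) (\<lambda>n. N n \<Otimes>\<^sub>M N n)"
  unfolding uniformly_ac_def
proof (intro allI impI)
  fix \<epsilon> :: real assume "\<epsilon> > 0"
  define \<epsilon>' where "\<epsilon>' = \<epsilon> / (2 * m + 1)"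
  have \<epsilon>': "\<epsilon>' > 0" "2 * m * \<epsilon>' < \<epsilon>" using \<open>\<epsilon> > 0\<close> m_nonneg by (auto simp: \<epsilon>'_def field_simps)
  obtain \<delta> where \<delta>: "\<delta> > 0" "\<And>n A. A \<in> sets P \<Longrightarrow> measure P A < \<delta> \<Longrightarrow> measure (N n) A < \<epsilon>'"
    using N_uac[unfolded uniformly_ac_def, rule_format, OF \<epsilon>'(1)] by blast
  interpret PP: pair_sigma_finite P P ..
  interpret PPf: finite_measure "P \<Otimes>\<^sub>M P" by (rule finite_measure_pair_measure) unfold_locales
  have "measure (N n \<Otimes>\<^sub>M N n) A < \<epsilon>" if A[measurable]: "A \<in> sets (P \<Otimes>\<^sub>M P)" and small: "measure (P \<Otimes>\<^sub>M P) A < \<delta> * \<delta>" for n A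
  proof -
    interpret N: finite_measure "N n" by (rule N_finite)
    interpret NN: pair_sigma_finite "N n" "N n" ..
    interpret NNf: finite_measure "N n \<Otimes>\<^sub>M N n" by (rule finite_measure_pair_measure) unfold_locales
    have sect[measurable]: "Pair x -` A \<in> sets P" for x by (rule sets_Pair1[OF A])
    have sectP: "(\<lambda>x. measure P (Pair x -` A)) \<in> borel_measurable P"
      unfolding measure_def using P.measurable_emeasure_Pair[OF A] by measurable
    have AN: "A \<in> sets (N n \<Otimes>\<^sub>M N n)"
      using A sets_pair_measure_cong[OF N_sets N_sets] by blast
    have sectN: "(\<lambda>x. measure (N n) (Pair x -` A)) \<in> borel_measurable (N n)"
      unfolding measure_def using N.measurable_emeasure_Pair[OF AN] by measurable
    \<comment> \<open>The exceptional points, whose sections are not small.\<close>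
    define B where "B = {x \<in> space P. \<delta> \<le> measure P (Pair x -` A)}"
    have B[measurable]: "B \<in> sets P" unfolding B_def using sectP by measurable
    have fubini: "measure (M \<Otimes>\<^sub>M M) A = (LINT x|M. measure M (Pair x -` A))"
      if M: "finite_measure M" "sets M = sets P" for M
    proof -
      interpret M: finite_measure M by fact
      interpret MM: finite_measure "M \<Otimes>\<^sub>M M" by (rule finite_measure_pair_measure) unfold_locales
      have A': "A \<in> sets (M \<Otimes>\<^sub>M M)" using A sets_pair_measure_cong[OF M(2) M(2)] by blast
      have "ennreal (measure (M \<Otimes>\<^sub>M M) A) = (\<integral>\<^sup>+x. emeasure M (Pair x -` A) \<partial>M)"
        using M.emeasure_pair_measure_alt[OF A'] by (simp add: MM.emeasure_eq_measure)
      also have "\<dots> = (\<integral>\<^sup>+x. ennreal (measure M (Pair x -` A)) \<partial>M)"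
        by (simp add: M.emeasure_eq_measure)
      also have "\<dots> = ennreal (LINT x|M. measure M (Pair x -` A))"
      proof (rule nn_integral_eq_integral)
        have "(\<lambda>x. measure M (Pair x -` A)) \<in> borel_measurable M"
          unfolding measure_def using M.measurable_emeasure_Pair[OF A'] by measurable
        thus "integrable M (\<lambda>x. measure M (Pair x -` A))"
          by (intro M.integrable_const_bound[of _ "measure M (space M)"]) (auto simp: M.bounded_measure)
      qed simp
      finally show ?thesis by (simp add: integral_nonneg_AE)
    qed
    have "\<delta> * measure P B = (LINT x|P. \<delta> * indicator B x)" by simp
    also have "\<dots> \<le> (LINT x|P. measure P (Pair x -` A))"
    proof (intro integral_mono)
      show "integrable P (\<lambda>x. measure P (Pair x -` A))"
        using sectP by (intro P.integrable_const_bound[of _ "measure P (space P)"]) (auto simp: P.bounded_measure)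
      show "integrable P (\<lambda>x. \<delta> * indicator B x)"
        by (intro integrable_mult_right integrable_real_indicator) (auto simp: P.emeasure_eq_measure)
    qed (auto simp: B_def indicator_def)
    also have "\<dots> = measure (P \<Otimes>\<^sub>M P) A" by (rule fubini[symmetric]) (auto simp: P_finite)
    also have "\<dots> < \<delta> * \<delta>" by (rule small)
    finally have "measure P B < \<delta>" using \<delta>(1) by simp
    hence NB: "measure (N n) B < \<epsilon>'" by (rule \<delta>(2)[OF B])
    have BN[measurable]: "B \<in> sets (N n)" using B by (simp add: N_sets)
    have "measure (N n \<Otimes>\<^sub>M N n) A = (LINT x|N n. measure (N n) (Pair x -` A))"
      by (rule fubini) (auto simp: N_finite N_sets)
    also have "\<dots> \<le> (LINT x|N n. m * indicator B x + \<epsilon>')"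
    proof (intro integral_mono)
      show "integrable (N n) (\<lambda>x. measure (N n) (Pair x -` A))"
        using sectN by (intro N.integrable_const_bound[of _ m]) (auto simp: N_measure_le)
      show "integrable (N n) (\<lambda>x. m * indicator B x + \<epsilon>')"
        by (intro Bochner_Integration.integrable_add integrable_mult_right integrable_real_indicator)
           (auto simp: N.emeasure_eq_measure)
      fix x assume "x \<in> space (N n)"
      hence "x \<in> space P" by (simp add: N_space)
      thus "measure (N n) (Pair x -` A) \<le> m * indicator B x + \<epsilon>'"
        using \<epsilon>'(1) N_measure_le[of n "Pair x -` A"] \<delta>(2)[OF sect, of x n]
        by (auto simp: B_def indicator_def not_le)
    qed
    also have "\<dots> = m * measure (N n) B + measure (N n) (space P) * \<epsilon>'"
      by (subst Bochner_Integration.integral_add)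
         (auto simp: N_space N.emeasure_eq_measure intro!: integrable_mult_right integrable_real_indicator)
    also have "\<dots> \<le> m * \<epsilon>' + m * \<epsilon>'"
      using NB N_bound[of n] \<epsilon>'(1) m_nonneg by (intro add_mono mult_left_mono mult_right_mono) auto
    finally show ?thesis using \<epsilon>'(2) by (simp add: mult_ac)
  qed
  thus "\<exists>\<delta>>0. \<forall>n. \<forall>A\<in>sets (P \<Otimes>\<^sub>M P). measure (P \<Otimes>\<^sub>M P) A < \<delta> \<longrightarrow> measure (N n \<Otimes>\<^sub>M N n) A < \<epsilon>"
    using \<delta>(1) by (intro exI[of _ "\<delta> * \<delta>"]) simp
qed

lemma measure_square_times:
  assumes "finite_measure M" "A \<in> sets M" "B \<in> sets M"
  shows "measure (M \<Otimes>\<^sub>M M) (A \<times> B) = measure M A * measure M B"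
proof -
  interpret finite_measure M by fact
  show ?thesis using assms by (simp add: measure_def emeasure_pair_measure_Times enn2real_mult)
qed

lemma square_family: "measure_family F (P \<Otimes>\<^sub>M P) (\<lambda>n. N n \<Otimes>\<^sub>M N n) (m * m)"
proof (intro measure_family.intro measure_family_axioms.intro generalized_limit_axioms)
  show "finite_measure (P \<Otimes>\<^sub>M P)" by (rule finite_measure_pair_measure) unfold_locales
  show "finite_measure (N n \<Otimes>\<^sub>M N n)" for n by (intro finite_measure_pair_measure N_finite)
  show "sets (N n \<Otimes>\<^sub>M N n) = sets (P \<Otimes>\<^sub>M P)" for n by (intro sets_pair_measure_cong N_sets)
  show "measure (N n \<Otimes>\<^sub>M N n) (space (P \<Otimes>\<^sub>M P)) \<le> m * m" for n
    unfolding space_pair_measure using m_nonneg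
    by (subst measure_square_times) (auto intro!: mult_mono simp: N_finite N_measure_le N_sets)
qed (rule uniformly_ac_square)

text \<open>The squares have a setwise limit that is a measure, and a measure on the product is determined by its values
  on rectangles.  No information on the convergence of densities enters, so this handles
  a quadratic term with a discontinuous kernel.\<close>
lemma limit_measure_square:
  "measure_family.limit_measure F (P \<Otimes>\<^sub>M P) (\<lambda>n. N n \<Otimes>\<^sub>M N n) = limit_measure \<Otimes>\<^sub>M limit_measure"
proof -
  interpret S: measure_family F "P \<Otimes>\<^sub>M P" "\<lambda>n. N n \<Otimes>\<^sub>M N n" "m * m" by (rule square_family)
  show ?thesis
  proof (rule pair_measure_eqI[symmetric])
    show "sets (limit_measure \<Otimes>\<^sub>M limit_measure) = sets S.limit_measure"
      by (simp cong: sets_pair_measure_cong)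
    fix A B assume AB: "A \<in> sets limit_measure" "B \<in> sets limit_measure"
    hence AB': "A \<times> B \<in> sets (P \<Otimes>\<^sub>M P)" by simp
    have "((\<lambda>n. measure (N n) A * measure (N n) B) \<longlongrightarrow> measure limit_measure A * measure limit_measure B) F"
      using AB by (intro tendsto_mult tendsto_measure) auto
    moreover have "measure (N n \<Otimes>\<^sub>M N n) (A \<times> B) = measure (N n) A * measure (N n) B" for n
      using AB by (intro measure_square_times N_finite) (auto simp: N_sets)
    ultimately have "measure S.limit_measure (A \<times> B) = measure limit_measure A * measure limit_measure B"
      using S.tendsto_measure[OF AB'] F_unique by simp
    thus "emeasure limit_measure A * emeasure limit_measure B = emeasure S.limit_measure (A \<times> B)"
      by (simp add: S.Q.emeasure_eq_measure Q.emeasure_eq_measure ennreal_mult)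
  qed unfold_locales
qed

end

section \<open>Product integrals\<close>

lemma integrable_product_mult:
  fixes a :: "'a \<Rightarrow> real" and b :: "'b \<Rightarrow> real"
  assumes "sigma_finite_measure M" "sigma_finite_measure M'" and a: "integrable M a" and b: "integrable M' b"
  shows "integrable (M \<Otimes>\<^sub>M M') (\<lambda>(x, y). a x * b y)"
    and "(LINT (x, y)|(M \<Otimes>\<^sub>M M'). a x * b y) = (LINT x|M. a x) * (LINT y|M'. b y)"
proof -
  interpret pair_sigma_finite M M' using assms by (simp add: pair_sigma_finite_def)
  have [measurable]: "a \<in> borel_measurable M" "b \<in> borel_measurable M'" using a b by auto
  show int: "integrable (M \<Otimes>\<^sub>M M') (\<lambda>(x, y). a x * b y)"
    by (rule Fubini_integrable) (use a b in \<open>auto simp: abs_mult\<close>)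
  show "(LINT (x, y)|(M \<Otimes>\<^sub>M M'). a x * b y) = (LINT x|M. a x) * (LINT y|M'. b y)"
    using integral_fst[OF int] by simp
qed

text \<open>Translation invariance in the second variable.  The shear turns a convolution into a double integral in which the test
  function is evaluated at \<open>x + y\<close>.\<close>
lemma distr_shear:
  "distr (lborel \<Otimes>\<^sub>M lborel) (borel \<Otimes>\<^sub>M borel) (\<lambda>(y, z). (y, y + z)) = lborel \<Otimes>\<^sub>M (lborel :: real measure)"
proof (rule measure_eqI)
  fix A :: "(real \<times> real) set"
  assume "A \<in> sets (distr (lborel \<Otimes>\<^sub>M lborel) (borel \<Otimes>\<^sub>M borel) (\<lambda>(y, z). (y, y + z)))"
  hence A[measurable]: "A \<in> sets (borel \<Otimes>\<^sub>M borel)" by simp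
  hence A'[measurable]: "A \<in> sets (lborel \<Otimes>\<^sub>M lborel)" by (simp cong: sets_pair_measure_cong)
  have sect: "emeasure lborel {z. (y, y + z) \<in> A} = emeasure lborel {z. (y, z) \<in> A}" for y
  proof -
    have B: "Pair y -` A \<in> sets borel" by (rule sets_Pair1[OF A])
    have "emeasure lborel (Pair y -` A) = emeasure (distr lborel borel ((+) y)) (Pair y -` A)"
      by (simp add: lborel_distr_plus)
    also have "\<dots> = emeasure lborel ((+) y -` (Pair y -` A))" using B by (subst emeasure_distr) auto
    finally show ?thesis by (simp add: vimage_def)
  qed
  have "emeasure (distr (lborel \<Otimes>\<^sub>M lborel) (borel \<Otimes>\<^sub>M borel) (\<lambda>(y, z). (y, y + z))) A
      = emeasure (lborel \<Otimes>\<^sub>M lborel) ((\<lambda>(y, z). (y, y + z)) -` A \<inter> space (lborel \<Otimes>\<^sub>M lborel))"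
    by (subst emeasure_distr) auto
  also have "\<dots> = (\<integral>\<^sup>+y. emeasure lborel (Pair y -` ((\<lambda>(y, z). (y, y + z)) -` A \<inter> space (lborel \<Otimes>\<^sub>M lborel))) \<partial>lborel)"
    by (rule lborel.emeasure_pair_measure_alt) measurable
  also have "\<dots> = (\<integral>\<^sup>+y. emeasure lborel (Pair y -` A) \<partial>lborel)"
    by (simp add: sect vimage_def space_pair_measure)
  also have "\<dots> = emeasure (lborel \<Otimes>\<^sub>M lborel) A"
    by (rule lborel.emeasure_pair_measure_alt[symmetric, OF A'])
  finally show "emeasure (distr (lborel \<Otimes>\<^sub>M lborel) (borel \<Otimes>\<^sub>M borel) (\<lambda>(y, z). (y, y + z))) A
      = emeasure (lborel \<Otimes>\<^sub>M lborel) A" .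
qed (simp cong: sets_pair_measure_cong)

section \<open>Size densities with finite number and mass of clusters\<close>

text \<open>Densities vanish on the negative half-line, so that integrals extend over the whole line and the convolution
  of two densities needs no limits of integration.\<close>
definition size_density :: "(real \<Rightarrow> real) \<Rightarrow> bool" where
  "size_density f \<longleftrightarrow> f \<in> borel_measurable borel \<and> (\<forall>x. 0 \<le> f x) \<and> (\<forall>x\<le>0. f x = 0) \<and>
     integrable lborel f \<and> integrable lborel (\<lambda>x. x * f x)"

abbreviation number :: "(real \<Rightarrow> real) \<Rightarrow> real" where
  "number f \<equiv> LINT x|lborel. f x"

abbreviation first_moment :: "(real \<Rightarrow> real) \<Rightarrow> real" where
  "first_moment f \<equiv> LINT x|lborel. x * f x"

abbreviation dens :: "(real \<Rightarrow> real) \<Rightarrow> real measure" where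
  "dens f \<equiv> density lborel (\<lambda>x. ennreal (f x))"

text \<open>The test functions integrable against every density; they include \<open>1\<close>, the identity and the truncations used for the
  tails.\<close>
definition linear_growth :: "(real \<Rightarrow> real) \<Rightarrow> bool" where
  "linear_growth \<theta> \<longleftrightarrow> \<theta> \<in> borel_measurable borel \<and> (\<exists>C. \<forall>x. \<bar>\<theta> x\<bar> \<le> C * (1 + \<bar>x\<bar>))"

lemma linear_growthI:
  "\<theta> \<in> borel_measurable borel \<Longrightarrow> (\<And>x. \<bar>\<theta> x\<bar> \<le> C * (1 + \<bar>x\<bar>)) \<Longrightarrow> linear_growth \<theta>"
  unfolding linear_growth_def by blast

lemma linear_growth_bounded:
  assumes "\<theta> \<in> borel_measurable borel" "\<And>x. \<bar>\<theta> x\<bar> \<le> c"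
  shows "linear_growth \<theta>"
proof (rule linear_growthI[of _ c])
  fix x
  have "0 \<le> c" using assms(2)[of 0] by linarith
  hence "c \<le> c * (1 + \<bar>x\<bar>)" by (simp add: distrib_left)
  thus "\<bar>\<theta> x\<bar> \<le> c * (1 + \<bar>x\<bar>)" using assms(2)[of x] by linarith
qed (rule assms(1))

lemma linear_growth_ident: "linear_growth (\<lambda>x. x)" "linear_growth abs"
  by (rule linear_growthI[of _ 1]; simp)+

lemma size_density_measurable: "size_density f \<Longrightarrow> f \<in> borel_measurable borel"
  and size_density_nonneg: "size_density f \<Longrightarrow> 0 \<le> f x"
  and size_density_zero: "size_density f \<Longrightarrow> x \<le> 0 \<Longrightarrow> f x = 0"
  and size_density_integrable: "size_density f \<Longrightarrow> integrable lborel f" "size_density f \<Longrightarrow> integrable lborel (\<lambda>x. x * f x)"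
  by (auto simp: size_density_def)

lemma integral_dens:
  assumes "size_density f" "\<theta> \<in> borel_measurable borel"
  shows "(LINT x|dens f. \<theta> x) = (LINT x|lborel. \<theta> x * f x)"
  using assms by (subst integral_real_density) (auto simp: size_density_def mult.commute)

lemma integrable_dens_iff:
  assumes "size_density f" "\<theta> \<in> borel_measurable borel"
  shows "integrable (dens f) (\<theta> :: real \<Rightarrow> real) \<longleftrightarrow> integrable lborel (\<lambda>x. \<theta> x * f x)"
  using assms by (subst integrable_real_density) (auto simp: size_density_def mult.commute)

lemma integrable_linear_growth:
  assumes f: "size_density f" and \<theta>: "linear_growth \<theta>"
  shows "integrable lborel (\<lambda>x. \<theta> x * f x)" "integrable (dens f) \<theta>"
proof -
  obtain C where C: "\<And>x. \<bar>\<theta> x\<bar> \<le> C * (1 + \<bar>x\<bar>)" and [measurable]: "\<theta> \<in> borel_measurable borel"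
    using \<theta> by (auto simp: linear_growth_def)
  have [measurable]: "f \<in> borel_measurable borel" using f by (simp add: size_density_def)
  show "integrable lborel (\<lambda>x. \<theta> x * f x)"
  proof (rule Bochner_Integration.integrable_bound)
    show "integrable lborel (\<lambda>x. C * (f x + x * f x))" using f by (simp add: size_density_def)
    show "AE x in lborel. norm (\<theta> x * f x) \<le> norm (C * (f x + x * f x))"
    proof (rule AE_I2)
      fix x
      show "norm (\<theta> x * f x) \<le> norm (C * (f x + x * f x))"
      proof (cases "x \<le> 0")
        case False
        have "\<bar>\<theta> x\<bar> * f x \<le> C * (1 + \<bar>x\<bar>) * f x" 
          by (intro mult_right_mono C size_density_nonneg[OF f])
        also have "\<dots> = C * (f x + x * f x)" using False by (simp add: algebra_simps)
        also have "\<dots> \<le> \<bar>C * (f x + x * f x)\<bar>" by simp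
        finally show ?thesis using size_density_nonneg[OF f, of x] by (simp add: abs_mult)
      qed (simp add: size_density_zero[OF f])
    qed
  qed measurable
  thus "integrable (dens f) \<theta>" by (simp add: integrable_dens_iff[OF f])
qed

lemma finite_measure_dens: "size_density f \<Longrightarrow> finite_measure (dens f)"
  by (intro finite_measureI) (auto simp: size_density_def emeasure_density nn_integral_eq_integral)

lemma measure_dens:
  assumes "size_density f" "A \<in> sets borel"
  shows "measure (dens f) A = (LINT x|lborel. indicator A x * f x)"
proof -
  interpret finite_measure "dens f" by (rule finite_measure_dens[OF assms(1)])
  have "(LINT x|dens f. indicator A x) = measure (dens f) A" by simp
  moreover have "(LINT x|dens f. indicator A x) = (LINT x|lborel. indicator A x * f x)"
    by (rule integral_dens) (use assms in auto)
  ultimately show ?thesis by linarith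
qed

lemma AE_dens_pos: "size_density f \<Longrightarrow> AE x in dens f. 0 < x"
  by (subst AE_density) (auto simp: size_density_def intro!: AE_I2 intro: ccontr)

lemma dens_square:
  assumes "size_density f"
  shows "dens f \<Otimes>\<^sub>M dens f = density (lborel \<Otimes>\<^sub>M lborel) (\<lambda>p. ennreal (f (fst p) * f (snd p)))"
proof -
  interpret finite_measure "dens f" by (rule finite_measure_dens[OF assms])
  have "dens f \<Otimes>\<^sub>M dens f = density (lborel \<Otimes>\<^sub>M lborel) (\<lambda>(x, y). ennreal (f x) * ennreal (f y))"
    using assms by (intro pair_measure_density) (auto simp: size_density_def intro: lborel.sigma_finite_measure_axioms sigma_finite_measure_axioms)
  thus ?thesis using assms by (simp add: case_prod_beta' ennreal_mult size_density_nonneg)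
qed

lemma AE_dens_square_pos:
  assumes f: "size_density f"
  shows "AE p in dens f \<Otimes>\<^sub>M dens f. 0 < fst p \<and> 0 < snd p"
proof -
  have [measurable]: "f \<in> borel_measurable borel" by (rule size_density_measurable[OF f])
  have pos: "0 < x" if "f x \<noteq> 0" for x using size_density_zero[OF f, of x] that by (cases "x \<le> 0") auto
  hence "0 < fst p \<and> 0 < snd p" if "0 < f (fst p) * f (snd p)" for p
    using that pos[of "fst p"] pos[of "snd p"] by (metis less_irrefl mult_zero_left mult_zero_right)
  hence "\<forall>p. 0 < ennreal (f (fst p) * f (snd p)) \<longrightarrow> 0 < fst p \<and> 0 < snd p"
    by (simp add: ennreal_less_zero_iff)
  hence ae: "AE p in lborel \<Otimes>\<^sub>M lborel. 0 < ennreal (f (fst p) * f (snd p)) \<longrightarrow> 0 < fst p \<and> 0 < snd p"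
    by (intro AE_I2) blast
  have m: "(\<lambda>p. ennreal (f (fst p) * f (snd p))) \<in> borel_measurable (lborel \<Otimes>\<^sub>M lborel)" by measurable
  show ?thesis unfolding dens_square[OF f] AE_density[OF m] by (rule ae)
qed

lemma integral_dens_square:
  assumes f: "size_density f" and H: "case_prod H \<in> borel_measurable (borel \<Otimes>\<^sub>M borel)"
  shows "(LINT (x, y)|(dens f \<Otimes>\<^sub>M dens f). H x y) = (LINT (x, y)|(lborel \<Otimes>\<^sub>M lborel). H x y * (f x * f y))"
proof -
  have [measurable]: "f \<in> borel_measurable borel" "case_prod H \<in> borel_measurable (borel \<Otimes>\<^sub>M borel)" 
    using f H by (auto simp: size_density_def)
  show ?thesis unfolding dens_square[OF f]
    by (subst integral_real_density) (auto simp: case_prod_beta' size_density_nonneg[OF f] mult.commute)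
qed

lemma integrable_dens_square_iff:
  assumes f: "size_density f" and H: "case_prod H \<in> borel_measurable (borel \<Otimes>\<^sub>M borel)"
  shows "integrable (dens f \<Otimes>\<^sub>M dens f) (\<lambda>(x, y). H x y :: real) \<longleftrightarrow>
    integrable (lborel \<Otimes>\<^sub>M lborel) (\<lambda>(x, y). H x y * (f x * f y))"
proof -
  have [measurable]: "f \<in> borel_measurable borel" "case_prod H \<in> borel_measurable (borel \<Otimes>\<^sub>M borel)" 
    using f H by (auto simp: size_density_def)
  show ?thesis unfolding dens_square[OF f]
    by (subst integrable_real_density) (auto simp: case_prod_beta' size_density_nonneg[OF f] mult.commute)
qed

text \<open>The majorant is a product, so that its integral splits into moments of order at most one.\<close>
lemma integrable_product_growth:
  assumes f: "size_density f" and H: "case_prod H \<in> borel_measurable (borel \<Otimes>\<^sub>M borel)"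
    and bd: "\<And>x y. \<bar>H x y\<bar> \<le> C * ((1 + \<bar>x\<bar>) * (1 + \<bar>y\<bar>))"
  shows "integrable (dens f \<Otimes>\<^sub>M dens f) (\<lambda>(x, y). H x y)"
    and "integrable (lborel \<Otimes>\<^sub>M lborel) (\<lambda>(x, y). H x y * (f x * f y))"
proof -
  interpret finite_measure "dens f" by (rule finite_measure_dens[OF f])
  have [measurable]: "case_prod H \<in> borel_measurable (borel \<Otimes>\<^sub>M borel)" by (rule H)
  have 1: "integrable (dens f) (\<lambda>x. 1 + \<bar>x\<bar>)"
    by (intro integrable_linear_growth[OF f] linear_growthI[of _ 1]) auto
  have "integrable (dens f \<Otimes>\<^sub>M dens f) (\<lambda>p. C * (\<lambda>(x, y). (1 + \<bar>x\<bar>) * (1 + \<bar>y\<bar>)) p)"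
    by (intro integrable_mult_right integrable_product_mult(1) 1) unfold_locales
  thus *: "integrable (dens f \<Otimes>\<^sub>M dens f) (\<lambda>(x, y). H x y)"
  proof (rule Bochner_Integration.integrable_bound)
    show "AE p in dens f \<Otimes>\<^sub>M dens f. norm (case p of (x, y) \<Rightarrow> H x y) \<le> norm (C * (case p of (x, y) \<Rightarrow> (1 + \<bar>x\<bar>) * (1 + \<bar>y\<bar>)))"
      using bd by (intro AE_I2) (auto intro: order_trans[OF bd abs_ge_self])
  qed measurable
  thus "integrable (lborel \<Otimes>\<^sub>M lborel) (\<lambda>(x, y). H x y * (f x * f y))"
    by (simp add: integrable_dens_square_iff[OF f H])
qed

lemma tilde_growth:
  assumes "\<And>x. \<bar>\<theta> x\<bar> \<le> C * (1 + \<bar>x\<bar>)"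
  shows "\<bar>tilde \<theta> x y\<bar> \<le> 3 * C * ((1 + \<bar>x\<bar>) * (1 + \<bar>y\<bar>))"
    and "\<bar>\<theta> (x + y)\<bar> \<le> C * ((1 + \<bar>x\<bar>) * (1 + \<bar>y\<bar>))"
    and "\<bar>\<theta> x\<bar> \<le> C * ((1 + \<bar>x\<bar>) * (1 + \<bar>y\<bar>))"
    and "\<bar>\<theta> y\<bar> \<le> C * ((1 + \<bar>x\<bar>) * (1 + \<bar>y\<bar>))"
proof -
  have "0 \<le> C" using assms[of 0] by simp
  hence C: "C * a \<le> C * ((1 + \<bar>x\<bar>) * (1 + \<bar>y\<bar>))" if "a \<le> 1 + \<bar>x\<bar> + \<bar>y\<bar>" for a
    using that by (intro mult_left_mono) (auto simp: algebra_simps intro: order_trans add_increasing2)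
  show 1: "\<bar>\<theta> (x + y)\<bar> \<le> C * ((1 + \<bar>x\<bar>) * (1 + \<bar>y\<bar>))"
    by (rule order_trans[OF assms C]) linarith
  show 2: "\<bar>\<theta> x\<bar> \<le> C * ((1 + \<bar>x\<bar>) * (1 + \<bar>y\<bar>))" and 3: "\<bar>\<theta> y\<bar> \<le> C * ((1 + \<bar>x\<bar>) * (1 + \<bar>y\<bar>))"
    by (rule order_trans[OF assms C], linarith)+
  show "\<bar>tilde \<theta> x y\<bar> \<le> 3 * C * ((1 + \<bar>x\<bar>) * (1 + \<bar>y\<bar>))"
    using 1 2 3 unfolding tilde_def by linarith
qed

lemma tilde_measurable[measurable (raw)]:
  assumes "\<theta> \<in> borel_measurable borel" "f \<in> borel_measurable M" "g \<in> borel_measurable M"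
  shows "(\<lambda>x. tilde \<theta> (f x) (g x)) \<in> borel_measurable M"
  using assms unfolding tilde_def by measurable

section \<open>The explicit Euler step\<close>

locale coag_kernel =
  fixes K :: "real \<Rightarrow> real \<Rightarrow> real" and \<kappa> :: real
  assumes K_measurable[measurable]: "case_prod K \<in> borel_measurable (borel \<Otimes>\<^sub>M borel)"
    and K_nonneg: "0 \<le> K x y"
    and K_sym: "K x y = K y x"
    and K_zero: "x \<le> 0 \<Longrightarrow> K x y = 0"
    and K_le: "0 < x \<Longrightarrow> 0 < y \<Longrightarrow> K x y \<le> \<kappa> * (2 + x + y)"
    and \<kappa>_pos: "0 < \<kappa>"

locale bounded_coag_kernel = coag_kernel +
  fixes b :: real
  assumes K_bounded: "K x y \<le> b"
begin

lemma b_nonneg: "0 \<le> b"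
  using K_nonneg[of 0 0] K_bounded[of 0 0] by linarith

definition euler_step :: "real \<Rightarrow> (real \<Rightarrow> real) \<Rightarrow> real \<Rightarrow> real" where
  "euler_step h f x = f x + h * (1 / 2 * (LINT y|lborel. K y (x - y) * (f y * f (x - y)))
     - f x * (LINT y|lborel. K x y * f y))"

lemma K_test_growth:
  assumes C: "\<And>x y. \<bar>G x y\<bar> \<le> C * ((1 + \<bar>x\<bar>) * (1 + \<bar>y\<bar>))"
  shows "\<bar>G x y * K x y\<bar> \<le> C * b * ((1 + \<bar>x\<bar>) * (1 + \<bar>y\<bar>))"
proof -
  have "\<bar>G x y * K x y\<bar> \<le> (C * ((1 + \<bar>x\<bar>) * (1 + \<bar>y\<bar>))) * b"
    unfolding abs_mult using C[of x y] K_nonneg[of x y] K_bounded[of x y] by (intro mult_mono) auto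
  thus ?thesis by (simp add: mult_ac)
qed

text \<open>Fubini's theorem after the shear that sends the pair of merging sizes \<open>(y, z)\<close> to \<open>(y, y + z)\<close>.  The inner
  integral may diverge on a null set of \<open>x\<close>, where its value is \<open>0\<close> by convention.\<close>
lemma gain_term:
  assumes f: "size_density f" and \<theta>: "linear_growth \<theta>"
  shows "integrable lborel (\<lambda>x. \<theta> x * (LINT y|lborel. K y (x - y) * (f y * f (x - y))))"
    and "(LINT x|lborel. \<theta> x * (LINT y|lborel. K y (x - y) * (f y * f (x - y))))
       = (LINT (x, y)|(dens f \<Otimes>\<^sub>M dens f). \<theta> (x + y) * K x y)"
proof -
  have [measurable]: "f \<in> borel_measurable borel" using f by (simp add: size_density_def)
  obtain C where C: "\<And>x. \<bar>\<theta> x\<bar> \<le> C * (1 + \<bar>x\<bar>)" and [measurable]: "\<theta> \<in> borel_measurable borel"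
    using \<theta> by (auto simp: linear_growth_def)
  have m: "(\<lambda>(x, y). \<theta> (x + y) * K x y) \<in> borel_measurable (borel \<Otimes>\<^sub>M borel)" by measurable
  have "\<bar>\<theta> (x + y) * K x y\<bar> \<le> C * b * ((1 + \<bar>x\<bar>) * (1 + \<bar>y\<bar>))" for x y
    by (rule K_test_growth) (rule tilde_growth(2)[OF C])
  note int = integrable_product_growth(2)[OF f m this]
  have sh: "(\<lambda>(y, z). (y, y + z)) \<in> lborel \<Otimes>\<^sub>M lborel \<rightarrow>\<^sub>M borel \<Otimes>\<^sub>M (borel :: real measure)" by measurable
  define G where "G = (\<lambda>y x. \<theta> x * (K y (x - y) * (f y * f (x - y))))"
  have G: "case_prod G \<in> borel_measurable (borel \<Otimes>\<^sub>M borel)" unfolding G_def by measurable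
  have comp: "case_prod G (case p of (y, z) \<Rightarrow> (y, y + z)) = (case p of (x, y) \<Rightarrow> \<theta> (x + y) * K x y * (f x * f y))" for p
    by (auto simp: G_def split: prod.splits)
  have iG: "integrable (lborel \<Otimes>\<^sub>M lborel) (case_prod G)"
    using integrable_distr_eq[OF sh G] int unfolding distr_shear comp by simp
  have eG: "integral\<^sup>L (lborel \<Otimes>\<^sub>M lborel) (case_prod G) = (LINT (x, y)|(lborel \<Otimes>\<^sub>M lborel). \<theta> (x + y) * K x y * (f x * f y))"
    using integral_distr[OF sh G] unfolding distr_shear comp .
  have inner: "(LINT y|lborel. G y x) = \<theta> x * (LINT y|lborel. K y (x - y) * (f y * f (x - y)))" for x
    unfolding G_def by simp
  show "integrable lborel (\<lambda>x. \<theta> x * (LINT y|lborel. K y (x - y) * (f y * f (x - y))))"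
    using lborel_pair.integrable_snd[OF iG] unfolding inner .
  show "(LINT x|lborel. \<theta> x * (LINT y|lborel. K y (x - y) * (f y * f (x - y))))
       = (LINT (x, y)|(dens f \<Otimes>\<^sub>M dens f). \<theta> (x + y) * K x y)"
    using lborel_pair.integral_snd[OF iG] unfolding inner eG integral_dens_square[OF f m] .
qed

lemma loss_term:
  assumes f: "size_density f" and \<theta>: "linear_growth \<theta>"
  shows "integrable lborel (\<lambda>x. \<theta> x * (f x * (LINT y|lborel. K x y * f y)))"
    and "(LINT x|lborel. \<theta> x * (f x * (LINT y|lborel. K x y * f y)))
       = (LINT (x, y)|(dens f \<Otimes>\<^sub>M dens f). \<theta> x * K x y)"
proof -
  have [measurable]: "f \<in> borel_measurable borel" using f by (simp add: size_density_def)
  obtain C where C: "\<And>x. \<bar>\<theta> x\<bar> \<le> C * (1 + \<bar>x\<bar>)" and [measurable]: "\<theta> \<in> borel_measurable borel"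
    using \<theta> by (auto simp: linear_growth_def)
  have m: "(\<lambda>(x, y). \<theta> x * K x y) \<in> borel_measurable (borel \<Otimes>\<^sub>M borel)" by measurable
  have "\<bar>\<theta> x * K x y\<bar> \<le> C * b * ((1 + \<bar>x\<bar>) * (1 + \<bar>y\<bar>))" for x y
    by (rule K_test_growth) (rule tilde_growth(3)[OF C])
  note int = integrable_product_growth(2)[OF f m this]
  have inner: "(LINT y|lborel. \<theta> x * K x y * (f x * f y)) = \<theta> x * (f x * (LINT y|lborel. K x y * f y))" for x
  proof -
    have "(LINT y|lborel. \<theta> x * K x y * (f x * f y)) = (LINT y|lborel. (\<theta> x * f x) * (K x y * f y))"
      by (simp add: mult_ac)
    also have "\<dots> = (\<theta> x * f x) * (LINT y|lborel. K x y * f y)" by (rule integral_mult_right_zero)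
    finally show ?thesis by (simp add: mult_ac)
  qed
  show "integrable lborel (\<lambda>x. \<theta> x * (f x * (LINT y|lborel. K x y * f y)))"
    using lborel_pair.integrable_fst[OF int] unfolding inner .
  show "(LINT x|lborel. \<theta> x * (f x * (LINT y|lborel. K x y * f y)))
       = (LINT (x, y)|(dens f \<Otimes>\<^sub>M dens f). \<theta> x * K x y)"
    using lborel_pair.integral_fst[OF int] unfolding inner integral_dens_square[OF f m] .
qed

lemma integrable_tilde:
  assumes f: "size_density f" and \<theta>: "linear_growth \<theta>"
  shows "integrable (dens f \<Otimes>\<^sub>M dens f) (\<lambda>(x, y). tilde \<theta> x y * K x y)"
proof -
  obtain C where C: "\<And>x. \<bar>\<theta> x\<bar> \<le> C * (1 + \<bar>x\<bar>)" and [measurable]: "\<theta> \<in> borel_measurable borel"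
    using \<theta> by (auto simp: linear_growth_def)
  show ?thesis
    by (rule integrable_product_growth(1)[OF f _ K_test_growth]) (measurable, rule tilde_growth(1)[OF C])
qed

text \<open>The step may not remove more clusters of a given size than there are: the loss rate is at most the bound of
  the kernel times the total number of clusters.\<close>
lemma euler_step_density:
  assumes f: "size_density f" and h: "0 \<le> h" "h * (b * number f) \<le> 1"
  shows "size_density (euler_step h f)"
proof -
  have fm[measurable]: "f \<in> borel_measurable borel" using f by (simp add: size_density_def)
  have nonneg: "0 \<le> euler_step h f x" for x
  proof -
    have "(LINT y|lborel. K x y * f y) \<le> (LINT y|lborel. b * f y)"
    proof (intro integral_mono)
      show bf: "integrable lborel (\<lambda>y. b * f y)" using f by (simp add: size_density_def)
      show "integrable lborel (\<lambda>y. K x y * f y)"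
        by (rule Bochner_Integration.integrable_bound[OF bf])
          (use K_nonneg[of x] K_bounded[of x] size_density_nonneg[OF f] b_nonneg in
             \<open>auto simp: abs_mult intro!: mult_right_mono\<close>)
    qed (intro mult_right_mono K_bounded size_density_nonneg[OF f])
    hence "h * (LINT y|lborel. K x y * f y) \<le> 1"
      using h mult_left_mono[OF _ h(1)] by fastforce
    hence "h * (LINT y|lborel. K x y * f y) * f x \<le> 1 * f x"
      by (intro mult_right_mono size_density_nonneg[OF f])
    moreover have "0 \<le> h * (1 / 2 * (LINT y|lborel. K y (x - y) * (f y * f (x - y))))"
      using h by (intro mult_nonneg_nonneg integral_nonneg_AE AE_I2 K_nonneg size_density_nonneg[OF f]) auto
    ultimately show ?thesis unfolding euler_step_def by (simp add: algebra_simps)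
  qed
  have zero: "euler_step h f x = 0" if "x \<le> 0" for x
  proof -
    have "(\<lambda>y. K y (x - y) * (f y * f (x - y))) = (\<lambda>_. 0)"
    proof
      fix y
      show "K y (x - y) * (f y * f (x - y)) = 0"
        using size_density_zero[OF f, of y] size_density_zero[OF f, of "x - y"] that by (cases "y \<le> 0") auto
    qed
    thus ?thesis using that by (simp add: euler_step_def size_density_zero[OF f])
  qed
  have int: "integrable lborel (\<lambda>x. \<theta> x * euler_step h f x)" if \<theta>: "linear_growth \<theta>" for \<theta>
  proof -
    have "(\<lambda>x. \<theta> x * euler_step h f x) = (\<lambda>x. \<theta> x * f x + h * (1/2 * (\<theta> x * (LINT y|lborel. K y (x - y) * (f y * f (x - y))))
         - \<theta> x * (f x * (LINT y|lborel. K x y * f y))))"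
      unfolding euler_step_def by (simp add: algebra_simps)
    thus ?thesis using gain_term(1)[OF f \<theta>] loss_term(1)[OF f \<theta>] integrable_linear_growth(1)[OF f \<theta>] by simp
  qed
  have "linear_growth (\<lambda>_. 1)" by (rule linear_growth_bounded[of _ 1]) auto
  from int[OF this] int[OF linear_growth_ident(1)]
  have "integrable lborel (euler_step h f)" "integrable lborel (\<lambda>x. x * euler_step h f x)" by simp_all
  thus ?thesis unfolding size_density_def using nonneg zero by auto
qed

text \<open>By symmetry of the kernel the loss term counts both partners, which produces \<open>tilde \<theta>\<close>.\<close>
lemma euler_step_weak:
  assumes f: "size_density f" and h: "0 \<le> h" "h * (b * number f) \<le> 1" and \<theta>: "linear_growth \<theta>"
  shows "(LINT x|dens (euler_step h f). \<theta> x) =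
     (LINT x|dens f. \<theta> x) + h / 2 * (LINT (x, y)|(dens f \<Otimes>\<^sub>M dens f). tilde \<theta> x y * K x y)"
proof -
  have [measurable]: "f \<in> borel_measurable borel" using f by (simp add: size_density_def)
  interpret D: finite_measure "dens f" by (rule finite_measure_dens[OF f])
  interpret DD: pair_sigma_finite "dens f" "dens f" ..
  obtain C where C: "\<And>x. \<bar>\<theta> x\<bar> \<le> C * (1 + \<bar>x\<bar>)" and [measurable]: "\<theta> \<in> borel_measurable borel"
    using \<theta> by (auto simp: linear_growth_def)
  let ?I = "\<lambda>H. LINT (x, y)|(dens f \<Otimes>\<^sub>M dens f). H x y * K x y"
  have i1: "integrable (dens f \<Otimes>\<^sub>M dens f) (\<lambda>(x, y). \<theta> (x + y) * K x y)"
    by (rule integrable_product_growth(1)[OF f _ K_test_growth]) (measurable, rule tilde_growth(2)[OF C])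
  have i2: "integrable (dens f \<Otimes>\<^sub>M dens f) (\<lambda>(x, y). \<theta> x * K x y)"
    by (rule integrable_product_growth(1)[OF f _ K_test_growth]) (measurable, rule tilde_growth(3)[OF C])
  have i3: "integrable (dens f \<Otimes>\<^sub>M dens f) (\<lambda>(x, y). \<theta> y * K x y)"
    by (rule integrable_product_growth(1)[OF f _ K_test_growth]) (measurable, rule tilde_growth(4)[OF C])
  have swap: "?I (\<lambda>x y. \<theta> y) = ?I (\<lambda>x y. \<theta> x)"
    using DD.integral_product_swap[of "\<lambda>(x, y). \<theta> x * K x y"] by (simp add: K_sym)
  have "?I (tilde \<theta>) = (LINT p|(dens f \<Otimes>\<^sub>M dens f). (case p of (x, y) \<Rightarrow> \<theta> (x + y) * K x y) - (case p of (x, y) \<Rightarrow> \<theta> x * K x y)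
        - (case p of (x, y) \<Rightarrow> \<theta> y * K x y))"
    by (rule Bochner_Integration.integral_cong) (auto simp: tilde_def algebra_simps)
  also have "\<dots> = ?I (\<lambda>x y. \<theta> (x + y)) - ?I (\<lambda>x y. \<theta> x) - ?I (\<lambda>x y. \<theta> y)"
    by (simp only: Bochner_Integration.integral_diff Bochner_Integration.integrable_diff i1 i2 i3)
  finally have I: "?I (tilde \<theta>) = ?I (\<lambda>x y. \<theta> (x + y)) - 2 * ?I (\<lambda>x y. \<theta> x)" using swap by simp
  have "(LINT x|dens (euler_step h f). \<theta> x) = (LINT x|lborel. \<theta> x * euler_step h f x)"
    by (rule integral_dens[OF euler_step_density[OF f h]]) measurable
  also have "\<dots> = (LINT x|lborel. \<theta> x * f x + h * (1/2 * (\<theta> x * (LINT y|lborel. K y (x - y) * (f y * f (x - y))))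
         - \<theta> x * (f x * (LINT y|lborel. K x y * f y))))"
    unfolding euler_step_def by (simp add: algebra_simps)
  also have "\<dots> = (LINT x|lborel. \<theta> x * f x) + h * (1/2 * ?I (\<lambda>x y. \<theta> (x + y)) - ?I (\<lambda>x y. \<theta> x))"
    using gain_term[OF f \<theta>] loss_term[OF f \<theta>] integrable_linear_growth(1)[OF f \<theta>] by simp
  finally show ?thesis unfolding I integral_dens[OF f \<open>\<theta> \<in> borel_measurable borel\<close>]
    by (simp add: algebra_simps)
qed

end

section \<open>Estimates for squares of densities\<close>

abbreviation square :: "(real \<Rightarrow> real) \<Rightarrow> (real \<times> real) measure" where
  "square f \<equiv> dens f \<Otimes>\<^sub>M dens f"

lemma integral_square_mono:
  assumes f: "size_density f" and "integrable (square f) (\<lambda>(x, y). G x y)" "integrable (square f) (\<lambda>(x, y). H x y)"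
    and le: "\<And>x y. 0 < x \<Longrightarrow> 0 < y \<Longrightarrow> G x y \<le> (H x y :: real)"
  shows "(LINT (x, y)|square f. G x y) \<le> (LINT (x, y)|square f. H x y)"
proof -
  have "AE p in square f. (case p of (x, y) \<Rightarrow> G x y) \<le> (case p of (x, y) \<Rightarrow> H x y)"
    using AE_dens_square_pos[OF f] by eventually_elim (auto split: prod.splits intro: le)
  thus ?thesis by (intro integral_mono_AE assms)
qed

text \<open>The quadratic terms are estimated by such symmetrized products throughout, because the bound of the
  kernel is one.\<close>
lemma integral_square_sym:
  assumes f: "size_density f" and a: "linear_growth a" and b: "linear_growth b"
  shows "integrable (square f) (\<lambda>(x, y). a x * b y + b x * a y)"
    and "(LINT (x, y)|square f. a x * b y + b x * a y) = 2 * ((LINT x|dens f. a x) * (LINT x|dens f. b x))"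
proof -
  interpret finite_measure "dens f" by (rule finite_measure_dens[OF f])
  have sf: "sigma_finite_measure (dens f)" by unfold_locales
  note ia = integrable_linear_growth(2)[OF f a] and ib = integrable_linear_growth(2)[OF f b]
  note ab = integrable_product_mult[OF sf sf ia ib] and ba = integrable_product_mult[OF sf sf ib ia]
  have eq: "(\<lambda>(x, y). a x * b y + b x * a y) = (\<lambda>p. (case p of (x, y) \<Rightarrow> a x * b y) + (case p of (x, y) \<Rightarrow> b x * a y))"
    by auto
  show "integrable (square f) (\<lambda>(x, y). a x * b y + b x * a y)"
    unfolding eq by (intro Bochner_Integration.integrable_add ab ba)
  show "(LINT (x, y)|square f. a x * b y + b x * a y) = 2 * ((LINT x|dens f. a x) * (LINT x|dens f. b x))"
    unfolding eq Bochner_Integration.integral_add[OF ab(1) ba(1)] ab(2) ba(2) by simp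
qed

definition first_tail :: "real \<Rightarrow> (real \<Rightarrow> real) \<Rightarrow> real" where
  "first_tail R f = (LINT x|dens f. indicator {R<..} x * x)"

lemma linear_growth_tail: "linear_growth (\<lambda>x. indicator {R<..} x * x)"
  by (rule linear_growthI[of _ 1]) (auto simp: indicator_def)

lemma linear_growth_1: "linear_growth (\<lambda>x. 1)" "linear_growth (\<lambda>x. 1 + \<bar>x\<bar>)" "linear_growth (\<lambda>x. 1 + x)"
  by (rule linear_growthI[of _ 1]; simp)+

lemma integral_dens_abs:
  assumes f: "size_density f"
  shows "(LINT x|dens f. 1 + \<bar>x\<bar>) = number f + first_moment f"
    and "(LINT x|dens f. 1 + x) = number f + first_moment f"
proof -
  have [measurable]: "f \<in> borel_measurable borel" by (rule size_density_measurable[OF f])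
  have e: "(1 + \<bar>x\<bar>) * f x = f x + x * f x" "(1 + x) * f x = f x + x * f x" for x
    using size_density_zero[OF f, of x] by (cases "x \<le> 0"; simp add: algebra_simps)+
  show "(LINT x|dens f. 1 + \<bar>x\<bar>) = number f + first_moment f"
    "(LINT x|dens f. 1 + x) = number f + first_moment f"
    using f by (subst integral_dens[OF f]; simp add: e size_density_def)+
qed

lemma integral_dens_1:
  assumes f: "size_density f"
  shows "(LINT x|dens f. 1) = number f" "(LINT x|dens f. x) = first_moment f"
    "measure (dens f) (space (dens f)) = number f"
proof -
  show *: "(LINT x|dens f. 1) = number f" by (subst integral_dens[OF f]) auto
  show "(LINT x|dens f. x) = first_moment f" by (subst integral_dens[OF f]) auto
  interpret finite_measure "dens f" by (rule finite_measure_dens[OF f])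
  show "measure (dens f) (space (dens f)) = number f" using * by simp
qed

lemma moments_nonneg:
  assumes f: "size_density f"
  shows "0 \<le> number f" "0 \<le> first_moment f"
proof -
  show "0 \<le> number f" by (intro integral_nonneg_AE AE_I2 size_density_nonneg[OF f])
  have "0 \<le> x * f x" for x
    using size_density_zero[OF f, of x] size_density_nonneg[OF f, of x] by (cases "x \<le> 0") auto
  thus "0 \<le> first_moment f" by (intro integral_nonneg_AE AE_I2)
qed

lemma integrable_square_weight:
  assumes f: "size_density f"
  shows "integrable (square f) (\<lambda>(x, y). 2 + \<bar>x\<bar> + \<bar>y\<bar>)"
    and "(LINT (x, y)|square f. 2 + \<bar>x\<bar> + \<bar>y\<bar>) = 
       2 * (number f * (number f + first_moment f))"
proof -
  have eq: "(\<lambda>(x, y). 2 + \<bar>x\<bar> + \<bar>y\<bar> :: real) = (\<lambda>(x, y). 1 * (1 + \<bar>y\<bar>) + (1 + \<bar>x\<bar>) * 1)" by (auto simp: algebra_simps)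
  note I = integral_square_sym[OF f linear_growth_1(1,2)]
  show "integrable (square f) (\<lambda>(x, y). 2 + \<bar>x\<bar> + \<bar>y\<bar>)" unfolding eq by (rule I)
  show "(LINT (x, y)|square f. 2 + \<bar>x\<bar> + \<bar>y\<bar>) = 
       2 * (number f * (number f + first_moment f))"
    unfolding eq I(2) integral_dens_abs[OF f] using integral_dens_1(1)[OF f] by simp
qed

text \<open>If \<open>x + y > 2 R\<close> then \<open>x\<close> or \<open>y\<close> exceeds \<open>R\<close>, so the square inherits the tails of the density.\<close>
lemma square_tail:
  assumes f: "size_density f" and R: "1 \<le> R"
  shows "(LINT (x, y)|square f. indicator {p. 2 + 2 * R < 2 + \<bar>fst p\<bar> + \<bar>snd p\<bar>} (x, y) * (2 + \<bar>x\<bar> + \<bar>y\<bar>))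
     \<le> 6 * (first_tail R f * (number f + first_moment f))"
proof -
  let ?a = "\<lambda>x :: real. indicator {R<..} x * x" and ?b = "\<lambda>x :: real. 1 + \<bar>x\<bar>"
  note I = integral_square_sym[OF f linear_growth_tail[of R] linear_growth_1(2)]
  have [measurable]: "f \<in> borel_measurable borel" by (rule size_density_measurable[OF f])
  have "(LINT (x, y)|square f. indicator {p. 2 + 2 * R < 2 + \<bar>fst p\<bar> + \<bar>snd p\<bar>} (x, y) * (2 + \<bar>x\<bar> + \<bar>y\<bar>))
      \<le> (LINT (x, y)|square f. 3 * (?a x * ?b y + ?b x * ?a y))"
  proof (rule integral_square_mono[OF f])
    show "integrable (square f) (\<lambda>(x, y). indicator {p. 2 + 2 * R < 2 + \<bar>fst p\<bar> + \<bar>snd p\<bar>} (x, y) * (2 + \<bar>x\<bar> + \<bar>y\<bar>))"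
      by (rule Bochner_Integration.integrable_bound[OF integrable_square_weight(1)[OF f]])
        (auto simp: indicator_def)
    have "integrable (square f) (\<lambda>p. 3 * (case p of (x, y) \<Rightarrow> ?a x * ?b y + ?b x * ?a y))"
      by (intro integrable_mult_right I)
    thus "integrable (square f) (\<lambda>(x, y). 3 * (?a x * ?b y + ?b x * ?a y))" by (simp add: case_prod_beta')
    fix x y :: real assume xy: "0 < x" "0 < y"
    have *: "2 + x + y \<le> 3 * (x * (1 + y))" if "x > R" "y > 0" for x y :: real
    proof -
      have "1 * y \<le> x * y" using that R by (intro mult_right_mono) auto
      moreover have "3 * (x * (1 + y)) = 3 * x + 3 * (x * y)" by (simp add: algebra_simps)
      ultimately show ?thesis using that R by linarith
    qed
    have nn: "0 \<le> ?a x * ?b y" "0 \<le> ?b x * ?a y" using xy by (auto simp: indicator_def)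
    show "indicator {p. 2 + 2 * R < 2 + \<bar>fst p\<bar> + \<bar>snd p\<bar>} (x, y) * (2 + \<bar>x\<bar> + \<bar>y\<bar>)
      \<le> 3 * (?a x * ?b y + ?b x * ?a y)"
    proof (cases "2 * R < x + y")
      case True
      hence lhs: "indicator {p. 2 + 2 * R < 2 + \<bar>fst p\<bar> + \<bar>snd p\<bar>} (x, y) * (2 + \<bar>x\<bar> + \<bar>y\<bar>) = 2 + x + y"
        using xy by simp
      from True consider "x > R" | "y > R" by linarith
      thus ?thesis
      proof cases
        case 1
        hence "2 + x + y \<le> 3 * (?a x * ?b y)" using *[of x y] xy by simp
        thus ?thesis using lhs nn unfolding distrib_left[of 3] by linarith
      next
        case 2
        hence "2 + x + y \<le> 3 * (?b x * ?a y)" using *[of y x] xy by (simp add: mult_ac)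
        thus ?thesis using lhs nn unfolding distrib_left[of 3] by linarith
      qed
    qed (use nn xy in simp)
  qed
  also have "\<dots> = (LINT p|square f. 3 * (case p of (x, y) \<Rightarrow> ?a x * ?b y + ?b x * ?a y))"
    by (simp only: case_prod_beta')
  also have "\<dots> = 3 * (LINT (x, y)|square f. ?a x * ?b y + ?b x * ?a y)"
    by (rule integral_mult_right_zero)
  also have "\<dots> = 6 * (first_tail R f * (number f + first_moment f))"
    unfolding I(2) integral_dens_abs[OF f] first_tail_def by simp
  finally show ?thesis .
qed

text \<open>The factors are exchanged one at a time: by Fubini's theorem, a bounded function of two variables integrates to
  a bounded test function of the other variable.\<close>
lemma square_diff:
  assumes M: "finite_measure M" "sets M = sets borel" "measure M (space M) \<le> m"
    and M': "finite_measure M'" "sets M' = sets borel" "measure M' (space M') \<le> m"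
    and d: "\<And>\<theta> c. \<theta> \<in> borel_measurable borel \<Longrightarrow> (\<And>x. \<bar>\<theta> x\<bar> \<le> c) \<Longrightarrow>
       \<bar>(LINT x|M. \<theta> x) - (LINT x|M'. \<theta> x)\<bar> \<le> c * d"
    and H: "case_prod H \<in> borel_measurable (borel \<Otimes>\<^sub>M borel)" and c: "\<And>x y :: real. \<bar>H x y\<bar> \<le> (c :: real)"
  shows "\<bar>(LINT (x, y)|(M \<Otimes>\<^sub>M M). H x y) - (LINT (x, y)|(M' \<Otimes>\<^sub>M M'). H x y)\<bar> \<le> 2 * (m * (c * d))"
proof -
  interpret M: finite_measure M by fact
  interpret M': finite_measure M' by fact
  interpret MM: pair_sigma_finite M M ..
  interpret MM': pair_sigma_finite M' M' ..
  interpret MMf: finite_measure "M \<Otimes>\<^sub>M M" by (rule finite_measure_pair_measure) unfold_locales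
  interpret MMf': finite_measure "M' \<Otimes>\<^sub>M M'" by (rule finite_measure_pair_measure) unfold_locales
  note [measurable_cong] = M(2) M'(2) 
  have [measurable]: "case_prod H \<in> borel_measurable (borel \<Otimes>\<^sub>M borel)" by (rule H)
  have m: "0 \<le> m" using M(3) measure_nonneg[of M "space M"] by linarith
  have c0: "0 \<le> c" using c[of 0 0] by linarith
  have iM: "integrable (M \<Otimes>\<^sub>M M) (case_prod H)" by (rule MMf.integrable_const_bound[of _ c]) (use c in auto)
  have iM': "integrable (M' \<Otimes>\<^sub>M M') (case_prod H)" by (rule MMf'.integrable_const_bound[of _ c]) (use c in auto)
  have ab: "\<bar>LINT x|N. \<phi> x\<bar> \<le> C * m"
    if "finite_measure N" "measure N (space N) \<le> m" "\<And>x. \<bar>\<phi> x\<bar> \<le> C" "\<phi> \<in> borel_measurable N" for N C and \<phi> :: "real \<Rightarrow> real"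
  proof -
    interpret N: finite_measure N by fact
    have i: "integrable N \<phi>" by (rule N.integrable_const_bound[of _ C]) (use that in auto)
    have "\<bar>LINT x|N. \<phi> x\<bar> \<le> (LINT x|N. \<bar>\<phi> x\<bar>)" by (rule integral_abs_bound)
    also have "\<dots> \<le> (LINT x|N. C)" using that i by (intro integral_mono) auto
    also have "\<dots> = C * measure N (space N)" by simp
    also have "\<dots> \<le> C * m" using that(2) that(3)[of 0] by (intro mult_left_mono) linarith+
    finally show ?thesis .
  qed
  define A where "A x = (LINT y|M. H x y)" for x
  define A' where "A' x = (LINT y|M'. H x y)" for x
  have [measurable]: "A \<in> borel_measurable borel" unfolding A_def by measurable
  have [measurable]: "A' \<in> borel_measurable borel" unfolding A'_def by measurable
  have Hx: "H x \<in> borel_measurable borel" for x by measurable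
  have Ab: "\<bar>A x\<bar> \<le> c * m" for x unfolding A_def
    by (rule ab) (use M c Hx in \<open>auto simp: measurable_cong_sets[OF M(2)]\<close>)
  have A'b: "\<bar>A' x\<bar> \<le> c * m" for x unfolding A'_def
    by (rule ab) (use M' c Hx in \<open>auto simp: measurable_cong_sets[OF M'(2)]\<close>)
  have AA': "\<bar>A x - A' x\<bar> \<le> c * d" for x unfolding A_def A'_def by (rule d[OF Hx c])
  have 1: "\<bar>(LINT x|M. A x) - (LINT x|M'. A x)\<bar> \<le> (c * m) * d"
    by (rule d) (measurable, rule Ab)
  have "integrable M' A" by (rule M'.integrable_const_bound[of _ "c * m"]) (use Ab in auto)
  moreover have "integrable M' A'" by (rule M'.integrable_const_bound[of _ "c * m"]) (use A'b in auto)
  ultimately have "(LINT x|M'. A x) - (LINT x|M'. A' x) = (LINT x|M'. A x - A' x)" by simp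
  moreover have "\<bar>LINT x|M'. A x - A' x\<bar> \<le> (c * d) * m"
    by (rule ab) (use M' AA' in auto)
  ultimately have 2: "\<bar>(LINT x|M'. A x) - (LINT x|M'. A' x)\<bar> \<le> (c * d) * m" by simp
  have "(LINT (x, y)|(M \<Otimes>\<^sub>M M). H x y) = (LINT x|M. A x)" "(LINT (x, y)|(M' \<Otimes>\<^sub>M M'). H x y) = (LINT x|M'. A' x)"
    unfolding A_def A'_def using MM.integral_fst[OF iM] MM'.integral_fst[OF iM'] by simp_all
  thus ?thesis using 1 2 by (simp add: mult_ac)
qed

context coag_kernel
begin

lemma K_le_weight: "K x y \<le> \<kappa> * (2 + \<bar>x\<bar> + \<bar>y\<bar>)"
proof (cases "0 < x \<and> 0 < y")
  case True
  thus ?thesis using K_le[of x y] by simp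
next
  case False
  hence "K x y = 0" using K_zero[of x y] K_zero[of y x] K_sym[of x y] by (auto simp: not_less)
  thus ?thesis using \<kappa>_pos by simp
qed

lemma tilde_K_le:
  assumes "\<And>x. \<bar>\<theta> x\<bar> \<le> c"
  shows "\<bar>tilde \<theta> x y * K x y\<bar> \<le> 3 * c * \<kappa> * (2 + \<bar>x\<bar> + \<bar>y\<bar>)"
proof -
  have "\<bar>tilde \<theta> x y\<bar> \<le> 3 * c"
    using assms[of x] assms[of y] assms[of "x + y"] unfolding tilde_def by linarith
  hence "\<bar>tilde \<theta> x y * K x y\<bar> \<le> (3 * c) * (\<kappa> * (2 + \<bar>x\<bar> + \<bar>y\<bar>))"
    unfolding abs_mult using K_nonneg[of x y] K_le_weight[of x y] by (intro mult_mono) auto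
  thus ?thesis by (simp add: mult_ac)
qed

end

section \<open>A priori estimates for the Euler scheme\<close>

locale euler_scheme = bounded_coag_kernel +
  fixes f0 :: "real \<Rightarrow> real" and h :: real
  assumes f0: "size_density f0" and h_pos: "0 < h" and h_small: "h * (b * number f0) \<le> 1"
begin

abbreviation m\<^sub>0 where "m\<^sub>0 \<equiv> number f0"
abbreviation m\<^sub>1 where "m\<^sub>1 \<equiv> first_moment f0"

definition iter :: "nat \<Rightarrow> real \<Rightarrow> real" where
  "iter k = (euler_step h ^^ k) f0"

definition flux :: "(real \<Rightarrow> real) \<Rightarrow> nat \<Rightarrow> real" where
  "flux \<theta> k = (LINT (x, y)|square (iter k). tilde \<theta> x y * K x y)"

lemma iter_0: "iter 0 = f0" by (simp add: iter_def)

text \<open>Nonnegativity of the next iterate requires the step to be small relative to the number of clusters of the current one, so both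
  properties are propagated together; the number decreases because \<open>tilde 1 = - 1\<close>.\<close>
lemma iter_density_number: "size_density (iter k) \<and> number (iter k) \<le> m\<^sub>0"
proof (induction k)
  case 0
  thus ?case by (simp add: iter_0 f0)
next
  case (Suc k)
  hence f: "size_density (iter k)" and le: "number (iter k) \<le> m\<^sub>0" by auto
  have "h * (b * number (iter k)) \<le> h * (b * m\<^sub>0)"
    using le b_nonneg h_pos by (intro mult_left_mono) auto
  hence h: "h * (b * number (iter k)) \<le> 1" using h_small by linarith
  have d: "size_density (iter (Suc k))"
    using euler_step_density[OF f _ h] h_pos by (simp add: iter_def)
  have "(LINT x|dens (iter (Suc k)). 1) =
     (LINT x|dens (iter k). 1) + h / 2 * (LINT (x, y)|square (iter k). tilde (\<lambda>_. 1) x y * K x y)"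
    using euler_step_weak[OF f _ h linear_growth_1(1)] h_pos by (simp add: iter_def)
  moreover have "(LINT (x, y)|square (iter k). tilde (\<lambda>_. 1) x y * K x y) \<le> 0"
  proof -
    have "0 \<le> (LINT p|square (iter k). (case p of (x, y) \<Rightarrow> K x y))"
      by (intro integral_nonneg_AE) (auto simp: K_nonneg)
    thus ?thesis by (simp add: tilde_def case_prod_beta')
  qed
  hence "h / 2 * (LINT (x, y)|square (iter k). tilde (\<lambda>_. 1) x y * K x y) \<le> 0"
    using h_pos by (simp add: mult_nonneg_nonpos)
  ultimately show ?case using d le integral_dens_1(1)[OF d] integral_dens_1(1)[OF f] by linarith
qed

lemma iter_density: "size_density (iter k)"
  and iter_number: "number (iter k) \<le> m\<^sub>0"
  using iter_density_number by auto

lemma m_nonneg: "0 \<le> m\<^sub>0" "0 \<le> m\<^sub>1"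
  using moments_nonneg[OF f0] by auto

lemma iter_weak:
  assumes "linear_growth \<theta>"
  shows "(LINT x|dens (iter (Suc k)). \<theta> x) = (LINT x|dens (iter k). \<theta> x) + h / 2 * flux \<theta> k"
proof -
  have "h * (b * number (iter k)) \<le> h * (b * m\<^sub>0)"
    using iter_number b_nonneg h_pos by (intro mult_left_mono) auto
  hence "h * (b * number (iter k)) \<le> 1" using h_small by linarith
  from euler_step_weak[OF iter_density[of k] _ this assms] show ?thesis using h_pos
    by (simp add: iter_def flux_def)
qed

lemma iter_first_moment: "first_moment (iter k) = m\<^sub>1"
proof (induction k)
  case (Suc k)
  have "flux (\<lambda>x. x) k = 0" by (simp add: flux_def tilde_def case_prod_beta')
  thus ?case using Suc iter_weak[OF linear_growth_ident(1), of k] integral_dens_1(2)[OF iter_density]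
    by simp
qed (simp add: iter_0)

definition c\<^sub>1 :: real where "c\<^sub>1 = 3 * \<kappa> * (m\<^sub>0 * (m\<^sub>0 + m\<^sub>1))"

text \<open>The sum kernel that dominates \<open>K\<close> integrates to a combination of the two conserved or decreasing moments, whatever
  the bound \<open>b\<close> of the kernel is.\<close>
lemma flux_bound:
  assumes \<theta>: "\<theta> \<in> borel_measurable borel" "\<And>x. \<bar>\<theta> x\<bar> \<le> c"
  shows "\<bar>flux \<theta> k\<bar> \<le> 2 * (c * c\<^sub>1)"
proof -
  note f = iter_density[of k]
  have c: "0 \<le> c" using \<theta>(2)[of 0] by linarith
  note iw = integrable_square_weight[OF f]
  have "\<bar>flux \<theta> k\<bar> \<le> (LINT p|square (iter k). \<bar>case p of (x, y) \<Rightarrow> tilde \<theta> x y * K x y\<bar>)"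
    unfolding flux_def by (rule integral_abs_bound)
  also have "\<dots> \<le> (LINT p|square (iter k). 3 * c * \<kappa> * (case p of (x, y) \<Rightarrow> 2 + \<bar>x\<bar> + \<bar>y\<bar>))"
    using integrable_tilde[OF f linear_growth_bounded[OF \<theta>]] iw(1) tilde_K_le[OF \<theta>(2)]
    by (intro integral_mono integrable_mult_right integrable_abs) auto
  also have "\<dots> = 3 * c * \<kappa> * (2 * (number (iter k) * (number (iter k) + m\<^sub>1)))"
    by (simp add: iw(2) iter_first_moment)
  also have "\<dots> \<le> 3 * c * \<kappa> * (2 * (m\<^sub>0 * (m\<^sub>0 + m\<^sub>1)))"
    using c \<kappa>_pos iter_number[of k] m_nonneg moments_nonneg[OF f]
    by (intro mult_left_mono mult_mono add_mono) auto
  finally show ?thesis unfolding c\<^sub>1_def by (simp add: mult_ac)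
qed

lemma iter_lipschitz_aux:
  assumes \<theta>: "\<theta> \<in> borel_measurable borel" "\<And>x. \<bar>\<theta> x\<bar> \<le> c"
  shows "\<bar>(LINT x|dens (iter (k + i)). \<theta> x) - (LINT x|dens (iter k). \<theta> x)\<bar> \<le> c * (c\<^sub>1 * (h * i))"
proof (induction i)
  case (Suc i)
  have "\<bar>h / 2 * flux \<theta> (k + i)\<bar> \<le> h / 2 * (2 * (c * c\<^sub>1))"
    unfolding abs_mult using h_pos flux_bound[OF \<theta>, of "k + i"] by (intro mult_mono) auto
  hence "\<bar>(LINT x|dens (iter (Suc (k + i))). \<theta> x) - (LINT x|dens (iter k). \<theta> x)\<bar>
      \<le> c * (c\<^sub>1 * (h * i)) + h / 2 * (2 * (c * c\<^sub>1))"
    using Suc iter_weak[OF linear_growth_bounded[OF \<theta>], of "k + i"] by linarith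
  thus ?case by (simp add: algebra_simps)
qed simp

lemma iter_lipschitz:
  assumes \<theta>: "\<theta> \<in> borel_measurable borel" "\<And>x. \<bar>\<theta> x\<bar> \<le> c"
  shows "\<bar>(LINT x|dens (iter j). \<theta> x) - (LINT x|dens (iter k). \<theta> x)\<bar> \<le> c * (c\<^sub>1 * (h * \<bar>real j - real k\<bar>))"
proof (cases "k \<le> j")
  case True
  thus ?thesis using iter_lipschitz_aux[OF \<theta>, of k "j - k"] by (simp add: of_nat_diff)
next
  case False
  thus ?thesis using iter_lipschitz_aux[OF \<theta>, of j "k - j"] by (simp add: of_nat_diff abs_minus_commute)
qed

definition \<phi> :: "real \<Rightarrow> real \<Rightarrow> real" where "\<phi> R x = \<bar>x\<bar> * min (\<bar>x\<bar> / R) 1"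

lemma \<phi>_bounds:
  assumes "0 < R"
  shows "0 \<le> \<phi> R x" "\<phi> R x \<le> \<bar>x\<bar>"
  using assms unfolding \<phi>_def by (auto intro!: mult_left_le)

lemma \<phi>_growth:
  assumes R: "0 < R"
  shows "linear_growth (\<phi> R)"
proof (rule linear_growthI[of _ 1])
  show "\<phi> R \<in> borel_measurable borel" unfolding \<phi>_def by measurable
  show "\<bar>\<phi> R x\<bar> \<le> 1 * (1 + \<bar>x\<bar>)" for x using \<phi>_bounds[OF R, of x] by simp
qed

text \<open>The weight is \<open>\<phi> R x = x \<psi> x\<close> with the concave function \<open>\<psi> x = min (x / R) 1\<close>.  Concavity bounds
  the increments of \<open>\<psi>\<close> in two ways: \<open>\<psi> (x + y) - \<psi> x \<le> \<psi> y\<close>, which is used against the constant part of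
  the kernel, and \<open>(x + y) (\<psi> (x + y) - \<psi> x) \<le> y \<psi> (x + y)\<close>, which absorbs its linear part.\<close>
lemma tilde_\<phi>_le:
  assumes R: "0 < R" and xy: "0 < x" "0 < y"
  shows "(2 + x + y) * tilde (\<phi> R) x y \<le> 2 * (x * (1 / R + 2 * \<phi> R y) + (1 / R + 2 * \<phi> R x) * y)"
proof -
  define \<psi> where "\<psi> x = min (x / R) 1" for x
  have phi: "\<phi> R x = x * \<psi> x" if "x > 0" for x using that by (simp add: \<phi>_def \<psi>_def)
  have nn: "0 \<le> \<psi> x" if "x > 0" for x using that R by (auto simp: \<psi>_def)
  have sub: "\<psi> (x + y) \<le> \<psi> x + \<psi> y"
  proof -
    have "0 \<le> x / R" "0 \<le> y / R" "(x + y) / R = x / R + y / R" using xy R by (auto simp: add_divide_distrib)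
    thus ?thesis unfolding \<psi>_def by linarith
  qed
  have conc: "(x + y) * (\<psi> (x + y) - \<psi> x) \<le> y * \<psi> (x + y)" if "x > 0" "y > 0" for x y
  proof -
    have "x * R \<le> x * (x + y)" if "R \<le> x + y" using that \<open>x > 0\<close> by (intro mult_left_mono) auto
    hence "x * \<psi> (x + y) \<le> (x + y) * \<psi> x"
      using that R by (auto simp: \<psi>_def min_def field_simps)
    thus ?thesis by (simp add: algebra_simps)
  qed
  have t: "tilde (\<phi> R) x y = x * (\<psi> (x + y) - \<psi> x) + y * (\<psi> (x + y) - \<psi> y)"
    using xy by (simp add: tilde_def phi algebra_simps)
  have "x * (\<psi> (x + y) - \<psi> x) \<le> x * \<psi> y" "y * (\<psi> (x + y) - \<psi> y) \<le> y * \<psi> x"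
    using sub xy by (intro mult_left_mono; simp)+
  hence 1: "2 * tilde (\<phi> R) x y \<le> 2 * (x * \<psi> y + y * \<psi> x)" unfolding t by simp
  have "(x + y) * tilde (\<phi> R) x y = x * ((x + y) * (\<psi> (x + y) - \<psi> x)) + y * ((y + x) * (\<psi> (y + x) - \<psi> y))"
    unfolding t by (simp add: algebra_simps)
  also have "\<dots> \<le> x * (y * \<psi> (x + y)) + y * (x * \<psi> (y + x))"
    using conc[OF xy] conc[OF xy(2,1)] xy by (intro add_mono mult_left_mono) auto
  also have "\<dots> = (2 * (x * y)) * \<psi> (x + y)" by (simp add: algebra_simps)
  also have "\<dots> \<le> (2 * (x * y)) * (\<psi> x + \<psi> y)" using sub xy by (intro mult_left_mono) auto
  finally have 2: "(x + y) * tilde (\<phi> R) x y \<le> 2 * (y * \<phi> R x + x * \<phi> R y)"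
    using xy by (simp add: phi algebra_simps)
  have 3: "\<psi> x \<le> 1 / R + \<phi> R x" if "x > 0" for x
  proof (cases "x \<le> 1")
    case True
    have "\<psi> x \<le> x / R" by (simp add: \<psi>_def)
    also have "\<dots> \<le> 1 / R" using True R by (intro divide_right_mono) auto
    finally show ?thesis using phi[OF that] nn[OF that] that by (simp add: add_increasing2)
  next
    case False
    have "1 * \<psi> x \<le> x * \<psi> x" using False nn[OF that] by (intro mult_right_mono) auto
    thus ?thesis using phi[OF that] R by (simp add: add_increasing)
  qed
  have "x * \<psi> y \<le> x * (1 / R + \<phi> R y)" "y * \<psi> x \<le> y * (1 / R + \<phi> R x)"
    using 3 xy by (intro mult_left_mono; simp)+
  hence "2 * tilde (\<phi> R) x y \<le> 2 * (x * (1 / R + \<phi> R y) + y * (1 / R + \<phi> R x))"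
    by (intro order_trans[OF 1] mult_left_mono[of _ _ 2] add_mono) simp_all
  with 2 show ?thesis by (simp add: algebra_simps)
qed

lemma flux_\<phi>:
  assumes R: "0 < R"
  shows "flux (\<phi> R) k \<le> 4 * \<kappa> * (m\<^sub>1 * (m\<^sub>0 / R + 2 * (LINT x|dens (iter k). \<phi> R x)))"
proof -
  note f = iter_density[of k]
  have \<phi>: "integrable (dens (iter k)) (\<phi> R)" by (rule integrable_linear_growth(2)[OF f \<phi>_growth[OF R]])
  interpret finite_measure "dens (iter k)" by (rule finite_measure_dens[OF f])
  have lg: "linear_growth (\<lambda>x. 1 / R + 2 * \<phi> R x)"
  proof (rule linear_growthI[of _ "1 / R + 2"])
    have [measurable]: "\<phi> R \<in> borel_measurable borel" using \<phi>_growth[OF R] by (simp add: linear_growth_def)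
    show "(\<lambda>x. 1 / R + 2 * \<phi> R x) \<in> borel_measurable borel" by measurable
    fix x
    have "0 \<le> 1 / R" "0 \<le> \<bar>x\<bar> / R" using R by auto
    moreover have "(1 / R + 2) * (1 + \<bar>x\<bar>) = 1 / R + 2 + \<bar>x\<bar> / R + 2 * \<bar>x\<bar>" by (simp add: algebra_simps)
    ultimately show "\<bar>1 / R + 2 * \<phi> R x\<bar> \<le> (1 / R + 2) * (1 + \<bar>x\<bar>)"
      using \<phi>_bounds[OF R, of x] by linarith
  qed
  note I = integral_square_sym[OF f linear_growth_ident(1) lg]
  have e: "(\<lambda>(x, y). 2 * \<kappa> * (x * (1 / R + 2 * \<phi> R y) + (1 / R + 2 * \<phi> R x) * y)) =
      (\<lambda>p. 2 * \<kappa> * (case p of (x, y) \<Rightarrow> x * (1 / R + 2 * \<phi> R y) + (1 / R + 2 * \<phi> R x) * y))" by auto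
  have "flux (\<phi> R) k \<le> (LINT (x, y)|square (iter k). 2 * \<kappa> * (x * (1 / R + 2 * \<phi> R y) + (1 / R + 2 * \<phi> R x) * y))"
    unfolding flux_def
  proof (rule integral_square_mono[OF f integrable_tilde[OF f \<phi>_growth[OF R]]])
    show "integrable (square (iter k)) (\<lambda>(x, y). 2 * \<kappa> * (x * (1 / R + 2 * \<phi> R y) + (1 / R + 2 * \<phi> R x) * y))"
      unfolding e by (intro integrable_mult_right I)
    fix x y :: real assume xy: "0 < x" "0 < y"
    have nn: "0 \<le> x * (1 / R + 2 * \<phi> R y) + (1 / R + 2 * \<phi> R x) * y"
      using xy R by (auto simp: \<phi>_def intro!: add_nonneg_nonneg mult_nonneg_nonneg)
    show "tilde (\<phi> R) x y * K x y \<le> 2 * \<kappa> * (x * (1 / R + 2 * \<phi> R y) + (1 / R + 2 * \<phi> R x) * y)"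
    proof (cases "tilde (\<phi> R) x y \<ge> 0")
      case True
      have "tilde (\<phi> R) x y * K x y \<le> tilde (\<phi> R) x y * (\<kappa> * (2 + x + y))"
        using True K_le[OF xy] by (intro mult_left_mono) auto
      also have "\<dots> = \<kappa> * ((2 + x + y) * tilde (\<phi> R) x y)" by (simp add: mult_ac)
      also have "\<dots> \<le> \<kappa> * (2 * (x * (1 / R + 2 * \<phi> R y) + (1 / R + 2 * \<phi> R x) * y))"
        using \<kappa>_pos by (intro mult_left_mono tilde_\<phi>_le[OF R xy]) auto
      finally show ?thesis by (simp add: mult_ac)
    next
      case False
      hence "tilde (\<phi> R) x y * K x y \<le> 0" using K_nonneg[of x y] by (simp add: mult_nonpos_nonneg)
      also have "0 \<le> 2 * \<kappa> * (x * (1 / R + 2 * \<phi> R y) + (1 / R + 2 * \<phi> R x) * y)"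
        using nn \<kappa>_pos by (intro mult_nonneg_nonneg) auto
      finally show ?thesis .
    qed
  qed
  also have "\<dots> = 2 * \<kappa> * (2 * ((LINT x|dens (iter k). x) * (LINT x|dens (iter k). 1 / R + 2 * \<phi> R x)))"
    unfolding e by (simp add: I(2) del: split_paired_All)
  also have "(LINT x|dens (iter k). 1 / R + 2 * \<phi> R x) = number (iter k) / R + 2 * (LINT x|dens (iter k). \<phi> R x)"
    using \<phi> integral_dens_1(3)[OF f] by simp
  also have "(LINT x|dens (iter k). x) = m\<^sub>1" using integral_dens_1(2)[OF f] iter_first_moment by simp
  also have "2 * \<kappa> * (2 * (m\<^sub>1 * (number (iter k) / R + 2 * (LINT x|dens (iter k). \<phi> R x))))
     \<le> 2 * \<kappa> * (2 * (m\<^sub>1 * (m\<^sub>0 / R + 2 * (LINT x|dens (iter k). \<phi> R x))))"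
    using \<kappa>_pos m_nonneg R by (intro mult_left_mono add_mono divide_right_mono iter_number) auto
  finally show ?thesis by simp
qed

text \<open>A discrete Gronwall inequality.  As \<open>R\<close> tends to infinity, the initial value and the source term
  \<open>m\<^sub>0 / R\<close> tend to \<open>0\<close>, so the moment is small uniformly on bounded time intervals, and so is the mass
  beyond \<open>R\<close>, which it dominates.\<close>
lemma \<phi>_moment:
  assumes R: "0 < R"
  defines "A \<equiv> 4 * \<kappa> * m\<^sub>1"
  shows "(LINT x|dens (iter k). \<phi> R x) \<le> ((LINT x|dens f0. \<phi> R x) + A * m\<^sub>0 / R * (h * k)) * exp (A * (h * k))"
proof (induction k)
  case 0
  thus ?case by (simp add: iter_0)
next
  case (Suc k)
  let ?u = "\<lambda>k. LINT x|dens (iter k). \<phi> R x"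
  let ?D = "A * m\<^sub>0 / R" and ?init = "LINT x|dens f0. \<phi> R x"
  have A: "0 \<le> A" using m_nonneg \<kappa>_pos by (simp add: A_def)
  have D: "0 \<le> ?D" using A m_nonneg R by simp
  have u0: "0 \<le> ?init" using R by (intro integral_nonneg_AE AE_I2) (auto simp: \<phi>_def)
  have "?u (Suc k) = ?u k + h / 2 * flux (\<phi> R) k" by (rule iter_weak[OF \<phi>_growth[OF R]])
  also have "\<dots> \<le> ?u k + h / 2 * (A * (m\<^sub>0 / R + 2 * ?u k))"
    using flux_\<phi>[OF R, of k] h_pos by (intro add_left_mono mult_left_mono) (auto simp: A_def mult_ac)
  also have "\<dots> = (1 + A * h) * ?u k + h / 2 * ?D" by (simp add: algebra_simps)
  also have "\<dots> \<le> (1 + A * h) * ((?init + ?D * (h * k)) * exp (A * (h * k))) + h * ?D"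
    using Suc A h_pos D by (intro add_mono mult_left_mono mult_right_mono) auto
  also have "\<dots> \<le> exp (A * h) * ((?init + ?D * (h * k)) * exp (A * (h * k))) + h * ?D * exp (A * (h * Suc k))"
  proof (intro add_mono mult_right_mono)
    show "1 + A * h \<le> exp (A * h)" by (rule exp_ge_add_one_self)
    show "0 \<le> (?init + ?D * (h * k)) * exp (A * (h * k))" using u0 D h_pos by (intro mult_nonneg_nonneg add_nonneg_nonneg) auto
    have "1 \<le> exp (A * (h * Suc k))" using A h_pos by simp
    from mult_left_mono[OF this, of "h * ?D"] show "h * ?D \<le> h * ?D * exp (A * (h * Suc k))"
      using mult_nonneg_nonneg[OF less_imp_le[OF h_pos] D] by (simp only: mult_1_right)
  qed
  also have "exp (A * h) * ((?init + ?D * (h * k)) * exp (A * (h * k))) = (?init + ?D * (h * k)) * exp (A * (h * Suc k))"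
    by (simp add: exp_add[symmetric] distrib_left mult_ac)
  finally show ?case by (simp add: algebra_simps add_divide_distrib)
qed

lemma tail_le_\<phi>:
  assumes R: "0 < R"
  shows "first_tail R (iter k) \<le> (LINT x|dens (iter k). \<phi> R x)"
  unfolding first_tail_def
proof (intro integral_mono integrable_linear_growth(2)[OF iter_density] linear_growth_tail \<phi>_growth R)
  fix x
  show "indicator {R<..} x * x \<le> \<phi> R x" using R by (auto simp: \<phi>_def indicator_def min_def)
qed

text \<open>Clusters enter \<open>A\<close> by a merger only; if one partner has size \<open>y\<close>, the other one lies in the
  translate of \<open>A\<close> by \<open>- y\<close>, which has the same measure and, since \<open>y > 0\<close>, still lies below \<open>R\<close>.  Hence the
  supremum over all such sets obeys a Gronwall inequality; below \<open>R\<close> the kernel is bounded by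
  \<open>\<kappa> (2 + R)\<close>.\<close>
lemma small_set_number:
  assumes R: "0 \<le> R" 
    and E: "\<And>A. A \<in> sets borel \<Longrightarrow> A \<subseteq> {..R} \<Longrightarrow> emeasure lborel A \<le> ennreal \<delta> \<Longrightarrow> measure (dens f0) A \<le> e"
    and A: "A \<in> sets borel" "A \<subseteq> {..R}" "emeasure lborel A \<le> ennreal \<delta>"
  shows "measure (dens (iter k)) A \<le> e * exp (\<kappa> * (2 + R) * m\<^sub>0 * (h * k))"
  using A
proof (induction k arbitrary: A)
  case 0
  thus ?case using E[of A] by (simp add: iter_0)
next
  case (Suc k)
  let ?C = "\<kappa> * (2 + R) * m\<^sub>0"
  let ?E = "e * exp (?C * (h * k))"
  note f = iter_density[of k]
  interpret D: finite_measure "dens (iter k)" by (rule finite_measure_dens[OF f])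
  interpret D': finite_measure "dens (iter (Suc k))" by (rule finite_measure_dens[OF iter_density])
  interpret DD: pair_sigma_finite "dens (iter k)" "dens (iter k)" ..
  interpret DDf: finite_measure "square (iter k)" by (rule finite_measure_pair_measure) unfold_locales
  have [measurable]: "A \<in> sets borel" by (rule Suc)
  have [measurable]: "iter k \<in> borel_measurable borel" by (rule size_density_measurable[OF f])
  have e: "0 \<le> e" using E[of "{}"] by simp
  have C: "0 \<le> ?C" using \<kappa>_pos R m_nonneg by simp
  have lgA: "linear_growth (indicator A)" by (rule linear_growth_bounded[of _ 1]) auto
  \<comment> \<open>The induction hypothesis applies to the translates of \<open>A\<close>.\<close>
  have shift: "measure (dens (iter k)) {x. x + y \<in> A} \<le> ?E" if y: "0 < y" for y
  proof (rule Suc.IH)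
    show "{x. x + y \<in> A} \<in> sets borel" by measurable
    show "{x. x + y \<in> A} \<subseteq> {..R}" using Suc.prems(2) y by force
    have "emeasure lborel A = emeasure (distr lborel borel ((+) y)) A" by (simp add: lborel_distr_plus)
    also have "\<dots> = emeasure lborel ((+) y -` A \<inter> space lborel)" by (rule emeasure_distr) auto
    also have "(+) y -` A \<inter> space lborel = {x. x + y \<in> A}" by (auto simp: add.commute)
    finally show "emeasure lborel {x. x + y \<in> A} \<le> ennreal \<delta>" using Suc.prems(3) by simp
  qed
  have iA: "integrable (square (iter k)) (\<lambda>(x, y). indicator A (x + y) :: real)"
    by (rule DDf.integrable_const_bound[of _ 1]) auto
  have "flux (indicator A) k \<le> (LINT (x, y)|square (iter k). \<kappa> * (2 + R) * indicator A (x + y))"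
    unfolding flux_def
  proof (rule integral_square_mono[OF f integrable_tilde[OF f lgA]])
    have "integrable (square (iter k)) (\<lambda>p. \<kappa> * (2 + R) * (case p of (x, y) \<Rightarrow> indicator A (x + y)))"
      by (intro integrable_mult_right iA)
    thus "integrable (square (iter k)) (\<lambda>(x, y). \<kappa> * (2 + R) * indicator A (x + y))" by (simp add: case_prod_beta')
    fix x y :: real assume xy: "0 < x" "0 < y"
    have "tilde (indicator A) x y * K x y \<le> indicator A (x + y) * K x y"
      using K_nonneg[of x y] by (intro mult_right_mono) (auto simp: tilde_def indicator_def)
    also have "\<dots> \<le> \<kappa> * (2 + R) * indicator A (x + y)"
    proof (cases "x + y \<in> A")
      case True
      hence "x + y \<le> R" using Suc.prems(2) by auto
      hence "\<kappa> * (2 + x + y) \<le> \<kappa> * (2 + R)" using \<kappa>_pos by (intro mult_left_mono) auto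
      thus ?thesis using K_le[OF xy] True by simp
    qed simp
    finally show "tilde (indicator A) x y * K x y \<le> \<kappa> * (2 + R) * indicator A (x + y)" .
  qed
  also have "\<dots> = \<kappa> * (2 + R) * (LINT (x, y)|square (iter k). indicator A (x + y))"
    by (simp add: case_prod_beta')
  also have "(LINT (x, y)|square (iter k). indicat_real A (x + y)) = (LINT y|dens (iter k). (LINT x|dens (iter k). indicat_real A (x + y)))"
    by (rule DD.integral_snd[OF iA, symmetric])
  also have "\<dots> \<le> (LINT y|dens (iter k). ?E)"
  proof (rule integral_mono_AE)
    show "integrable (dens (iter k)) (\<lambda>y. LINT x|dens (iter k). indicat_real A (x + y))"
      by (rule DD.integrable_snd[OF iA])
    have "(LINT x|dens (iter k). indicat_real A (x + y)) = measure (dens (iter k)) {x. x + y \<in> A}" for y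
    proof -
      have "(LINT x|dens (iter k). indicat_real A (x + y)) = (LINT x|dens (iter k). indicator {x. x + y \<in> A} x)"
        by (rule Bochner_Integration.integral_cong) (auto simp: indicator_def)
      thus ?thesis by simp
    qed
    with AE_dens_pos[OF f] show "AE y in dens (iter k). (LINT x|dens (iter k). indicat_real A (x + y)) \<le> ?E"
      by (auto elim!: eventually_mono simp: shift)
  qed simp
  also have "\<dots> = number (iter k) * ?E" using integral_dens_1(3)[OF f] by simp
  also have "\<kappa> * (2 + R) * (number (iter k) * ?E) \<le> \<kappa> * (2 + R) * (m\<^sub>0 * ?E)"
    using \<kappa>_pos R e by (intro mult_left_mono mult_right_mono iter_number) auto
  finally have fl: "flux (indicator A) k \<le> ?C * ?E" using \<kappa>_pos R by (simp add: mult_ac)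
  have "measure (dens (iter (Suc k))) A = measure (dens (iter k)) A + h / 2 * flux (indicator A) k"
    using iter_weak[OF lgA, of k] by simp
  also have "\<dots> \<le> ?E + h * (?C * ?E)"
  proof (intro add_mono)
    show "measure (dens (iter k)) A \<le> ?E" by (rule Suc.IH[OF Suc.prems])
    have "h / 2 * flux (indicator A) k \<le> h / 2 * (?C * ?E)" using fl h_pos by (intro mult_left_mono) auto
    also have "\<dots> \<le> h * (?C * ?E)"
      by (intro mult_right_mono mult_nonneg_nonneg[OF C] mult_nonneg_nonneg[OF e]) (use h_pos in auto)
    finally show "h / 2 * flux (indicator A) k \<le> h * (?C * ?E)" .
  qed
  also have "\<dots> = (1 + ?C * h) * ?E" by (simp add: algebra_simps)
  also have "\<dots> \<le> exp (?C * h) * ?E" using e by (intro mult_right_mono exp_ge_add_one_self) auto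
  also have "\<dots> = e * exp (?C * (h * Suc k))" by (simp add: exp_add[symmetric] distrib_left mult_ac)
  finally show ?case .
qed

text \<open>Cutting the kernel off at large sizes makes it bounded, so that the Lipschitz continuity in time carries over;
  what is cut off is controlled by the tails.\<close>
lemma flux_modulus:
  assumes \<theta>: "\<theta> \<in> borel_measurable borel" "\<And>x. \<bar>\<theta> x\<bar> \<le> c" and R: "1 \<le> R"
    and tails: "first_tail R (iter i) \<le> \<tau>" "first_tail R (iter j) \<le> \<tau>"
  shows "\<bar>flux \<theta> i - flux \<theta> j\<bar> \<le> 36 * c * \<kappa> * (m\<^sub>0 + m\<^sub>1) * \<tau>
      + 12 * c * \<kappa> * m\<^sub>0 * (1 + R) * c\<^sub>1 * (h * \<bar>real i - real j\<bar>)"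
proof -
  have c: "0 \<le> c" using \<theta>(2)[of 0] by linarith
  have [measurable]: "\<theta> \<in> borel_measurable borel" by (rule \<theta>)
  let ?w = "\<lambda>p. 2 + \<bar>fst p\<bar> + \<bar>snd p\<bar> :: real"
  define H where "H x y = indicator {p. ?w p \<le> 2 + 2 * R} (x, y) * (tilde \<theta> x y * K x y)" for x y
  have Hm[measurable]: "case_prod H \<in> borel_measurable (borel \<Otimes>\<^sub>M borel)" unfolding H_def by measurable
  have Hb: "\<bar>H x y\<bar> \<le> 3 * c * \<kappa> * (2 + 2 * R)" for x y
  proof (cases "?w (x, y) \<le> 2 + 2 * R")
    case True
    have "\<bar>tilde \<theta> x y * K x y\<bar> \<le> 3 * c * \<kappa> * (2 + \<bar>x\<bar> + \<bar>y\<bar>)" by (rule tilde_K_le[OF \<theta>(2)])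
    also have "\<dots> \<le> 3 * c * \<kappa> * (2 + 2 * R)" using True c \<kappa>_pos by (intro mult_left_mono) auto
    finally show ?thesis using True by (simp add: H_def)
  qed (use c \<kappa>_pos R in \<open>simp add: H_def\<close>)
  have cut: "\<bar>flux \<theta> k - (LINT (x, y)|square (iter k). H x y)\<bar> \<le> 18 * c * \<kappa> * (m\<^sub>0 + m\<^sub>1) * \<tau>"
    if t: "first_tail R (iter k) \<le> \<tau>" for k
  proof -
    note f = iter_density[of k]
    have [measurable]: "iter k \<in> borel_measurable borel" by (rule size_density_measurable[OF f])
    interpret D: finite_measure "dens (iter k)" by (rule finite_measure_dens[OF f])
    interpret DDf: finite_measure "square (iter k)" by (rule finite_measure_pair_measure) unfold_locales
    note i1 = integrable_tilde[OF f linear_growth_bounded[OF \<theta>]]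
    have i2: "integrable (square (iter k)) (case_prod H)"
      by (rule DDf.integrable_const_bound[of _ "3 * c * \<kappa> * (2 + 2 * R)"]) (use Hb in auto)
    have i3: "integrable (square (iter k)) (\<lambda>(x, y). indicator {p. 2 + 2 * R < ?w p} (x, y) * (2 + \<bar>x\<bar> + \<bar>y\<bar>))"
      by (rule Bochner_Integration.integrable_bound[OF integrable_square_weight(1)[OF f]])
        (auto simp: indicator_def)
    have t0: "0 \<le> first_tail R (iter k)" unfolding first_tail_def
      using R by (intro integral_nonneg_AE AE_I2) (auto simp: indicator_def)
    have "\<bar>flux \<theta> k - (LINT (x, y)|square (iter k). H x y)\<bar> =
        \<bar>LINT p|square (iter k). (case p of (x, y) \<Rightarrow> tilde \<theta> x y * K x y) - (case p of (x, y) \<Rightarrow> H x y)\<bar>"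
      unfolding flux_def by (simp only: Bochner_Integration.integral_diff[OF i1 i2])
    also have "\<dots> \<le> (LINT p|square (iter k). \<bar>(case p of (x, y) \<Rightarrow> tilde \<theta> x y * K x y) - (case p of (x, y) \<Rightarrow> H x y)\<bar>)"
      by (rule integral_abs_bound)
    also have "\<dots> \<le> (LINT p|square (iter k). 3 * c * \<kappa> * (case p of (x, y) \<Rightarrow> indicator {p. 2 + 2 * R < ?w p} (x, y) * (2 + \<bar>x\<bar> + \<bar>y\<bar>)))"
    proof (intro integral_mono integrable_abs Bochner_Integration.integrable_diff i1 i2 integrable_mult_right i3)
      fix p :: "real \<times> real"
      obtain x y where p: "p = (x, y)" by force
      show "\<bar>(case p of (x, y) \<Rightarrow> tilde \<theta> x y * K x y) - (case p of (x, y) \<Rightarrow> H x y)\<bar>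
         \<le> 3 * c * \<kappa> * (case p of (x, y) \<Rightarrow> indicator {p. 2 + 2 * R < ?w p} (x, y) * (2 + \<bar>x\<bar> + \<bar>y\<bar>))"
        using tilde_K_le[of \<theta> c x y, OF \<theta>(2)] by (auto simp: p H_def indicator_def)
    qed
    also have "\<dots> = 3 * c * \<kappa> * (LINT (x, y)|square (iter k). indicator {p. 2 + 2 * R < ?w p} (x, y) * (2 + \<bar>x\<bar> + \<bar>y\<bar>))"
      by simp
    also have "\<dots> \<le> 3 * c * \<kappa> * (6 * (first_tail R (iter k) * (number (iter k) + m\<^sub>1)))"
      using square_tail[OF f R] c \<kappa>_pos by (intro mult_left_mono) (auto simp: iter_first_moment)
    also have "\<dots> \<le> 3 * c * \<kappa> * (6 * (\<tau> * (m\<^sub>0 + m\<^sub>1)))"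
      using c \<kappa>_pos t t0 m_nonneg iter_number[of k] moments_nonneg[OF f]
      by (intro mult_left_mono mult_mono add_mono) auto
    finally show ?thesis by (simp add: mult_ac)
  qed
  have "\<bar>(LINT (x, y)|square (iter i). H x y) - (LINT (x, y)|square (iter j). H x y)\<bar>
     \<le> 2 * (m\<^sub>0 * (3 * c * \<kappa> * (2 + 2 * R) * (c\<^sub>1 * (h * \<bar>real i - real j\<bar>))))"
    by (rule square_diff[OF finite_measure_dens _ _ finite_measure_dens])
       (auto simp: iter_density Hb iter_number integral_dens_1(3) iter_lipschitz simp del: space_density)
  with cut[OF tails(1)] cut[OF tails(2)] show ?thesis by (simp add: algebra_simps)
qed

text \<open>Summation of the weak form of the single steps.\<close>
lemma iter_increment:
  assumes \<theta>: "linear_growth \<theta>" and "k \<le> l" "\<And>i. k \<le> i \<Longrightarrow> i < l \<Longrightarrow> \<bar>flux \<theta> i - g\<bar> \<le> \<omega>"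
  shows "\<bar>(LINT x|dens (iter l). \<theta> x) - (LINT x|dens (iter k). \<theta> x) - 1 / 2 * (h * (real l - real k)) * g\<bar>
     \<le> 1 / 2 * (h * (real l - real k)) * \<omega>"
  using assms(2,3)
proof (induction l rule: dec_induct)
  case (step l)
  have "\<bar>h / 2 * (flux \<theta> l - g)\<bar> \<le> h / 2 * \<omega>"
    unfolding abs_mult using h_pos step.prems[of l] step.hyps by (intro mult_mono) auto
  moreover have "\<bar>(LINT x|dens (iter l). \<theta> x) - (LINT x|dens (iter k). \<theta> x) - 1 / 2 * (h * (real l - real k)) * g\<bar>
     \<le> 1 / 2 * (h * (real l - real k)) * \<omega>"
    using step by auto
  moreover have "(LINT x|dens (iter l). \<theta> x) + h / 2 * flux \<theta> l - (LINT x|dens (iter k). \<theta> x) - 1 / 2 * (h * (real (Suc l) - real k)) * g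
     = ((LINT x|dens (iter l). \<theta> x) - (LINT x|dens (iter k). \<theta> x) - 1 / 2 * (h * (real l - real k)) * g) + h / 2 * (flux \<theta> l - g)"
    by (simp add: algebra_simps)
  moreover have "1 / 2 * (h * (real (Suc l) - real k)) * \<omega> = 1 / 2 * (h * (real l - real k)) * \<omega> + h / 2 * \<omega>"
    by (simp add: algebra_simps)
  ultimately show ?case unfolding iter_weak[OF \<theta>, of l] by linarith
qed simp

end

section \<open>Passage to the limit\<close>

text \<open>A finite measure with the null sets of the Lebesgue measure on the half-line.\<close>
definition exp_measure :: "real measure" where
  "exp_measure = density lborel (\<lambda>x. ennreal (exp (- x)) * indicator {0..} x)"

lemma sets_exp_measure[simp, measurable_cong]: "sets exp_measure = sets borel"
  by (simp add: exp_measure_def)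

lemma space_exp_measure[simp]: "space exp_measure = UNIV"
  by (simp add: exp_measure_def)

lemma finite_exp_measure: "finite_measure exp_measure"
proof (rule finite_measureI)
  have "((\<lambda>x :: real. - exp (- x)) \<longlongrightarrow> - 0) at_top"
    by (intro tendsto_minus filterlim_compose[OF exp_at_bot] filterlim_uminus_at_bot_at_top)
  hence "(\<integral>\<^sup>+x. ennreal (exp (- x)) * indicator {0 :: real..} x \<partial>lborel) = ennreal (0 - (- exp (- 0)))"
    by (intro nn_integral_FTC_atLeast) (auto intro!: derivative_eq_intros)
  thus "emeasure exp_measure (space exp_measure) \<noteq> \<infinity>"
    by (simp add: exp_measure_def emeasure_density)
qed

interpretation exp_measure: finite_measure exp_measure by (rule finite_exp_measure)

lemma exp_measure_nonpos: "emeasure exp_measure {..0} = 0"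
proof -
  have "emeasure exp_measure {..0} = (\<integral>\<^sup>+x. ennreal (exp (- x)) * indicator {0..} x * indicator {..0} x \<partial>lborel)"
    unfolding exp_measure_def by (rule emeasure_density) auto
  also have "\<dots> = (\<integral>\<^sup>+x. indicator {0 :: real} x \<partial>lborel)"
    by (rule nn_integral_cong) (auto simp: indicator_def)
  finally show ?thesis by simp
qed

lemma exp_measure_ac: "absolutely_continuous lborel exp_measure"
  unfolding exp_measure_def by (rule absolutely_continuousI_density) measurable

lemma lborel_le_exp_measure:
  assumes A: "A \<in> sets borel" "A \<subseteq> {0<..R}"
  shows "emeasure lborel A \<le> ennreal (exp R * measure exp_measure A)"
proof -
  have "emeasure lborel A = (\<integral>\<^sup>+x. indicator A x \<partial>lborel)" using A by simp
  also have "\<dots> \<le> (\<integral>\<^sup>+x. ennreal (exp R) * (ennreal (exp (- x)) * indicator {0..} x * indicator A x) \<partial>lborel)"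
  proof (rule nn_integral_mono)
    fix x
    have "1 \<le> exp R * exp (- x)" if "x \<in> A" using A(2) that by (auto simp: exp_add[symmetric])
    thus "indicator A x \<le> ennreal (exp R) * (ennreal (exp (- x)) * indicator {0..} x * indicator A x)"
      using A(2) by (auto simp: indicator_def ennreal_mult[symmetric])
  qed
  also have "\<dots> = ennreal (exp R) * emeasure exp_measure A"
    unfolding exp_measure_def using A(1) by (subst emeasure_density) (auto simp: nn_integral_cmult)
  finally show ?thesis by (simp add: exp_measure.emeasure_eq_measure ennreal_mult)
qed

text \<open>The density is split at a level \<open>k\<close>: the part above it has small integral, the part below it is bounded.\<close>
lemma dens_small_set:
  assumes f: "size_density f" and e: "0 < e"
  shows "\<exists>\<delta>>0. \<forall>A\<in>sets borel. emeasure lborel A \<le> ennreal \<delta> \<longrightarrow> measure (dens f) A \<le> e"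
proof -
  have [measurable]: "f \<in> borel_measurable borel" by (rule size_density_measurable[OF f])
  note fi = size_density_integrable(1)[OF f]
  have "(\<lambda>k. LINT x|lborel. f x - min (f x) (real k)) \<longlonglongrightarrow> (LINT x|(lborel :: real measure). 0)"
  proof (rule integral_dominated_convergence[OF _ _ fi])
    show "AE x in lborel. (\<lambda>k. f x - min (f x) (real k)) \<longlonglongrightarrow> 0"
    proof (rule AE_I2)
      fix x
      have "\<forall>\<^sub>F k in sequentially. f x - min (f x) (real k) = 0"
        using eventually_ge_at_top[of "nat \<lceil>f x\<rceil>"] by eventually_elim (auto simp: min_def)
      thus "(\<lambda>k. f x - min (f x) (real k)) \<longlonglongrightarrow> 0" by (rule tendsto_eventually)
    qed
  qed (use size_density_nonneg[OF f] in \<open>auto simp: min_def\<close>)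
  from LIMSEQ_D[OF this, of "e/2"] e obtain k :: nat where
    "\<bar>LINT x|lborel. f x - min (f x) (real k)\<bar> < e / 2" by auto
  hence k: "(LINT x|lborel. f x - min (f x) (real k)) \<le> e / 2" by linarith
  define \<delta> where "\<delta> = e / (2 * (real k + 1))"
  have \<delta>: "0 < \<delta>" "real k * \<delta> \<le> e / 2" using e by (auto simp: \<delta>_def field_simps)
  have "measure (dens f) A \<le> e" if A[measurable]: "A \<in> sets borel" "emeasure lborel A \<le> ennreal \<delta>" for A
  proof -
    have fin: "emeasure lborel A < \<infinity>" using A(2) le_less_trans ennreal_less_top by fastforce
    have mA: "measure lborel A \<le> \<delta>" using A(2) \<delta>(1) by (simp add: measure_def enn2real_leI)
    have i: "integrable lborel (\<lambda>x. f x - min (f x) (real k))"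
      by (rule Bochner_Integration.integrable_bound[OF fi]) (use size_density_nonneg[OF f] in \<open>auto simp: min_def\<close>)
    have i2: "integrable lborel (\<lambda>x. real k * indicator A x)" using fin by simp
    have "measure (dens f) A = (LINT x|lborel. indicator A x * f x)" by (rule measure_dens[OF f A(1)])
    also have "\<dots> \<le> (LINT x|lborel. (f x - min (f x) (real k)) + real k * indicator A x)"
    proof (intro integral_mono Bochner_Integration.integrable_add i i2)
      show "integrable lborel (\<lambda>x. indicator A x * f x)"
        by (rule Bochner_Integration.integrable_bound[OF fi]) (auto simp: indicator_def)
    qed (auto simp: indicator_def min_def)
    also have "\<dots> = (LINT x|lborel. f x - min (f x) (real k)) + real k * measure lborel A"
      using i i2 fin by (subst Bochner_Integration.integral_add) auto
    also have "\<dots> \<le> e / 2 + real k * \<delta>" using k mA by (intro add_mono mult_left_mono) auto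
    finally show ?thesis using \<delta>(2) by linarith
  qed
  thus ?thesis using \<delta>(1) by blast
qed

locale approximation = coag_kernel + generalized_limit +
  fixes f0 :: "real \<Rightarrow> real"
  assumes f0: "size_density f0"
begin

abbreviation m\<^sub>0 where "m\<^sub>0 \<equiv> number f0"
abbreviation m\<^sub>1 where "m\<^sub>1 \<equiv> first_moment f0"

definition cut_kernel :: "nat \<Rightarrow> real \<Rightarrow> real \<Rightarrow> real" where
  "cut_kernel n x y = (if x \<le> real n \<and> y \<le> real n then K x y else 0)"

definition cut_bound :: "nat \<Rightarrow> real" where
  "cut_bound n = \<kappa> * (2 + 2 * real n)"

text \<open>The step vanishes as \<open>n\<close> grows, and it is small enough for positivity, because its product with
  \<open>cut_bound n * m\<^sub>0\<close> is at most \<open>1\<close>.\<close>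
definition step_size :: "nat \<Rightarrow> real" where
  "step_size n = 1 / ((real n + 1) * (1 + cut_bound n * m\<^sub>0))"

lemma m0_nonneg: "0 \<le> m\<^sub>0" and m1_nonneg: "0 \<le> m\<^sub>1"
  using moments_nonneg[OF f0] by auto

lemma step_size_denom: "1 \<le> 1 + cut_bound n * m\<^sub>0"
  using \<kappa>_pos m0_nonneg by (simp add: cut_bound_def)

lemma step_size_pos: "0 < step_size n"
proof -
  have "0 < 1 + cut_bound n * m\<^sub>0" using step_size_denom[of n] by linarith
  thus ?thesis unfolding step_size_def by (intro divide_pos_pos mult_pos_pos) auto
qed

lemma step_size_le: "step_size n \<le> inverse (real (Suc n))"
proof -
  have "(real n + 1) * 1 \<le> (real n + 1) * (1 + cut_bound n * m\<^sub>0)"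
    by (intro mult_left_mono step_size_denom) auto
  hence "1 / ((real n + 1) * (1 + cut_bound n * m\<^sub>0)) \<le> 1 / (real n + 1)"
    by (intro divide_left_mono mult_pos_pos) auto
  thus ?thesis by (simp add: step_size_def inverse_eq_divide add.commute)
qed

lemma step_size_tendsto: "(step_size \<longlongrightarrow> 0) F"
proof (rule tendsto_F)
  show "step_size \<longlonglongrightarrow> 0"
    by (rule tendsto_sandwich[OF _ _ tendsto_const LIMSEQ_inverse_real_of_nat])
       (auto intro!: always_eventually step_size_le less_imp_le[OF step_size_pos] simp del: of_nat_Suc)
qed

lemma euler_scheme: "euler_scheme (cut_kernel n) \<kappa> (cut_bound n) f0 (step_size n)"
proof unfold_locales
  show "case_prod (cut_kernel n) \<in> borel_measurable (borel \<Otimes>\<^sub>M borel)"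
    unfolding cut_kernel_def by measurable
  show "step_size n * (cut_bound n * m\<^sub>0) \<le> 1"
  proof -
    let ?c = "cut_bound n * m\<^sub>0"
    have c: "1 \<le> 1 + ?c" by (rule step_size_denom)
    have "1 * (1 + ?c) \<le> (real n + 1) * (1 + ?c)" using c by (intro mult_right_mono) auto
    hence "?c \<le> (real n + 1) * (1 + ?c)" by (rule order_trans[rotated]) simp
    thus ?thesis using c unfolding step_size_def by (simp add: divide_le_eq)
  qed
  fix x y
  show "cut_kernel n x y \<le> cut_bound n"
  proof (cases "0 < x \<and> 0 < y \<and> x \<le> real n \<and> y \<le> real n")
    case True
    hence "K x y \<le> \<kappa> * (2 + x + y)" by (intro K_le) auto
    also have "\<dots> \<le> cut_bound n" unfolding cut_bound_def using True \<kappa>_pos by (intro mult_left_mono) auto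
    finally show ?thesis using True by (simp add: cut_kernel_def)
  next
    case False
    hence "cut_kernel n x y = 0" using K_zero[of x y] K_zero[of y x] K_sym[of x y]
      by (auto simp: cut_kernel_def not_less)
    thus ?thesis using \<kappa>_pos by (simp add: cut_bound_def)
  qed
  show "0 < x \<Longrightarrow> 0 < y \<Longrightarrow> cut_kernel n x y \<le> \<kappa> * (2 + x + y)"
    using K_le[of x y] \<kappa>_pos by (auto simp: cut_kernel_def)
qed (auto simp: cut_kernel_def K_nonneg K_zero K_sym \<kappa>_pos f0 step_size_pos)

sublocale E: euler_scheme "cut_kernel n" \<kappa> "cut_bound n" f0 "step_size n" for n
  by (rule euler_scheme)

definition idx :: "nat \<Rightarrow> real \<Rightarrow> nat" where "idx n t = nat \<lfloor>t / step_size n\<rfloor>"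

text \<open>The Euler iterates, interpolated as a function that is constant on each step.\<close>
definition approx :: "nat \<Rightarrow> real \<Rightarrow> real \<Rightarrow> real" where
  "approx n t = E.iter n (idx n t)"

lemma idx_le: "step_size n * real (idx n t) \<le> \<bar>t\<bar>"
proof (cases "t \<ge> 0")
  case True
  have "real (idx n t) \<le> t / step_size n"
    using True step_size_pos[of n] by (simp add: idx_def)
  from mult_left_mono[OF this less_imp_le[OF step_size_pos[of n]]] show ?thesis
    using step_size_pos[of n] True by simp
next
  case False
  hence "t / step_size n < 0" using step_size_pos[of n] by (simp add: divide_neg_pos)
  hence "idx n t = 0" unfolding idx_def by simp
  thus ?thesis by simp
qed

lemma idx_bounds:
  assumes "0 \<le> t"
  shows "step_size n * real (idx n t) \<le> t" "t - step_size n < step_size n * real (idx n t)"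
proof -
  show "step_size n * real (idx n t) \<le> t" using idx_le[of n t] assms by simp
  have "t / step_size n - 1 < real (idx n t)"
    using assms step_size_pos[of n] by (simp add: idx_def)
  from mult_strict_left_mono[OF this step_size_pos[of n]] show "t - step_size n < step_size n * real (idx n t)"
    using step_size_pos[of n] by (simp add: right_diff_distrib)
qed

lemma idx_mono: "s \<le> t \<Longrightarrow> idx n s \<le> idx n t"
  unfolding idx_def by (intro nat_mono floor_mono divide_right_mono less_imp_le[OF step_size_pos])

lemma idx_0: "idx n 0 = 0" by (simp add: idx_def)

lemma idx_tendsto:
  assumes t: "0 \<le> t"
  shows "((\<lambda>n. step_size n * real (idx n t)) \<longlongrightarrow> t) F"
proof -
  have "((\<lambda>n. t - step_size n) \<longlongrightarrow> t - 0) F" by (intro tendsto_intros step_size_tendsto)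
  hence lower: "((\<lambda>n. t - step_size n) \<longlongrightarrow> t) F" by simp
  show ?thesis
    by (rule tendsto_sandwich[OF _ _ lower tendsto_const])
       (intro always_eventually allI less_imp_le idx_bounds t, intro always_eventually allI idx_bounds t)
qed

lemma uniform_tail_iter:
  assumes "0 < e"
  shows "\<exists>R\<ge>1. \<forall>n k. step_size n * real k \<le> T \<longrightarrow> first_tail R (E.iter n k) \<le> e"
proof -
  define A where "A = 4 * \<kappa> * m\<^sub>1"
  let ?T = "max T 0"
  have [measurable]: "f0 \<in> borel_measurable borel" by (rule size_density_measurable[OF f0])
  have i1: "integrable (dens f0) (\<lambda>x. \<bar>x\<bar>)"
    by (intro integrable_linear_growth(2)[OF f0] linear_growth_ident)
  have \<phi>m: "E.\<phi> R \<in> borel_measurable borel" if "0 < R" for R using E.\<phi>_growth[OF that] by (simp add: linear_growth_def)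
  have lim: "(\<lambda>i. LINT x|dens f0. E.\<phi> (real (Suc i)) x) \<longlonglongrightarrow> (LINT x|dens f0. 0)"
  proof (rule integral_dominated_convergence[OF _ _ i1])
    show "AE x in dens f0. (\<lambda>i. E.\<phi> (real (Suc i)) x) \<longlonglongrightarrow> 0"
    proof (rule AE_I2)
      fix x
      have "(\<lambda>i. \<bar>x\<bar> * min (\<bar>x\<bar> * inverse (real (Suc i))) 1) \<longlonglongrightarrow> \<bar>x\<bar> * min (\<bar>x\<bar> * 0) 1"
        by (intro tendsto_intros LIMSEQ_inverse_real_of_nat)
      thus "(\<lambda>i. E.\<phi> (real (Suc i)) x) \<longlonglongrightarrow> 0" unfolding E.\<phi>_def by (simp add: divide_inverse)
    qed
    show "AE x in dens f0. norm (E.\<phi> (real (Suc i)) x) \<le> \<bar>x\<bar>" for i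
      using E.\<phi>_bounds[of "real (Suc i)"] by auto
    show "E.\<phi> (real (Suc i)) \<in> borel_measurable (dens f0)" for i using \<phi>m[of "real (Suc i)"] by simp
  qed measurable
  have "(\<lambda>i. ((LINT x|dens f0. E.\<phi> (real (Suc i)) x) + A * m\<^sub>0 * inverse (real (Suc i)) * ?T) * exp (A * ?T)) \<longlonglongrightarrow>
     ((LINT x|dens f0. 0) + A * m\<^sub>0 * 0 * ?T) * exp (A * ?T)"
    by (intro tendsto_intros lim LIMSEQ_inverse_real_of_nat)
  from LIMSEQ_D[OF this assms] obtain i where
    "\<bar>((LINT x|dens f0. E.\<phi> (real (Suc i)) x) + A * m\<^sub>0 * inverse (real (Suc i)) * ?T) * exp (A * ?T)\<bar> < e"
    by auto
  hence i: "((LINT x|dens f0. E.\<phi> (real (Suc i)) x) + A * m\<^sub>0 / real (Suc i) * ?T) * exp (A * ?T) \<le> e"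
    by (simp add: divide_inverse)
  have A: "0 \<le> A" using \<kappa>_pos m1_nonneg by (simp add: A_def)
  let ?R = "real (Suc i)"
  have "first_tail ?R (E.iter n k) \<le> e" if k: "step_size n * real k \<le> T" for n k
  proof -
    have R: "0 < ?R" by simp
    have k0: "0 \<le> step_size n * real k" using step_size_pos[of n] by simp
    have \<phi>0: "0 \<le> (LINT x|dens f0. E.\<phi> ?R x)" by (intro integral_nonneg_AE AE_I2 E.\<phi>_bounds R)
    have "first_tail ?R (E.iter n k) \<le> (LINT x|dens (E.iter n k). E.\<phi> ?R x)" by (rule E.tail_le_\<phi>[OF R])
    also have "\<dots> \<le> ((LINT x|dens f0. E.\<phi> ?R x) + A * m\<^sub>0 / ?R * (step_size n * real k)) * exp (A * (step_size n * real k))"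
      unfolding A_def by (rule E.\<phi>_moment[OF R])
    also have "\<dots> \<le> ((LINT x|dens f0. E.\<phi> ?R x) + A * m\<^sub>0 / ?R * ?T) * exp (A * ?T)"
    proof (rule mult_mono)
      show "(LINT x|dens f0. E.\<phi> ?R x) + A * m\<^sub>0 / ?R * (step_size n * real k) \<le> (LINT x|dens f0. E.\<phi> ?R x) + A * m\<^sub>0 / ?R * ?T"
        using A m0_nonneg k by (intro add_left_mono mult_left_mono) auto
      show "exp (A * (step_size n * real k)) \<le> exp (A * ?T)" using A k by (simp add: mult_left_mono)
      show "0 \<le> (LINT x|dens f0. E.\<phi> ?R x) + A * m\<^sub>0 / ?R * ?T"
        using \<phi>0 A m0_nonneg by (intro add_nonneg_nonneg mult_nonneg_nonneg) auto
    qed simp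
    also have "\<dots> \<le> e" by (rule i)
    finally show ?thesis .
  qed
  thus ?thesis by (intro exI[of _ ?R]) auto
qed

lemma approx_density: "size_density (approx n t)"
  and approx_number: "number (approx n t) \<le> m\<^sub>0"
  and approx_moment: "first_moment (approx n t) = m\<^sub>1"
  unfolding approx_def by (rule E.iter_density E.iter_number E.iter_first_moment)+

lemma uniform_tail:
  assumes "0 < e"
  shows "\<exists>R\<ge>1. \<forall>n t. \<bar>t\<bar> \<le> T \<longrightarrow> first_tail R (approx n t) \<le> e"
proof -
  obtain R where R: "R \<ge> 1" "\<And>n k. step_size n * real k \<le> T \<Longrightarrow> first_tail R (E.iter n k) \<le> e"
    using uniform_tail_iter[OF assms, of T] by blast
  thus ?thesis unfolding approx_def using idx_le order_trans by blast
qed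

text \<open>Sizes beyond \<open>R\<close> carry little mass, hence few clusters; on bounded sets of sizes, \<open>exp_measure\<close> controls the
  Lebesgue measure.\<close>
lemma approx_uac: "uniformly_ac exp_measure (\<lambda>n. dens (approx n t))"
  unfolding uniformly_ac_def
proof (intro allI impI)
  fix e :: real assume e: "0 < e"
  obtain R where R: "R \<ge> 1" "\<And>n. first_tail R (approx n t) \<le> e / 4"
    using uniform_tail[of "e / 4" "\<bar>t\<bar>"] e by auto
  define X where "X = exp (\<kappa> * (2 + R) * m\<^sub>0 * \<bar>t\<bar>)"
  have X: "0 < X" by (simp add: X_def)
  obtain \<delta> where \<delta>: "\<delta> > 0" "\<And>A. A \<in> sets borel \<Longrightarrow> emeasure lborel A \<le> ennreal \<delta> \<Longrightarrow> measure (dens f0) A \<le> e / (4 * X)"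
    using dens_small_set[OF f0, of "e / (4 * X)"] e X by auto
  have "measure (dens (approx n t)) A < e" if A: "A \<in> sets borel" and small: "measure exp_measure A < \<delta> / exp R" for n A
  proof -
    note f = approx_density[of n t]
    interpret finite_measure "dens (approx n t)" by (rule finite_measure_dens[OF f])
    let ?A = "A \<inter> {0<..R}"
    have "measure (dens (approx n t)) A \<le> measure (dens (approx n t)) (({..0} \<union> {R<..}) \<union> ?A)"
      using A by (intro finite_measure_mono) auto
    also have "\<dots> \<le> measure (dens (approx n t)) ({..0} \<union> {R<..}) + measure (dens (approx n t)) ?A"
      using A by (intro measure_Un_le) auto
    also have "measure (dens (approx n t)) ({..0} \<union> {R<..}) \<le> e / 4"
    proof -
      have "measure (dens (approx n t)) ({..0} \<union> {R<..}) = (LINT x|dens (approx n t). indicator ({..0} \<union> {R<..}) x)" by simp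
      also have "\<dots> \<le> first_tail R (approx n t)" unfolding first_tail_def
      proof (rule integral_mono_AE)
        show "AE x in dens (approx n t). indicator ({..0} \<union> {R<..}) x \<le> indicator {R<..} x * x"
          using AE_dens_pos[OF f] by eventually_elim (use R in \<open>auto simp: indicator_def\<close>)
      qed (auto intro: integrable_linear_growth[OF f linear_growth_tail] simp: emeasure_eq_measure)
      finally show ?thesis using R(2)[of n] by linarith
    qed
    also have "measure (dens (approx n t)) ?A \<le> e / (4 * X) * exp (\<kappa> * (2 + R) * m\<^sub>0 * (step_size n * real (idx n t)))"
      unfolding approx_def
    proof (rule E.small_set_number[where \<delta> = \<delta>])
      have "measure exp_measure ?A \<le> measure exp_measure A" using A by (intro exp_measure.finite_measure_mono) auto
      hence "exp R * measure exp_measure ?A \<le> exp R * (\<delta> / exp R)" using small by (intro mult_left_mono) auto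
      hence "exp R * measure exp_measure ?A \<le> \<delta>" by simp
      hence "ennreal (exp R * measure exp_measure ?A) \<le> ennreal \<delta>" by (rule ennreal_leI)
      moreover have "emeasure lborel ?A \<le> ennreal (exp R * measure exp_measure ?A)"
        using A by (intro lborel_le_exp_measure) auto
      ultimately show "emeasure lborel ?A \<le> ennreal \<delta>" by (rule order_trans[rotated])
    qed (use R A \<delta> in auto)
    also have "\<dots> \<le> e / (4 * X) * X"
      unfolding X_def using e \<kappa>_pos R m0_nonneg idx_le[of n t]
      by (intro mult_left_mono) (auto intro!: mult_left_mono)
    also have "\<dots> = e / 4" using X by simp
    finally show ?thesis using e by simp
  qed
  thus "\<exists>\<delta>>0. \<forall>n. \<forall>A\<in>sets exp_measure. measure exp_measure A < \<delta> \<longrightarrow> measure (dens (approx n t)) A < e"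
    using \<delta>(1) by (intro exI[of _ "\<delta> / exp R"]) auto
qed

lemma approx_family: "measure_family F exp_measure (\<lambda>n. dens (approx n t)) m\<^sub>0"
proof (intro measure_family.intro measure_family_axioms.intro generalized_limit_axioms)
  show "measure (dens (approx n t)) (space exp_measure) \<le> m\<^sub>0" for n
    using integral_dens_1(3)[OF approx_density[of n t]] approx_number[of n t] by simp
  show "finite_measure (dens (approx n t))" for n by (rule finite_measure_dens[OF approx_density])
  show "sets (dens (approx n t)) = sets exp_measure" for n by simp
qed (rule finite_exp_measure approx_uac)+

sublocale L: measure_family F exp_measure "\<lambda>n. dens (approx n t)" "m\<^sub>0" for t
  by (rule approx_family)

text \<open>Instance of the convergence of weighted integrals with weight \<open>C (1 + \<bar>x\<bar>)\<close>, whose tails are bounded by those of the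
  first moment.\<close>
lemma limit_measure_linear_growth:
  assumes \<theta>: "linear_growth \<theta>"
  shows "((\<lambda>n. LINT x|dens (approx n t). \<theta> x) \<longlongrightarrow> (LINT x|L.limit_measure t. \<theta> x)) F"
    and "integrable (L.limit_measure t) \<theta>"
proof -
  obtain C0 where C0: "\<And>x. \<bar>\<theta> x\<bar> \<le> C0 * (1 + \<bar>x\<bar>)" and [measurable]: "\<theta> \<in> borel_measurable borel"
    using \<theta> by (auto simp: linear_growth_def)
  define C where "C = \<bar>C0\<bar> + 1"
  have C: "0 < C" "\<bar>\<theta> x\<bar> \<le> C * (1 + \<bar>x\<bar>)" for x
  proof -
    show "0 < C" by (simp add: C_def)
    have "C0 * (1 + \<bar>x\<bar>) \<le> C * (1 + \<bar>x\<bar>)" unfolding C_def by (intro mult_right_mono) auto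
    thus "\<bar>\<theta> x\<bar> \<le> C * (1 + \<bar>x\<bar>)" using C0[of x] by linarith
  qed
  let ?w = "\<lambda>x :: real. C * (1 + \<bar>x\<bar>)"
  have lw: "linear_growth ?w" by (rule linear_growthI[of _ C]) (use C(1) in \<open>auto simp: abs_mult\<close>)
  have tail: "\<exists>R. \<forall>n. (LINT x|dens (approx n t). indicator {x. R < ?w x} x * ?w x) \<le> e" if e: "0 < e" for e
  proof -
    obtain R where R: "R \<ge> 1" "\<And>n. first_tail R (approx n t) \<le> e / (2 * C)"
      using uniform_tail[of "e / (2 * C)" "\<bar>t\<bar>"] e C(1) by auto
    have "(LINT x|dens (approx n t). indicator {x. C * (1 + R) < ?w x} x * ?w x) \<le> e" for n
    proof -
      note f = approx_density[of n t]
      have "(LINT x|dens (approx n t). indicator {x. C * (1 + R) < ?w x} x * ?w x)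
         \<le> (LINT x|dens (approx n t). (2 * C) * (indicator {R<..} x * x))"
      proof (rule integral_mono_AE)
        show "integrable (dens (approx n t)) (\<lambda>x. indicator {x. C * (1 + R) < ?w x} x * ?w x)"
          by (rule Bochner_Integration.integrable_bound[OF integrable_linear_growth(2)[OF f lw]])
            (auto simp: indicator_def)
        show "integrable (dens (approx n t)) (\<lambda>x. (2 * C) * (indicator {R<..} x * x))"
          by (intro integrable_mult_right integrable_linear_growth(2)[OF f linear_growth_tail])
        show "AE x in dens (approx n t). indicator {x. C * (1 + R) < ?w x} x * ?w x \<le> (2 * C) * (indicator {R<..} x * x)"
          using AE_dens_pos[OF f]
        proof eventually_elim
          case (elim x)
          show ?case
          proof (cases "x > R")
            case True
            have "C * (1 + x) \<le> C * (2 * x)" using True R C(1) by (intro mult_left_mono) auto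
            thus ?thesis using True elim C(1) by (auto simp: indicator_def)
          next
            case False
            hence "\<not> C * (1 + R) < ?w x" using C(1) elim by simp
            thus ?thesis using False by simp
          qed
        qed
      qed
      also have "\<dots> = (2 * C) * first_tail R (approx n t)" by (simp add: first_tail_def)
      also have "\<dots> \<le> (2 * C) * (e / (2 * C))" using R C(1) by (intro mult_left_mono) auto
      finally show ?thesis using C(1) by simp
    qed
    thus ?thesis by blast
  qed
  note T = L.tendsto_integral_weight[of ?w \<theta> "\<lambda>_. \<theta>" t, OF _ _ _ C(2) C(2) refl integrable_linear_growth(2)[OF approx_density lw] tail]
  have wQ: "integrable (L.limit_measure t) ?w" by (rule T(1)) auto
  show "((\<lambda>n. LINT x|dens (approx n t). \<theta> x) \<longlongrightarrow> (LINT x|L.limit_measure t. \<theta> x)) F"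
    by (rule T(2)) auto
  show "integrable (L.limit_measure t) \<theta>"
    by (rule Bochner_Integration.integrable_bound[OF wQ])
       (use order_trans[OF C(2) abs_ge_self] in auto)
qed

text \<open>The limit is absolutely continuous with respect to \<open>exp_measure\<close>, hence has a Lebesgue density and does not charge
  the negative half-line; the density may be changed on a null set to be finite and to vanish there.\<close>
lemma limit_density: "\<exists>f. size_density f \<and> dens f = L.limit_measure t"
proof -
  let ?Q = "L.limit_measure t"
  interpret Q: finite_measure ?Q by (rule L.finite_limit_measure)
  have ac: "absolutely_continuous lborel ?Q"
    using exp_measure_ac L.limit_measure_ac[of t] unfolding absolutely_continuous_def by blast
  have Q0: "emeasure ?Q {..0} = 0"
  proof -
    have "{..0} \<in> null_sets exp_measure" using exp_measure_nonpos by (simp add: null_sets_def)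
    hence "{..0} \<in> null_sets ?Q" using L.limit_measure_ac[of t] unfolding absolutely_continuous_def by blast
    thus ?thesis by (rule null_setsD1)
  qed
  obtain g where g[measurable]: "g \<in> borel_measurable lborel" and gQ: "density lborel g = ?Q"
    using sigma_finite_measure.Radon_Nikodym[OF sigma_finite_lborel ac] by auto
  define f where "f x = indicator {0<..} x * enn2real (g x)" for x
  have [measurable]: "f \<in> borel_measurable borel" unfolding f_def using g by measurable
  have fin: "AE x in lborel. g x \<noteq> \<infinity>"
  proof (rule nn_integral_PInf_AE[OF g])
    have "(\<integral>\<^sup>+x. g x \<partial>lborel) = emeasure (density lborel g) UNIV" by (subst emeasure_density) auto
    thus "(\<integral>\<^sup>+x. g x \<partial>lborel) \<noteq> \<infinity>" unfolding gQ by (simp add: finite_measure.emeasure_finite[OF L.finite_limit_measure])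
  qed
  have zero: "AE x in lborel. x \<le> 0 \<longrightarrow> g x = 0"
  proof -
    have "{..0} \<in> null_sets (density lborel g)" unfolding gQ using Q0 by (simp add: null_sets_def)
    thus ?thesis by (simp add: null_sets_density_iff)
  qed
  have fQ: "dens f = ?Q" unfolding gQ[symmetric]
  proof (rule density_cong)
    show "AE x in lborel. ennreal (f x) = g x"
      using fin zero by eventually_elim (auto simp: f_def indicator_def less_top[symmetric])
  qed (use g in auto)
  have "size_density f"
    unfolding size_density_def
  proof (intro conjI allI impI)
    show "0 \<le> f x" for x by (simp add: f_def)
    show "f x = 0" if "x \<le> 0" for x using that by (simp add: f_def)
    have nn: "AE x in lborel. 0 \<le> f x" by (simp add: f_def)
    have "integrable (dens f) (\<lambda>x. 1)" unfolding fQ by simp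
    thus "integrable lborel f" by (subst (asm) integrable_real_density[OF _ nn]) auto
    have "integrable (dens f) (\<lambda>x. x)" unfolding fQ
      by (rule limit_measure_linear_growth(2)[OF linear_growth_ident(1)])
    thus "integrable lborel (\<lambda>x. x * f x)"
      by (subst (asm) integrable_real_density[OF _ nn]) (auto simp: mult.commute)
  qed measurable
  thus ?thesis using fQ by blast
qed

definition lim_density :: "real \<Rightarrow> real \<Rightarrow> real" where
  "lim_density t = (SOME f. size_density f \<and> dens f = L.limit_measure t)"

lemma lim_density: "size_density (lim_density t)"
  and dens_lim_density: "dens (lim_density t) = L.limit_measure t"
  using someI_ex[OF limit_density[of t]] unfolding lim_density_def by auto

lemma tendsto_lim_density:
  "linear_growth \<theta> \<Longrightarrow> ((\<lambda>n. LINT x|dens (approx n t). \<theta> x) \<longlongrightarrow> (LINT x|dens (lim_density t). \<theta> x)) F"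
  unfolding dens_lim_density by (rule limit_measure_linear_growth)

text \<open>Instance of the convergence of weighted integrals on the product, where a weight of at most \<open>n\<close> forces both sizes below the
  cut-off.  The constant of the weight is enlarged to be at least \<open>1\<close> for this purpose.\<close>
lemma tendsto_lim_square:
  assumes H[measurable]: "case_prod H \<in> borel_measurable (borel \<Otimes>\<^sub>M borel)"
    and HC: "\<And>x y. \<bar>H x y\<bar> \<le> C0 * (2 + \<bar>x\<bar> + \<bar>y\<bar>)"
  shows "((\<lambda>n. LINT (x, y)|square (approx n t). (if x \<le> real n \<and> y \<le> real n then H x y else 0)) \<longlongrightarrow>
    (LINT (x, y)|square (lim_density t). H x y)) F"
proof -
  interpret S: measure_family F "exp_measure \<Otimes>\<^sub>M exp_measure" "\<lambda>n. square (approx n t)" "m\<^sub>0 * m\<^sub>0"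
    by (rule L.square_family)
  have Seq: "S.limit_measure = square (lim_density t)"
    unfolding dens_lim_density by (rule L.limit_measure_square)
  define C where "C = \<bar>C0\<bar> + 1"
  let ?w = "\<lambda>p :: real \<times> real. C * (2 + \<bar>fst p\<bar> + \<bar>snd p\<bar>)"
  have C: "1 \<le> C" "\<bar>H x y\<bar> \<le> C * (2 + \<bar>x\<bar> + \<bar>y\<bar>)" for x y
  proof -
    show "1 \<le> C" by (simp add: C_def)
    have "C0 * (2 + \<bar>x\<bar> + \<bar>y\<bar>) \<le> C * (2 + \<bar>x\<bar> + \<bar>y\<bar>)" unfolding C_def by (intro mult_right_mono) auto
    thus "\<bar>H x y\<bar> \<le> C * (2 + \<bar>x\<bar> + \<bar>y\<bar>)" using HC[of x y] by linarith
  qed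
  have iw: "integrable (square (approx n t)) ?w" for n
    using integrable_mult_right[OF integrable_square_weight(1)[OF approx_density[of n t]], of C]
    by (simp add: case_prod_beta')
  have tail: "\<exists>R. \<forall>n. (LINT p|square (approx n t). indicator {p. R < ?w p} p * ?w p) \<le> e" if e: "0 < e" for e
  proof -
    define \<tau> where "\<tau> = e / (6 * C * (m\<^sub>0 + m\<^sub>1 + 1))"
    have \<tau>: "0 < \<tau>" using e C(1) m0_nonneg m1_nonneg by (simp add: \<tau>_def)
    obtain R where R: "R \<ge> 1" "\<And>n. first_tail R (approx n t) \<le> \<tau>"
      using uniform_tail[OF \<tau>, of "\<bar>t\<bar>"] by auto
    have "(LINT p|square (approx n t). indicator {p. C * (2 + 2 * R) < ?w p} p * ?w p) \<le> e" for n
    proof -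
      note f = approx_density[of n t]
      have t0: "0 \<le> first_tail R (approx n t)" unfolding first_tail_def
        using R by (intro integral_nonneg_AE AE_I2) (auto simp: indicator_def)
      have "(LINT p|square (approx n t). indicator {p. C * (2 + 2 * R) < ?w p} p * ?w p)
        = (LINT p|square (approx n t). C * (case p of (x, y) \<Rightarrow> indicator {p. 2 + 2 * R < 2 + \<bar>fst p\<bar> + \<bar>snd p\<bar>} (x, y) * (2 + \<bar>x\<bar> + \<bar>y\<bar>)))"
        using C(1) by (intro Bochner_Integration.integral_cong) (auto simp: indicator_def)
      also have "\<dots> = C * (LINT (x, y)|square (approx n t). indicator {p. 2 + 2 * R < 2 + \<bar>fst p\<bar> + \<bar>snd p\<bar>} (x, y) * (2 + \<bar>x\<bar> + \<bar>y\<bar>))"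
        by (rule integral_mult_right_zero)
      also have "\<dots> \<le> C * (6 * (first_tail R (approx n t) * (number (approx n t) + first_moment (approx n t))))"
        using C(1) by (intro mult_left_mono square_tail[OF f R(1)]) auto
      also have "\<dots> \<le> C * (6 * (\<tau> * (m\<^sub>0 + m\<^sub>1 + 1)))"
      proof -
        have "first_tail R (approx n t) * (number (approx n t) + first_moment (approx n t)) \<le> \<tau> * (m\<^sub>0 + m\<^sub>1 + 1)"
          using approx_number[of n t] approx_moment[of n t] moments_nonneg[OF f] R(2)[of n] t0 m0_nonneg m1_nonneg
          by (intro mult_mono) auto
        thus ?thesis using C(1) by (intro mult_left_mono) auto
      qed
      also have "\<dots> = e"
      proof -
        have "6 * C * (m\<^sub>0 + m\<^sub>1 + 1) \<noteq> 0" using C(1) m0_nonneg m1_nonneg by auto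
        hence "\<tau> * (6 * C * (m\<^sub>0 + m\<^sub>1 + 1)) = e" unfolding \<tau>_def by (rule nonzero_eq_divide_eq[THEN iffD1, OF _ refl])
        thus ?thesis by (simp only: mult_ac)
      qed
      finally show ?thesis .
    qed
    thus ?thesis by blast
  qed
  have "((\<lambda>n. LINT p|square (approx n t). (if fst p \<le> real n \<and> snd p \<le> real n then case_prod H p else 0)) \<longlongrightarrow>
    (LINT p|S.limit_measure. case_prod H p)) F"
  proof (rule S.tendsto_integral_weight(2)[where w = ?w])
    show "(if fst p \<le> real n \<and> snd p \<le> real n then case_prod H p else 0) = case_prod H p" if "?w p \<le> real n" for n p
    proof -
      have "1 * (2 + \<bar>fst p\<bar> + \<bar>snd p\<bar>) \<le> ?w p" using C(1) by (intro mult_right_mono) auto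
      thus ?thesis using that by auto
    qed
    have w0: "0 \<le> ?w p" for p using C(1) by (intro mult_nonneg_nonneg) auto
    show "\<bar>case_prod H p\<bar> \<le> ?w p" for p using C(2)[of "fst p" "snd p"] by (simp add: case_prod_beta)
    thus "\<bar>if fst p \<le> real n \<and> snd p \<le> real n then case_prod H p else 0\<bar> \<le> ?w p" for n p
      using w0[of p] by simp
    show "(\<lambda>p. if fst p \<le> real n \<and> snd p \<le> real n then case_prod H p else 0) \<in> borel_measurable (exp_measure \<Otimes>\<^sub>M exp_measure)" for n
      by measurable
    show "case_prod H \<in> borel_measurable (exp_measure \<Otimes>\<^sub>M exp_measure)" by measurable
    show "?w \<in> borel_measurable (exp_measure \<Otimes>\<^sub>M exp_measure)" by measurable
  qed (rule iw tail; assumption?)+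
  thus ?thesis unfolding Seq by (simp add: case_prod_unfold cong: if_cong)
qed

end

section \<open>The limit solves the equation\<close>

context approximation
begin

definition lim_flux :: "(real \<Rightarrow> real) \<Rightarrow> real \<Rightarrow> real" where
  "lim_flux \<theta> t = (LINT (x, y)|square (lim_density t). tilde \<theta> x y * K x y)"

lemma tendsto_flux:
  assumes \<theta>: "\<theta> \<in> borel_measurable borel" "\<And>x. \<bar>\<theta> x\<bar> \<le> c"
  shows "((\<lambda>n. E.flux n \<theta> (idx n t)) \<longlongrightarrow> lim_flux \<theta> t) F"
proof -
  have [measurable]: "\<theta> \<in> borel_measurable borel" by (rule \<theta>)
  have "E.flux n \<theta> (idx n t) = (LINT (x, y)|square (approx n t). (if x \<le> real n \<and> y \<le> real n then tilde \<theta> x y * K x y else 0))" for n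
    unfolding E.flux_def approx_def by (intro Bochner_Integration.integral_cong) (auto simp: cut_kernel_def)
  moreover have "((\<lambda>n. LINT (x, y)|square (approx n t). (if x \<le> real n \<and> y \<le> real n then tilde \<theta> x y * K x y else 0)) \<longlongrightarrow>
      lim_flux \<theta> t) F"
    unfolding lim_flux_def
    by (rule tendsto_lim_square[of "\<lambda>x y. tilde \<theta> x y * K x y"]) (measurable, rule tilde_K_le[OF \<theta>(2)])
  ultimately show ?thesis by simp
qed

lemma lim_number: "number (lim_density t) \<le> m\<^sub>0"
proof -
  have "(LINT x|dens (lim_density t). 1) \<le> m\<^sub>0"
  proof (rule F_upper[OF tendsto_lim_density[OF linear_growth_1(1)]])
    fix n
    show "(LINT x|dens (approx n t). 1) \<le> m\<^sub>0"
      using approx_number[of n t] integral_dens_1(1)[OF approx_density[of n t]] by linarith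
  qed
  thus ?thesis using integral_dens_1(1)[OF lim_density[of t]] by linarith
qed

text \<open>Convergence of the first moment, an unbounded test function, rests on the uniform tails; it is conservation of mass.\<close>
lemma lim_moment: "first_moment (lim_density t) = m\<^sub>1"
proof -
  have "(LINT x|dens (approx n t). x) = m\<^sub>1" for n
    using approx_moment[of n t] integral_dens_1(2)[OF approx_density[of n t]] by linarith
  hence "m\<^sub>1 = (LINT x|dens (lim_density t). x)"
    using tendsto_lim_density[OF linear_growth_ident(1), of t] by (intro F_const) simp
  thus ?thesis using integral_dens_1(2)[OF lim_density[of t]] by linarith
qed

lemma lim_tail:
  assumes "0 < e"
  shows "\<exists>R\<ge>1. \<forall>t. \<bar>t\<bar> \<le> T \<longrightarrow> first_tail R (lim_density t) \<le> e"
proof -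
  obtain R where R: "R \<ge> 1" "\<And>n t. \<bar>t\<bar> \<le> T \<Longrightarrow> first_tail R (approx n t) \<le> e"
    using uniform_tail[OF assms, of T] by blast
  have "first_tail R (lim_density t) \<le> e" if "\<bar>t\<bar> \<le> T" for t
    using F_upper[OF tendsto_lim_density[OF linear_growth_tail[of R], of t]] R(2)[OF that]
    unfolding first_tail_def by blast
  thus ?thesis using R(1) by blast
qed

lemma lim_initial:
  assumes "linear_growth \<theta>"
  shows "(LINT x|dens (lim_density 0). \<theta> x) = (LINT x|dens f0. \<theta> x)"
proof -
  have "approx n 0 = f0" for n by (simp add: approx_def idx_0 E.iter_0)
  hence "((\<lambda>_. LINT x|dens f0. \<theta> x) \<longlongrightarrow> (LINT x|dens (lim_density 0). \<theta> x)) F"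
    using tendsto_lim_density[OF assms, of 0] by simp
  thus ?thesis by (rule F_const[symmetric])
qed

lemma idx_diff:
  assumes "0 \<le> s" "0 \<le> t"
  shows "step_size n * \<bar>real (idx n t) - real (idx n s)\<bar> \<le> \<bar>t - s\<bar> + step_size n"
proof -
  have "step_size n * \<bar>real (idx n t) - real (idx n s)\<bar> = \<bar>step_size n * real (idx n t) - step_size n * real (idx n s)\<bar>"
    using step_size_pos[of n] by (simp add: abs_mult right_diff_distrib[symmetric])
  thus ?thesis using idx_bounds[OF assms(1), of n] idx_bounds[OF assms(2), of n] by linarith
qed

lemma lim_lipschitz:
  assumes st: "0 \<le> s" "0 \<le> t" and \<theta>: "\<theta> \<in> borel_measurable borel" "\<And>x. \<bar>\<theta> x\<bar> \<le> c"
  shows "\<bar>(LINT x|dens (lim_density t). \<theta> x) - (LINT x|dens (lim_density s). \<theta> x)\<bar> \<le> c * (E.c\<^sub>1 * \<bar>t - s\<bar>)"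
proof -
  have c: "0 \<le> c" using \<theta>(2)[of 0] by linarith
  have c1: "0 \<le> E.c\<^sub>1" unfolding E.c\<^sub>1_def using \<kappa>_pos m0_nonneg m1_nonneg by simp
  note lg = linear_growth_bounded[OF \<theta>]
  have lhs: "((\<lambda>n. \<bar>(LINT x|dens (approx n t). \<theta> x) - (LINT x|dens (approx n s). \<theta> x)\<bar>) \<longlongrightarrow>
     \<bar>(LINT x|dens (lim_density t). \<theta> x) - (LINT x|dens (lim_density s). \<theta> x)\<bar>) F"
    by (intro tendsto_rabs tendsto_diff tendsto_lim_density lg)
  have rhs: "((\<lambda>n. c * (E.c\<^sub>1 * (\<bar>t - s\<bar> + step_size n))) \<longlongrightarrow> c * (E.c\<^sub>1 * (\<bar>t - s\<bar> + 0))) F"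
    by (intro tendsto_intros step_size_tendsto)
  have "\<bar>(LINT x|dens (approx n t). \<theta> x) - (LINT x|dens (approx n s). \<theta> x)\<bar> \<le> c * (E.c\<^sub>1 * (\<bar>t - s\<bar> + step_size n))" for n
  proof -
    have "\<bar>(LINT x|dens (approx n t). \<theta> x) - (LINT x|dens (approx n s). \<theta> x)\<bar>
       \<le> c * (E.c\<^sub>1 * (step_size n * \<bar>real (idx n t) - real (idx n s)\<bar>))"
      unfolding approx_def by (rule E.iter_lipschitz[OF \<theta>])
    also have "\<dots> \<le> c * (E.c\<^sub>1 * (\<bar>t - s\<bar> + step_size n))"
      using c c1 idx_diff[OF st] by (intro mult_left_mono) auto
    finally show ?thesis .
  qed
  from F_le[OF lhs rhs this] show ?thesis by simp
qed

text \<open>The flux of the approximations is equicontinuous in time (\<open>E.flux_modulus\<close>), hence it may be frozen at any time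
  \<open>s\<close> of a short interval.  The resulting estimate involves finitely many times only and therefore
  passes to the pointwise limit.\<close>
lemma lim_increment:
  assumes \<theta>: "\<theta> \<in> borel_measurable borel" "\<And>x. \<bar>\<theta> x\<bar> \<le> c" and e: "0 < e"
  shows "\<exists>\<delta>>0. \<forall>t s t'. 0 \<le> t \<longrightarrow> t \<le> s \<longrightarrow> s \<le> t' \<longrightarrow> t' \<le> T \<longrightarrow> t' - t < \<delta> \<longrightarrow>
     \<bar>(LINT x|dens (lim_density t'). \<theta> x) - (LINT x|dens (lim_density t). \<theta> x) - 1 / 2 * (t' - t) * lim_flux \<theta> s\<bar>
       \<le> e * (t' - t)"
proof -
  have c: "0 \<le> c" using \<theta>(2)[of 0] by linarith
  note lg = linear_growth_bounded[OF \<theta>]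
  have c1: "0 \<le> E.c\<^sub>1" unfolding E.c\<^sub>1_def using \<kappa>_pos m0_nonneg m1_nonneg by simp
  define a where "a = 36 * c * \<kappa> * (m\<^sub>0 + m\<^sub>1)"
  have a: "0 \<le> a" unfolding a_def using c \<kappa>_pos m0_nonneg m1_nonneg by simp
  \<comment> \<open>The tail level \<open>\<tau>\<close> and the length \<open>\<delta>\<close> make the two terms of the modulus at most \<open>e\<close> each.\<close>
  define \<tau> where "\<tau> = e / (a + 1)"
  have \<tau>: "0 < \<tau>" "a * \<tau> \<le> e" using a e by (auto simp: \<tau>_def field_simps)
  obtain R where R: "R \<ge> 1" "\<And>n k. step_size n * real k \<le> T \<Longrightarrow> first_tail R (E.iter n k) \<le> \<tau>"
    using uniform_tail_iter[OF \<tau>(1), of T] by blast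
  define L where "L = 12 * c * \<kappa> * m\<^sub>0 * (1 + R) * E.c\<^sub>1"
  have L: "0 \<le> L" unfolding L_def using c \<kappa>_pos m0_nonneg c1 R(1) by simp
  define \<delta> where "\<delta> = e / (L + 1)"
  have \<delta>: "0 < \<delta>" "L * \<delta> \<le> e" using L e by (auto simp: \<delta>_def field_simps)
  have "\<bar>(LINT x|dens (lim_density t'). \<theta> x) - (LINT x|dens (lim_density t). \<theta> x) - 1 / 2 * (t' - t) * lim_flux \<theta> s\<bar>
       \<le> e * (t' - t)"
    if t: "0 \<le> t" "t \<le> s" "s \<le> t'" "t' \<le> T" "t' - t < \<delta>" for t s t'
  proof -
    have pos: "0 \<le> t" "0 \<le> s" "0 \<le> t'" using t by auto
    have lhs: "((\<lambda>n. \<bar>(LINT x|dens (approx n t'). \<theta> x) - (LINT x|dens (approx n t). \<theta> x)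
           - 1 / 2 * (step_size n * real (idx n t') - step_size n * real (idx n t)) * E.flux n \<theta> (idx n s)\<bar>) \<longlongrightarrow>
        \<bar>(LINT x|dens (lim_density t'). \<theta> x) - (LINT x|dens (lim_density t). \<theta> x) - 1 / 2 * (t' - t) * lim_flux \<theta> s\<bar>) F"
      by (intro tendsto_rabs tendsto_diff tendsto_mult tendsto_const tendsto_lim_density lg
          idx_tendsto pos tendsto_flux[OF \<theta>])
    have rhs: "((\<lambda>n. 1 / 2 * (step_size n * real (idx n t') - step_size n * real (idx n t)) *
          (a * \<tau> + L * ((t' - t) + step_size n))) \<longlongrightarrow> 1 / 2 * (t' - t) * (a * \<tau> + L * ((t' - t) + 0))) F"
      by (intro tendsto_diff tendsto_mult tendsto_add tendsto_const idx_tendsto pos step_size_tendsto)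
    have "\<bar>(LINT x|dens (approx n t'). \<theta> x) - (LINT x|dens (approx n t). \<theta> x)
           - 1 / 2 * (step_size n * real (idx n t') - step_size n * real (idx n t)) * E.flux n \<theta> (idx n s)\<bar>
        \<le> 1 / 2 * (step_size n * real (idx n t') - step_size n * real (idx n t)) * (a * \<tau> + L * ((t' - t) + step_size n))" for n
    proof -
      have h: "0 < step_size n" by (rule step_size_pos)
      have flux: "\<bar>E.flux n \<theta> i - E.flux n \<theta> (idx n s)\<bar> \<le> a * \<tau> + L * ((t' - t) + step_size n)"
        if i: "idx n t \<le> i" "i < idx n t'" for i
      proof -
        have up: "step_size n * real i \<le> step_size n * real (idx n t')"
          and lo: "step_size n * real (idx n t) \<le> step_size n * real i"
          using i h by (auto intro: mult_left_mono)
        have tail_i: "first_tail R (E.iter n i) \<le> \<tau>" 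
          using up idx_bounds(1)[OF pos(3), of n] t by (intro R(2)) linarith
        have tail_s: "first_tail R (E.iter n (idx n s)) \<le> \<tau>" 
          using idx_bounds(1)[OF pos(2), of n] t by (intro R(2)) linarith
        have "step_size n * \<bar>real i - real (idx n s)\<bar> = \<bar>step_size n * real i - step_size n * real (idx n s)\<bar>"
          using h by (simp add: abs_mult right_diff_distrib[symmetric])
        also have "\<dots> \<le> (t' - t) + step_size n"
          using up lo idx_bounds[OF pos(1), of n] idx_bounds[OF pos(2), of n] idx_bounds[OF pos(3), of n] t by linarith
        finally have d: "step_size n * \<bar>real i - real (idx n s)\<bar> \<le> (t' - t) + step_size n" .
        have "\<bar>E.flux n \<theta> i - E.flux n \<theta> (idx n s)\<bar> \<le> a * \<tau> + L * (step_size n * \<bar>real i - real (idx n s)\<bar>)"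
          unfolding a_def L_def by (rule E.flux_modulus[OF \<theta> R(1) tail_i tail_s])
        also have "\<dots> \<le> a * \<tau> + L * ((t' - t) + step_size n)"
          using d L by (intro add_left_mono mult_left_mono)
        finally show ?thesis .
      qed
      have "idx n t \<le> idx n t'" using t by (intro idx_mono) simp
      from E.iter_increment[OF lg this flux] show ?thesis
        unfolding approx_def by (simp add: right_diff_distrib)
    qed
    from F_le[OF lhs rhs this]
    have "\<bar>(LINT x|dens (lim_density t'). \<theta> x) - (LINT x|dens (lim_density t). \<theta> x) - 1 / 2 * (t' - t) * lim_flux \<theta> s\<bar>
       \<le> 1 / 2 * (t' - t) * (a * \<tau> + L * (t' - t))" by simp
    also have "\<dots> \<le> 1 / 2 * (t' - t) * (e + e)"
    proof -
      have "L * (t' - t) \<le> L * \<delta>" using L t by (intro mult_left_mono) auto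
      thus ?thesis using \<tau>(2) \<delta>(2) t by (intro mult_left_mono) auto
    qed
    also have "\<dots> = e * (t' - t)" by simp
    finally show ?thesis .
  qed
  thus ?thesis using \<delta>(1) by blast
qed

lemma lim_flux_continuous:
  assumes \<theta>: "\<theta> \<in> borel_measurable borel" "\<And>x. \<bar>\<theta> x\<bar> \<le> c"
  shows "continuous_on {0..T} (lim_flux \<theta>)"
  unfolding continuous_on_iff
proof (intro ballI allI impI)
  fix t e :: real assume t: "t \<in> {0..T}" and e: "0 < e"
  let ?\<Phi> = "\<lambda>t. LINT x|dens (lim_density t). \<theta> x"
  obtain \<delta> where \<delta>: "\<delta> > 0" "\<And>t s t'. 0 \<le> t \<Longrightarrow> t \<le> s \<Longrightarrow> s \<le> t' \<Longrightarrow> t' \<le> T \<Longrightarrow> t' - t < \<delta> \<Longrightarrow>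
     \<bar>?\<Phi> t' - ?\<Phi> t - 1 / 2 * (t' - t) * lim_flux \<theta> s\<bar> \<le> e / 8 * (t' - t)"
    using lim_increment[OF \<theta>, of "e / 8" T] e by (metis zero_less_divide_iff zero_less_numeral)
  have close: "\<bar>lim_flux \<theta> s - lim_flux \<theta> s'\<bar> < e" if s: "0 \<le> s" "s < s'" "s' \<le> T" "s' - s < \<delta>" for s s'
  proof -
    have "\<bar>?\<Phi> s' - ?\<Phi> s - 1 / 2 * (s' - s) * lim_flux \<theta> s\<bar> \<le> e / 8 * (s' - s)"
      "\<bar>?\<Phi> s' - ?\<Phi> s - 1 / 2 * (s' - s) * lim_flux \<theta> s'\<bar> \<le> e / 8 * (s' - s)"
      by (rule \<delta>(2); use s in simp)+
    hence "\<bar>1 / 2 * (s' - s) * lim_flux \<theta> s - 1 / 2 * (s' - s) * lim_flux \<theta> s'\<bar> \<le> e / 4 * (s' - s)" by linarith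
    hence "\<bar>1 / 2 * (s' - s) * (lim_flux \<theta> s - lim_flux \<theta> s')\<bar> \<le> e / 4 * (s' - s)"
      by (simp only: right_diff_distrib)
    hence "(s' - s) * \<bar>lim_flux \<theta> s - lim_flux \<theta> s'\<bar> \<le> (s' - s) * (e / 2)"
      using s by (simp add: abs_mult)
    hence "\<bar>lim_flux \<theta> s - lim_flux \<theta> s'\<bar> \<le> e / 2" using s by simp
    thus ?thesis using e by simp
  qed
  show "\<exists>d>0. \<forall>s\<in>{0..T}. dist s t < d \<longrightarrow> dist (lim_flux \<theta> s) (lim_flux \<theta> t) < e"
  proof (intro exI[of _ \<delta>] conjI \<delta> ballI impI)
    fix s assume s: "s \<in> {0..T}" "dist s t < \<delta>"
    consider "s < t" | "s = t" | "t < s" by linarith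
    thus "dist (lim_flux \<theta> s) (lim_flux \<theta> t) < e"
    proof cases
      case 1
      thus ?thesis using close[of s t] s t by (simp add: dist_real_def)
    next
      case 3
      thus ?thesis using close[of t s] s t by (simp add: dist_real_def abs_minus_commute)
    qed (use e in simp)
  qed
qed

text \<open>The increments to the left and to the right of \<open>t\<close> are both compared with the flux at \<open>t\<close> itself.\<close>
lemma lim_derivative:
  assumes \<theta>: "\<theta> \<in> borel_measurable borel" "\<And>x. \<bar>\<theta> x\<bar> \<le> c" and t: "t \<in> {0..T}"
  shows "((\<lambda>t. LINT x|dens (lim_density t). \<theta> x) has_real_derivative 1 / 2 * lim_flux \<theta> t) (at t within {0..T})"
  unfolding has_field_derivative_iff tendsto_iff eventually_at
proof (intro allI impI)
  fix e :: real assume e: "0 < e"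
  let ?\<Phi> = "\<lambda>t. LINT x|dens (lim_density t). \<theta> x"
  obtain \<delta> where \<delta>: "\<delta> > 0" "\<And>t s t'. 0 \<le> t \<Longrightarrow> t \<le> s \<Longrightarrow> s \<le> t' \<Longrightarrow> t' \<le> T \<Longrightarrow> t' - t < \<delta> \<Longrightarrow>
     \<bar>?\<Phi> t' - ?\<Phi> t - 1 / 2 * (t' - t) * lim_flux \<theta> s\<bar> \<le> e / 2 * (t' - t)"
    using lim_increment[OF \<theta>, of "e / 2" T] e by (metis zero_less_divide_iff zero_less_numeral)
  show "\<exists>d>0. \<forall>y\<in>{0..T}. y \<noteq> t \<and> dist y t < d \<longrightarrow> dist ((?\<Phi> y - ?\<Phi> t) / (y - t)) (1 / 2 * lim_flux \<theta> t) < e"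
  proof (intro exI[of _ \<delta>] conjI \<delta> ballI impI)
    fix y assume y: "y \<in> {0..T}" "y \<noteq> t \<and> dist y t < \<delta>"
    have "\<bar>?\<Phi> y - ?\<Phi> t - 1 / 2 * (y - t) * lim_flux \<theta> t\<bar> \<le> e / 2 * \<bar>y - t\<bar>"
    proof (cases "t \<le> y")
      case True
      thus ?thesis using \<delta>(2)[of t t y] y t by (simp add: dist_real_def)
    next
      case False
      have "\<bar>?\<Phi> t - ?\<Phi> y - 1 / 2 * (t - y) * lim_flux \<theta> t\<bar> \<le> e / 2 * (t - y)"
        using False \<delta>(2)[of y t t] y t by (simp add: dist_real_def)
      moreover have "?\<Phi> y - ?\<Phi> t - 1 / 2 * (y - t) * lim_flux \<theta> t = - (?\<Phi> t - ?\<Phi> y - 1 / 2 * (t - y) * lim_flux \<theta> t)"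
        by (simp add: algebra_simps diff_divide_distrib)
      ultimately show ?thesis using False by (simp only: abs_minus_cancel) simp
    qed
    moreover have "(?\<Phi> y - ?\<Phi> t) / (y - t) - 1 / 2 * lim_flux \<theta> t = (?\<Phi> y - ?\<Phi> t - 1 / 2 * (y - t) * lim_flux \<theta> t) / (y - t)"
    proof -
      have "1 / 2 * d * l / d = 1 / 2 * l" if "d \<noteq> 0" for d l :: real using that by simp
      from this[of "y - t" "lim_flux \<theta> t"] show ?thesis using y by (simp only: diff_divide_distrib) simp
    qed
    ultimately have "\<bar>(?\<Phi> y - ?\<Phi> t) / (y - t) - 1 / 2 * lim_flux \<theta> t\<bar> \<le> e / 2"
      using y by (simp add: abs_divide divide_le_eq)
    thus "dist ((?\<Phi> y - ?\<Phi> t) / (y - t)) (1 / 2 * lim_flux \<theta> t) < e" using e by (simp add: dist_real_def)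
  qed
qed

lemma lim_weak:
  assumes \<theta>: "\<theta> \<in> borel_measurable borel" "\<And>x. \<bar>\<theta> x\<bar> \<le> c" and t: "0 \<le> t"
  shows "((\<lambda>s. 1 / 2 * lim_flux \<theta> s) has_integral
     ((LINT x|dens (lim_density t). \<theta> x) - (LINT x|dens f0. \<theta> x))) {0..t}"
proof -
  have "((\<lambda>s. 1 / 2 * lim_flux \<theta> s) has_integral
     ((LINT x|dens (lim_density t). \<theta> x) - (LINT x|dens (lim_density 0). \<theta> x))) {0..t}"
    by (rule fundamental_theorem_of_calculus[OF t])
       (rule lim_derivative[OF \<theta>, unfolded has_real_derivative_iff_has_vector_derivative])
  thus ?thesis by (simp add: lim_initial[OF linear_growth_bounded[OF \<theta>]])
qed

end

section \<open>Borel versions of Lebesgue measurable functions\<close>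

lemma AE_lebesgue_on_iff:
  fixes S :: "'a::euclidean_space set"
  shows "S \<in> sets borel \<Longrightarrow> (AE x in lebesgue_on S. P x) \<longleftrightarrow> (AE x in lborel. x \<in> S \<longrightarrow> P x)"
  by (subst AE_restrict_space_iff) (auto simp: AE_completion_iff)

lemma borel_measurable_completion_AE:
  assumes f: "f \<in> borel_measurable M" and eq: "AE x in M. f x = g x"
  shows "g \<in> borel_measurable (completion M)"
proof (rule measurableI)
  fix B :: "'b set" assume B: "B \<in> sets borel"
  have [measurable]: "f \<in> borel_measurable (completion M)" using f by (rule measurable_completion)
  have [measurable]: "Measurable.pred (completion M) (\<lambda>x. f x \<noteq> g x)"
    by (rule sets_completion_AE) (use eq in simp)
  have [measurable]: "Measurable.pred (completion M) (\<lambda>x. g x \<in> B \<and> f x \<noteq> g x)"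
    by (rule sets_completion_AE) (use eq in eventually_elim, simp)
  have "{x \<in> space (completion M). (f x \<in> B \<and> \<not> f x \<noteq> g x) \<or> (g x \<in> B \<and> f x \<noteq> g x)} \<in> sets (completion M)"
    using B by measurable
  moreover have "g -` B \<inter> space (completion M) =
      {x \<in> space (completion M). (f x \<in> B \<and> \<not> f x \<noteq> g x) \<or> (g x \<in> B \<and> f x \<noteq> g x)}" by auto
  ultimately show "g -` B \<inter> space (completion M) \<in> sets (completion M)" by simp
qed simp

text \<open>Integrals over Lebesgue measurable subsets are reduced to Borel functions on the whole space; measurability of \<open>g\<close> is
  a consequence, because the Lebesgue measure is complete.\<close>
lemma lebesgue_on_borel_version:
  fixes g g' :: "'a::euclidean_space \<Rightarrow> real"
  assumes S[measurable]: "S \<in> sets borel" and g'[measurable]: "g' \<in> borel_measurable borel"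
    and eq: "AE x in lborel. x \<in> S \<longrightarrow> g x = g' x"
  shows "integrable (lebesgue_on S) g \<longleftrightarrow> integrable lborel (\<lambda>x. indicator S x * g' x)"
    and "integral\<^sup>L (lebesgue_on S) g = (LINT x|lborel. indicator S x * g' x)"
proof -
  let ?g = "\<lambda>x. indicator S x * g x" and ?g' = "\<lambda>x. indicator S x * g' x"
  have m': "?g' \<in> borel_measurable lborel" by measurable
  have eq': "AE x in lborel. ?g' x = ?g x" using eq by eventually_elim (auto split: split_indicator)
  have m: "?g \<in> borel_measurable lebesgue" by (rule borel_measurable_completion_AE[OF m' eq'])
  have eq'': "AE x in lebesgue. ?g x = ?g' x" using AE_completion[OF eq'] by eventually_elim (rule sym)
  have m'': "?g' \<in> borel_measurable lebesgue" by (rule measurable_completion[OF m'])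
  have SL: "S \<inter> space lebesgue \<in> sets lebesgue" by simp
  show "integrable (lebesgue_on S) g \<longleftrightarrow> integrable lborel ?g'"
    unfolding integrable_restrict_space[OF SL] real_scaleR_def
    using integrable_cong_AE[OF m m'' eq''] integrable_completion[OF m'] by blast
  show "integral\<^sup>L (lebesgue_on S) g = (LINT x|lborel. indicator S x * g' x)"
    unfolding integral_restrict_space[OF SL] real_scaleR_def
    using integral_cong_AE[OF m m'' eq''] integral_completion[OF m'] by simp
qed

lemma ex_borel_version:
  fixes g :: "'a::euclidean_space \<Rightarrow> real"
  assumes S: "S \<in> sets borel" and g: "g \<in> borel_measurable (lebesgue_on S)"
  shows "\<exists>g'\<in>borel_measurable borel. AE x in lborel. x \<in> S \<longrightarrow> g x = g' x"
proof -
  have SL: "S \<inter> space lebesgue \<in> sets lebesgue" using S by simp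
  have "(\<lambda>x. indicator S x *\<^sub>R g x) \<in> borel_measurable lebesgue"
    using g unfolding borel_measurable_restrict_space_iff[OF SL] .
  from completion_ex_borel_measurable_real[OF this] obtain g' where
    "g' \<in> borel_measurable lborel" "AE x in lborel. indicator S x *\<^sub>R g x = g' x" by blast
  moreover from this(2) have "AE x in lborel. x \<in> S \<longrightarrow> g x = g' x" by eventually_elim auto
  ultimately show ?thesis by (intro bexI[of _ g']) auto
qed

lemma AE_pair_fst:
  assumes "AE x in lborel. P x"
  shows "AE p in lborel \<Otimes>\<^sub>M (lborel :: real measure). P (fst p :: real)"
proof -
  obtain N where N: "N \<in> null_sets lborel" "{x. \<not> P x} \<subseteq> N" using assms by (auto elim!: AE_E simp: null_sets_def)
  have [measurable]: "N \<in> sets borel" using N(1) by auto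
  have "AE p in lborel \<Otimes>\<^sub>M (lborel :: real measure). fst p \<notin> N"
  proof (rule lborel_pair.AE_pair_measure)
    show "AE x in lborel. AE y in (lborel :: real measure). fst (x, y) \<notin> N"
      using AE_not_in[OF N(1)] by eventually_elim simp
  qed measurable
  thus ?thesis by eventually_elim (use N(2) in auto)
qed

lemma AE_pair_swap:
  assumes "AE p in lborel \<Otimes>\<^sub>M (lborel :: real measure). P (p :: real \<times> real)"
  shows "AE p in lborel \<Otimes>\<^sub>M (lborel :: real measure). P (snd p, fst p)"
proof -
  have "AE p in distr (lborel \<Otimes>\<^sub>M lborel) (lborel \<Otimes>\<^sub>M lborel) (\<lambda>(x, y). (y, x :: real)). P p"
    using assms unfolding lborel_pair.distr_pair_swap[symmetric] .
  hence "AE p in lborel \<Otimes>\<^sub>M lborel. P (case p of (x, y) \<Rightarrow> (y, x))" by (rule AE_distrD[rotated]) simp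
  thus ?thesis by (simp add: case_prod_beta)
qed

lemma AE_pair_snd:
  assumes "AE x in lborel. P x"
  shows "AE p in (lborel :: real measure) \<Otimes>\<^sub>M lborel. P (snd p :: real)"
  using AE_pair_swap[OF AE_pair_fst[OF assms]] by simp

text \<open>A change of a test function on a null set is invisible in \<open>\<theta> (x + y)\<close>, because the shear preserves null sets.\<close>
lemma AE_pair_sum:
  assumes "AE x in lborel. P x"
  shows "AE p in lborel \<Otimes>\<^sub>M (lborel :: real measure). P (fst p + snd p)"
proof -
  have "AE p in distr (lborel \<Otimes>\<^sub>M lborel) (borel \<Otimes>\<^sub>M borel) (\<lambda>(y, z). (y, y + z)). P (snd p)"
    unfolding distr_shear by (rule AE_pair_snd[OF assms])
  hence "AE p in lborel \<Otimes>\<^sub>M lborel. P (snd (case p of (y, z) \<Rightarrow> (y, y + z)))" by (rule AE_distrD[rotated]) simp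
  thus ?thesis by (simp add: case_prod_beta)
qed

section \<open>Densities as elements of the weighted spaces\<close>

lemma halfline_integral_dens:
  assumes f: "size_density f" and \<theta>: "linear_growth \<theta>" and eq: "AE x in lborel. 0 < x \<longrightarrow> g x = \<theta> x * f x"
  shows "integrable halfline g" "integral\<^sup>L halfline g = (LINT x|dens f. \<theta> x)"
proof -
  have [measurable]: "f \<in> borel_measurable borel" "\<theta> \<in> borel_measurable borel"
    using f \<theta> by (auto simp: size_density_def linear_growth_def)
  have e: "(\<lambda>x. indicator {0<..} x * (\<theta> x * f x)) = (\<lambda>x. \<theta> x * f x)"
    using size_density_zero[OF f] by (auto simp: indicator_def fun_eq_iff)
  have eq': "AE x in lborel. x \<in> {0<..} \<longrightarrow> g x = \<theta> x * f x" using eq by simp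
  have m: "(\<lambda>x. \<theta> x * f x) \<in> borel_measurable borel" by measurable
  note L = lebesgue_on_borel_version[OF _ m eq', unfolded e]
  show "integrable halfline g" by (subst L(1)) (auto intro: integrable_linear_growth(1)[OF f \<theta>])
  show "integral\<^sup>L halfline g = (LINT x|dens f. \<theta> x)" by (subst L(2)) (auto simp: integral_dens[OF f])
qed

lemma size_density_L1_weighted:
  assumes f: "size_density f"
  shows "f \<in> L1" "f \<in> L1_weighted 1"
    and "L1_weighted_norm 1 f = number f + first_moment f"
proof -
  show 1: "f \<in> L1" unfolding L1_def
    using halfline_integral_dens(1)[OF f linear_growth_1(1), of f] by simp
  have e: "AE x in lborel. 0 < x \<longrightarrow> (1 + x powr 1) * \<bar>f x\<bar> = (1 + x) * f x"
    using size_density_nonneg[OF f] by simp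
  note H = halfline_integral_dens[OF f linear_growth_1(3) e]
  show "f \<in> L1_weighted 1" unfolding L1_weighted_def using 1 H(1) by simp
  show "L1_weighted_norm 1 f = number f + first_moment f"
    unfolding L1_weighted_norm_def H(2) integral_dens_abs(2)[OF f] ..
qed

lemma moments_dens:
  assumes f: "size_density f" and eq: "AE x in lborel. 0 < x \<longrightarrow> g x = f x"
  shows "moment 0 g = number f" "moment 1 g = first_moment f"
proof -
  have "AE x in lborel. 0 < x \<longrightarrow> x powr 0 * g x = 1 * f x" using eq by eventually_elim simp
  from halfline_integral_dens(2)[OF f linear_growth_1(1) this]
  show "moment 0 g = number f" unfolding moment_def using integral_dens_1(1)[OF f] by simp
  have "AE x in lborel. 0 < x \<longrightarrow> x powr 1 * g x = x * f x" using eq by eventually_elim simp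
  from halfline_integral_dens(2)[OF f linear_growth_ident(1) this]
  show "moment 1 g = first_moment f" unfolding moment_def using integral_dens_1(2)[OF f] by simp
qed

lemma integrable_density_diff:
  assumes f: "size_density f" and g: "size_density g"
  shows "integrable lborel (\<lambda>x. \<bar>f x - g x\<bar>)" "integrable lborel (\<lambda>x. (1 + x) * \<bar>f x - g x\<bar>)"
proof -
  have [measurable]: "f \<in> borel_measurable borel" "g \<in> borel_measurable borel"
    using f g by (auto simp: size_density_def)
  show "integrable lborel (\<lambda>x. \<bar>f x - g x\<bar>)"
    using f g by (intro integrable_abs Bochner_Integration.integrable_diff) (auto simp: size_density_def)
  have "(\<lambda>x. (1 + x) * \<bar>f x - g x\<bar>) = (\<lambda>x. \<bar>(1 + x) * f x - (1 + x) * g x\<bar>)"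
  proof
    fix x
    show "(1 + x) * \<bar>f x - g x\<bar> = \<bar>(1 + x) * f x - (1 + x) * g x\<bar>"
    proof (cases "x \<le> 0")
      case False
      thus ?thesis by (simp add: right_diff_distrib[symmetric] abs_mult)
    qed (simp add: size_density_zero[OF f] size_density_zero[OF g])
  qed
  thus "integrable lborel (\<lambda>x. (1 + x) * \<bar>f x - g x\<bar>)"
    using integrable_linear_growth(1)[OF f linear_growth_1(3)] integrable_linear_growth(1)[OF g linear_growth_1(3)]
    by (simp only: integrable_abs Bochner_Integration.integrable_diff)
qed

lemma L1_norm_diff:
  assumes f: "size_density f" and g: "size_density g"
  shows "L1_norm (\<lambda>x. f x - g x) = (LINT x|lborel. \<bar>f x - g x\<bar>)"
    and "L1_weighted_norm 1 (\<lambda>x. f x - g x) = (LINT x|lborel. (1 + x) * \<bar>f x - g x\<bar>)"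
proof -
  have [measurable]: "f \<in> borel_measurable borel" "g \<in> borel_measurable borel"
    using f g by (auto simp: size_density_def)
  have e: "(\<lambda>x. indicator {0<..} x * \<bar>f x - g x\<bar>) = (\<lambda>x. \<bar>f x - g x\<bar>)"
    "(\<lambda>x. indicator {0<..} x * ((1 + x) * \<bar>f x - g x\<bar>)) = (\<lambda>x. (1 + x) * \<bar>f x - g x\<bar>)"
    using size_density_zero[OF f] size_density_zero[OF g] by (auto simp: indicator_def fun_eq_iff)
  show "L1_norm (\<lambda>x. f x - g x) = (LINT x|lborel. \<bar>f x - g x\<bar>)" unfolding L1_norm_def
    by (subst lebesgue_on_borel_version(2)[where g' = "\<lambda>x. \<bar>f x - g x\<bar>"]) (auto simp: e)
  show "L1_weighted_norm 1 (\<lambda>x. f x - g x) = (LINT x|lborel. (1 + x) * \<bar>f x - g x\<bar>)" unfolding L1_weighted_norm_def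
    by (subst lebesgue_on_borel_version(2)[where g' = "\<lambda>x. (1 + x) * \<bar>f x - g x\<bar>"]) (auto simp: e)
qed

lemma weighted_diff_le:
  assumes f: "size_density f" and g: "size_density g" and R: "1 \<le> R"
  shows "L1_weighted_norm 1 (\<lambda>x. f x - g x) \<le>
    (1 + R) * (LINT x|lborel. \<bar>f x - g x\<bar>) + 2 * (first_tail R f + first_tail R g)"
proof -
  let ?t = "\<lambda>x. indicator {R<..} x * x"
  note d = integrable_density_diff[OF f g]
  note it = integrable_linear_growth(1)[OF f linear_growth_tail[of R]] integrable_linear_growth(1)[OF g linear_growth_tail[of R]]
  have "(LINT x|lborel. (1 + x) * \<bar>f x - g x\<bar>) \<le> (LINT x|lborel. (1 + R) * \<bar>f x - g x\<bar> + 2 * (?t x * f x + ?t x * g x))"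
  proof (intro integral_mono d Bochner_Integration.integrable_add integrable_mult_right it)
    fix x
    have fg: "0 \<le> f x" "0 \<le> g x" using f g by (auto simp: size_density_nonneg)
    show "(1 + x) * \<bar>f x - g x\<bar> \<le> (1 + R) * \<bar>f x - g x\<bar> + 2 * (?t x * f x + ?t x * g x)"
    proof (cases "x > R")
      case True
      have "(1 + x) * \<bar>f x - g x\<bar> \<le> (2 * x) * (f x + g x)"
        using True R fg by (intro mult_mono) auto
      moreover have "0 \<le> (1 + R) * \<bar>f x - g x\<bar>" using R by simp
      moreover have "2 * (?t x * f x + ?t x * g x) = (2 * x) * (f x + g x)" using True by (simp add: algebra_simps)
      ultimately show ?thesis by linarith
    next
      case False
      hence "(1 + x) * \<bar>f x - g x\<bar> \<le> (1 + R) * \<bar>f x - g x\<bar>" by (intro mult_right_mono) auto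
      thus ?thesis using False by simp
    qed
  qed
  also have "\<dots> = (1 + R) * (LINT x|lborel. \<bar>f x - g x\<bar>) + 2 * (first_tail R f + first_tail R g)"
    using d(1) it by (simp add: first_tail_def integral_dens[OF f] integral_dens[OF g])
  finally show ?thesis unfolding L1_norm_diff(2)[OF f g] .
qed

context approximation
begin

text \<open>The norm is attained at the sign of the difference as a test function.\<close>
lemma lim_L1_lipschitz:
  assumes "0 \<le> s" "0 \<le> t"
  shows "(LINT x|lborel. \<bar>lim_density t x - lim_density s x\<bar>) \<le> E.c\<^sub>1 * \<bar>t - s\<bar>"
proof -
  note ft = lim_density[of t] and fs = lim_density[of s]
  have [measurable]: "lim_density t \<in> borel_measurable borel" "lim_density s \<in> borel_measurable borel"
    by (rule size_density_measurable[OF lim_density])+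
  define \<theta> where "\<theta> x = sgn (lim_density t x - lim_density s x)" for x
  have \<theta>m: "\<theta> \<in> borel_measurable borel" unfolding \<theta>_def by measurable
  have \<theta>b: "\<bar>\<theta> x\<bar> \<le> 1" for x by (simp add: \<theta>_def sgn_if)
  note lg = linear_growth_bounded[OF \<theta>m \<theta>b]
  have "(LINT x|lborel. \<bar>lim_density t x - lim_density s x\<bar>) = (LINT x|lborel. \<theta> x * lim_density t x - \<theta> x * lim_density s x)"
    by (intro Bochner_Integration.integral_cong) (auto simp: \<theta>_def abs_sgn algebra_simps)
  also have "\<dots> = (LINT x|dens (lim_density t). \<theta> x) - (LINT x|dens (lim_density s). \<theta> x)"
    using integrable_linear_growth(1)[OF ft lg] integrable_linear_growth(1)[OF fs lg]
    by (simp add: integral_dens[OF ft \<theta>m] integral_dens[OF fs \<theta>m])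
  also have "\<dots> \<le> E.c\<^sub>1 * \<bar>t - s\<bar>" using lim_lipschitz[OF assms \<theta>m \<theta>b] by simp
  finally show ?thesis .
qed

lemma lim_continuous_L1: "continuous_L1 lim_density"
  unfolding continuous_L1_def
proof (intro allI impI conjI)
  fix t :: real assume t: "0 \<le> t"
  show "lim_density t \<in> L1" by (rule size_density_L1_weighted(1)[OF lim_density])
  have "((\<lambda>s. E.c\<^sub>1 * \<bar>s - t\<bar>) \<longlongrightarrow> E.c\<^sub>1 * \<bar>t - t\<bar>) (at t within {0..})"
    by (intro tendsto_intros)
  hence lim: "((\<lambda>s. E.c\<^sub>1 * \<bar>s - t\<bar>) \<longlongrightarrow> 0) (at t within {0..})" by simp
  show "((\<lambda>s. L1_norm (\<lambda>x. lim_density s x - lim_density t x)) \<longlongrightarrow> 0) (at t within {0..})"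
  proof (rule tendsto_sandwich[OF _ _ tendsto_const lim])
    show "\<forall>\<^sub>F s in at t within {0..}. 0 \<le> L1_norm (\<lambda>x. lim_density s x - lim_density t x)"
      by (simp add: L1_norm_def)
    show "\<forall>\<^sub>F s in at t within {0..}. L1_norm (\<lambda>x. lim_density s x - lim_density t x) \<le> E.c\<^sub>1 * \<bar>s - t\<bar>"
      unfolding eventually_at_filter
      by (intro always_eventually allI impI) (simp add: L1_norm_diff(1)[OF lim_density lim_density] lim_L1_lipschitz[OF t])
  qed
qed

text \<open>Together with the uniform tails, Lipschitz continuity in \<open>L\<^sup>1\<close> yields continuity in the weighted space, so
  that the curve is approximated by sampling it at finitely many times.\<close>
lemma lim_strongly_measurable: "strongly_measurable_L1_weighted 1 lim_density"
  unfolding strongly_measurable_L1_weighted_def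
proof (intro exI[of _ "\<lambda>n t. lim_density (min (real_of_int \<lfloor>real (Suc n) * t\<rfloor> / real (Suc n)) (real n))"] conjI allI impI)
  fix n
  let ?\<phi> = "\<lambda>t. min (real_of_int \<lfloor>real (Suc n) * t\<rfloor> / real (Suc n)) (real n)"
  have "?\<phi> \<in> borel_measurable borel" by measurable
  hence m: "?\<phi> \<in> borel_measurable halfline"
    by (intro measurable_restrict_space1 measurable_completion) simp
  have fin: "?\<phi> ` space halfline \<subseteq> (\<lambda>k. real k / real (Suc n)) ` {..n * Suc n}"
  proof safe
    fix t :: real assume "t \<in> space halfline"
    hence t: "0 < t" by (simp add: space_restrict_space)
    define k where "k = nat \<lfloor>real (Suc n) * t\<rfloor>"
    have k: "real_of_int \<lfloor>real (Suc n) * t\<rfloor> = real k" using t by (simp add: k_def)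
    show "?\<phi> t \<in> (\<lambda>k. real k / real (Suc n)) ` {..n * Suc n}"
    proof (cases "k \<le> n * Suc n")
      case True
      hence "real k \<le> real n * real (Suc n)" by (metis of_nat_le_iff of_nat_mult)
      hence "real k / real (Suc n) \<le> real n" by (simp add: divide_le_eq)
      thus ?thesis using True unfolding k by (intro image_eqI[of _ _ k]) (auto simp: min_def)
    next
      case False
      hence "real n * real (Suc n) \<le> real k" by (metis of_nat_le_iff of_nat_mult nat_le_linear)
      hence "real n \<le> real k / real (Suc n)" by (simp add: le_divide_eq)
      moreover have "real n = real (n * Suc n) / real (Suc n)"
        unfolding of_nat_mult by (rule nonzero_mult_div_cancel_right[symmetric]) simp
      ultimately have "?\<phi> t = real (n * Suc n) / real (Suc n)" unfolding k by (metis min_absorb2)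
      thus ?thesis by (rule image_eqI) simp
    qed
  qed
  have "simple_function halfline ?\<phi>"
    by (rule simple_function_borel_measurable[OF m]) (rule finite_subset[OF fin], simp)
  from simple_function_compose[OF this, of lim_density]
  show "simple_function halfline (\<lambda>t. lim_density (?\<phi> t))" by (simp add: comp_def)
  show "lim_density (?\<phi> t) \<in> L1_weighted 1" for t by (rule size_density_L1_weighted(2)[OF lim_density])
next
  let ?\<phi> = "\<lambda>n t. min (real_of_int \<lfloor>real (Suc n) * t\<rfloor> / real (Suc n)) (real n)"
  have "(\<lambda>n. L1_weighted_norm 1 (\<lambda>x. lim_density (?\<phi> n t) x - lim_density t x)) \<longlonglongrightarrow> 0"
    if t: "0 < t" for t
  proof (rule LIMSEQ_I)
    fix e :: real assume e: "0 < e"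
    obtain R where R: "1 \<le> R" "\<And>s. \<bar>s\<bar> \<le> t \<Longrightarrow> first_tail R (lim_density s) \<le> e / 8"
      using lim_tail[of "e / 8" t] e by auto
    have c1: "0 \<le> E.c\<^sub>1" unfolding E.c\<^sub>1_def using \<kappa>_pos m0_nonneg m1_nonneg by simp
    have "(\<lambda>n. (1 + R) * (E.c\<^sub>1 * inverse (real (Suc n)))) \<longlonglongrightarrow> (1 + R) * (E.c\<^sub>1 * 0)"
      by (intro tendsto_intros LIMSEQ_inverse_real_of_nat)
    from LIMSEQ_D[OF this, of "e / 2"] e obtain n1 where
      n1: "\<And>n. n \<ge> n1 \<Longrightarrow> \<bar>(1 + R) * (E.c\<^sub>1 * inverse (real (Suc n)))\<bar> < e / 2" by auto
    show "\<exists>n0. \<forall>n\<ge>n0. norm (L1_weighted_norm 1 (\<lambda>x. lim_density (?\<phi> n t) x - lim_density t x) - 0) < e"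
    proof (intro exI[of _ "max n1 (nat \<lceil>t\<rceil>)"] allI impI)
      fix n assume n: "max n1 (nat \<lceil>t\<rceil>) \<le> n"
      let ?s = "?\<phi> n t"
      have tn: "t \<le> real n" using n by linarith
      define z where "z = real_of_int \<lfloor>real (Suc n) * t\<rfloor>"
      have z: "0 \<le> z" unfolding z_def using t by simp
      have z': "z \<le> real (Suc n) * t" "real (Suc n) * t - 1 \<le> z" unfolding z_def by linarith+
      have zt: "z / real (Suc n) \<le> t" using z'(1) by (simp add: divide_le_eq mult.commute)
      hence s: "?s = z / real (Suc n)" using tn unfolding z_def[symmetric] by simp
      have s0: "0 \<le> ?s" "?s \<le> t" unfolding s using z zt by auto
      have "real (Suc n) * (t - ?s) \<le> 1" unfolding s using z'(2) by (simp add: right_diff_distrib del: of_nat_Suc)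
      hence d: "\<bar>?s - t\<bar> \<le> inverse (real (Suc n))" using s0
        by (simp add: inverse_eq_divide le_divide_eq mult.commute del: of_nat_Suc)
      have nn: "0 \<le> L1_weighted_norm 1 (\<lambda>x. lim_density ?s x - lim_density t x)"
        unfolding L1_weighted_norm_def by (intro integral_nonneg_AE AE_I2) (auto intro!: mult_nonneg_nonneg add_nonneg_nonneg)
      have "L1_weighted_norm 1 (\<lambda>x. lim_density ?s x - lim_density t x) \<le>
          (1 + R) * (LINT x|lborel. \<bar>lim_density ?s x - lim_density t x\<bar>)
            + 2 * (first_tail R (lim_density ?s) + first_tail R (lim_density t))"
        by (rule weighted_diff_le[OF lim_density lim_density R(1)])
      also have "\<dots> \<le> (1 + R) * (E.c\<^sub>1 * inverse (real (Suc n))) + 2 * (e / 8 + e / 8)"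
      proof (intro add_mono mult_left_mono)
        have "(LINT x|lborel. \<bar>lim_density ?s x - lim_density t x\<bar>) \<le> E.c\<^sub>1 * \<bar>?s - t\<bar>"
          using t s0 by (intro lim_L1_lipschitz) auto
        also have "\<dots> \<le> E.c\<^sub>1 * inverse (real (Suc n))" by (intro mult_left_mono d c1)
        finally show "(LINT x|lborel. \<bar>lim_density ?s x - lim_density t x\<bar>) \<le> E.c\<^sub>1 * inverse (real (Suc n))" .
      qed (use R t s0 in auto)
      also have "\<dots> < e" using n1[of n] n e by auto
      finally show "norm (L1_weighted_norm 1 (\<lambda>x. lim_density ?s x - lim_density t x) - 0) < e" using nn by simp
    qed
  qed
  thus "AE t in halfline. lim_density t \<in> L1_weighted 1 \<and>
      (\<lambda>n. L1_weighted_norm 1 (\<lambda>x. lim_density (?\<phi> n t) x - lim_density t x)) \<longlonglongrightarrow> 0"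
    by (intro AE_I2) (simp add: space_restrict_space size_density_L1_weighted(2)[OF lim_density])
qed

lemma lim_Linf_L1_weighted: "lim_density \<in> Linf_L1_weighted 1"
  unfolding Linf_L1_weighted_def
  using lim_strongly_measurable lim_number lim_moment
  by (auto intro!: exI[of _ "m\<^sub>0 + m\<^sub>1"] simp: size_density_L1_weighted(3)[OF lim_density])

text \<open>All data agree almost everywhere with Borel versions: \<open>\<theta>\<close> with a bounded function \<open>\<theta>'\<close>, \<open>K'\<close> with \<open>K\<close>, and
  \<open>f_in\<close> with \<open>f0\<close>.  By Fubini's theorem for null sets, the inner integrals agree for almost every \<open>x\<close>.\<close>
lemma lim_solution:
  assumes \<theta>: "\<theta> \<in> Linf" and t: "0 < t"
    and K': "AE p in lborel \<Otimes>\<^sub>M lborel. 0 < fst p \<and> 0 < snd p \<longrightarrow> K' (fst p) (snd p) = K (fst p) (snd p)"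
    and f_in: "AE x in lborel. 0 < x \<longrightarrow> f_in x = f0 x"
  defines "J \<equiv> \<lambda>s x y. tilde \<theta> x y * K' x y * lim_density s x * lim_density s y"
  shows "integrable quadrant (\<lambda>(x, y). J s x y)"
    and "integrable (lebesgue_on {0<..<t}) (\<lambda>s. LINT x|halfline. LINT y|halfline. J s x y)"
    and "(LINT x|halfline. \<theta> x * (lim_density t x - f_in x)) =
       1 / 2 * (LINT s|lebesgue_on {0<..<t}. LINT x|halfline. LINT y|halfline. J s x y)"
proof -
  obtain C0 where \<theta>m: "\<theta> \<in> borel_measurable halfline" and C0: "AE x in halfline. \<bar>\<theta> x\<bar> \<le> C0"
    using \<theta> by (auto simp: Linf_def)
  obtain \<theta>1 where \<theta>1[measurable]: "\<theta>1 \<in> borel_measurable borel" "AE x in lborel. x \<in> {0<..} \<longrightarrow> \<theta> x = \<theta>1 x"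
    using ex_borel_version[OF _ \<theta>m] by auto
  define C where "C = \<bar>C0\<bar>"
  define \<theta>' where "\<theta>' x = max (- C) (min C (\<theta>1 x))" for x
  have \<theta>'m[measurable]: "\<theta>' \<in> borel_measurable borel" unfolding \<theta>'_def by measurable
  have \<theta>'b: "\<bar>\<theta>' x\<bar> \<le> C" for x unfolding \<theta>'_def C_def by (auto simp: abs_le_iff)
  have C0': "AE x in lborel. x \<in> {0<..} \<longrightarrow> \<bar>\<theta> x\<bar> \<le> C0" using C0 by (simp add: AE_lebesgue_on_iff)
  have \<theta>': "AE x in lborel. 0 < x \<longrightarrow> \<theta> x = \<theta>' x"
    using \<theta>1(2) C0' by eventually_elim (auto simp: \<theta>'_def C_def abs_le_iff)
  note lg = linear_growth_bounded[OF \<theta>'m \<theta>'b]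
  have J: "integrable quadrant (\<lambda>(x, y). J s x y) \<and> (LINT x|halfline. LINT y|halfline. J s x y) = lim_flux \<theta>' s" for s
  proof -
    note f = lim_density[of s]
    have [measurable]: "lim_density s \<in> borel_measurable borel" by (rule size_density_measurable[OF f])
    define G where "G x y = tilde \<theta>' x y * K x y * (lim_density s x * lim_density s y)" for x y
    have Gm[measurable]: "case_prod G \<in> borel_measurable (borel \<Otimes>\<^sub>M borel)" unfolding G_def by measurable
    have G0: "indicator ({0<..} \<times> {0<..}) p * case_prod G p = case_prod G p" 
      "indicator {0<..} x * G x y = G x y" "indicator {0<..} y * G x y = G x y" for x y p
    proof -
      have "0 < x" if "lim_density s x \<noteq> 0" for x using size_density_zero[OF f, of x] that by (cases "x \<le> 0") auto
      thus "indicator ({0<..} \<times> {0<..}) p * case_prod G p = case_prod G p" 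
        "indicator {0<..} x * G x y = G x y" "indicator {0<..} y * G x y = G x y" for x y p
        by (auto simp: G_def indicator_def split: prod.splits)
    qed
    have Hm: "case_prod (\<lambda>x y. tilde \<theta>' x y * K x y) \<in> borel_measurable (borel \<Otimes>\<^sub>M borel)" by measurable
    have Hb: "\<bar>tilde \<theta>' x y * K x y\<bar> \<le> 3 * C * \<kappa> * 2 * ((1 + \<bar>x\<bar>) * (1 + \<bar>y\<bar>))" for x y
    proof -
      have "2 + \<bar>x\<bar> + \<bar>y\<bar> \<le> 2 * ((1 + \<bar>x\<bar>) * (1 + \<bar>y\<bar>))" by (simp add: algebra_simps)
      hence "3 * C * \<kappa> * (2 + \<bar>x\<bar> + \<bar>y\<bar>) \<le> 3 * C * \<kappa> * (2 * ((1 + \<bar>x\<bar>) * (1 + \<bar>y\<bar>)))"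
        using \<kappa>_pos by (intro mult_left_mono) (auto simp: C_def)
      also have "\<dots> = 3 * C * \<kappa> * 2 * ((1 + \<bar>x\<bar>) * (1 + \<bar>y\<bar>))" by (simp only: mult.assoc)
      finally show ?thesis using tilde_K_le[of \<theta>' C x y, OF \<theta>'b] by linarith
    qed
    have Gi: "integrable (lborel \<Otimes>\<^sub>M lborel) (case_prod G)"
      using integrable_product_growth(2)[OF f Hm Hb] unfolding G_def .
    have Gint: "integral\<^sup>L (lborel \<Otimes>\<^sub>M lborel) (case_prod G) = lim_flux \<theta>' s"
      unfolding lim_flux_def integral_dens_square[OF f Hm] G_def ..
    have ae: "AE p in lborel \<Otimes>\<^sub>M lborel. 0 < fst p \<and> 0 < snd p \<longrightarrow> J s (fst p) (snd p) = G (fst p) (snd p)"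
      using K' AE_pair_fst[OF \<theta>'] AE_pair_snd[OF \<theta>'] AE_pair_sum[OF \<theta>']
      by eventually_elim (auto simp: J_def G_def tilde_def)
    have q: "{0<..} \<times> {0<..} \<in> sets (borel :: (real \<times> real) measure)" by (simp add: borel_prod[symmetric])
    have Gm': "case_prod G \<in> borel_measurable (borel :: (real \<times> real) measure)" using Gm by (simp add: borel_prod)
    have ae': "AE p in lborel. p \<in> {0<..} \<times> {0<..} \<longrightarrow> (case p of (x, y) \<Rightarrow> J s x y) = case_prod G p"
      using ae unfolding lborel_prod by eventually_elim auto
    have "integrable quadrant (\<lambda>(x, y). J s x y)"
      unfolding lebesgue_on_borel_version(1)[OF q Gm' ae'] G0 using Gi by (simp add: lborel_prod)
    moreover have "(LINT x|halfline. LINT y|halfline. J s x y) = lim_flux \<theta>' s"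
    proof -
      have inner: "AE x in lborel. x \<in> {0<..} \<longrightarrow> (LINT y|halfline. J s x y) = (LINT y|lborel. G x y)"
        using lborel_pair.AE_pair[OF ae]
      proof eventually_elim
        case (elim x)
        show ?case
        proof
          assume x: "x \<in> {0<..}"
          have "AE y in lborel. y \<in> {0<..} \<longrightarrow> J s x y = G x y" using elim by eventually_elim (use x in auto)
          moreover have "G x \<in> borel_measurable borel" by measurable
          ultimately show "(LINT y|halfline. J s x y) = (LINT y|lborel. G x y)"
            by (subst lebesgue_on_borel_version(2)[where g' = "G x"]) (auto simp: G0)
        qed
      qed
      have m: "(\<lambda>x. LINT y|lborel. G x y) \<in> borel_measurable borel" by measurable
      have halfline_borel: "{0<..} \<in> sets (borel :: real measure)" by simp
      have ind: "indicator {0<..} x * (LINT y|lborel. G x y) = (LINT y|lborel. G x y)" for x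
      proof -
        have "indicator {0<..} x * (LINT y|lborel. G x y) = (LINT y|lborel. indicator {0<..} x * G x y)" by simp
        thus ?thesis by (simp only: G0)
      qed
      have "(LINT x|halfline. LINT y|halfline. J s x y) = (LINT x|lborel. (LINT y|lborel. G x y))"
        by (simp only: lebesgue_on_borel_version(2)[OF halfline_borel m inner] ind)
      also have "\<dots> = lim_flux \<theta>' s" using lborel_pair.integral_fst[OF Gi] Gint by simp
      finally show ?thesis .
    qed
    ultimately show ?thesis ..
  qed
  show "integrable quadrant (\<lambda>(x, y). J s x y)" using J by blast
  have Jeq: "(\<lambda>s. LINT x|halfline. LINT y|halfline. J s x y) = lim_flux \<theta>'" using J by blast
  have ai: "lim_flux \<theta>' absolutely_integrable_on {0..t}"
    by (intro absolutely_integrable_continuous_real lim_flux_continuous[OF \<theta>'m \<theta>'b])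
  have "lim_flux \<theta>' absolutely_integrable_on {0<..<t}"
    by (rule set_integrable_subset[OF ai]) auto
  hence int: "integrable (lebesgue_on {0<..<t}) (lim_flux \<theta>')"
    unfolding set_integrable_def by (subst integrable_restrict_space) auto
  show "integrable (lebesgue_on {0<..<t}) (\<lambda>s. LINT x|halfline. LINT y|halfline. J s x y)"
    unfolding Jeq by (rule int)
  have "(LINT s|lebesgue_on {0<..<t}. lim_flux \<theta>' s) = integral {0..t} (lim_flux \<theta>')"
    unfolding integral_open_interval_real by (rule lebesgue_integral_eq_integral[OF int]) simp
  hence R: "1 / 2 * (LINT s|lebesgue_on {0<..<t}. lim_flux \<theta>' s) = (LINT x|dens (lim_density t). \<theta>' x) - (LINT x|dens f0. \<theta>' x)"
    using lim_weak[OF \<theta>'m \<theta>'b, of t] t integral_unique[OF lim_weak[OF \<theta>'m \<theta>'b, of t]] by simp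
  have e1: "AE x in lborel. 0 < x \<longrightarrow> \<theta> x * lim_density t x = \<theta>' x * lim_density t x"
    using \<theta>' by eventually_elim auto
  have e2: "AE x in lborel. 0 < x \<longrightarrow> \<theta> x * f_in x = \<theta>' x * f0 x"
    using \<theta>' f_in by eventually_elim auto
  note H1 = halfline_integral_dens[OF lim_density lg e1] and H2 = halfline_integral_dens[OF f0 lg e2]
  have "(LINT x|halfline. \<theta> x * (lim_density t x - f_in x)) = (LINT x|halfline. \<theta> x * lim_density t x) - (LINT x|halfline. \<theta> x * f_in x)"
    unfolding right_diff_distrib by (rule Bochner_Integration.integral_diff[OF H1(1) H2(1)])
  thus "(LINT x|halfline. \<theta> x * (lim_density t x - f_in x)) =
       1 / 2 * (LINT s|lebesgue_on {0<..<t}. LINT x|halfline. LINT y|halfline. J s x y)"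
    unfolding Jeq R H1(2) H2(2) .
qed

end

section \<open>Borel versions of the data\<close>

text \<open>A Borel version satisfies symmetry and bounds only almost everywhere; clipping and symmetrizing it makes them hold
  everywhere, and changes nothing where they held.\<close>
lemma ex_borel_kernel:
  fixes K :: "real \<Rightarrow> real \<Rightarrow> real"
  assumes K: "(\<lambda>(x, y). K x y) \<in> borel_measurable quadrant" and \<kappa>: "\<kappa> > 0"
    and bd: "\<And>x y. x > 0 \<Longrightarrow> y > 0 \<Longrightarrow> 0 \<le> K x y \<and> K x y = K y x \<and> K x y \<le> \<kappa> * (2 + x + y)"
  shows "\<exists>K'. coag_kernel K' \<kappa> \<and>
    (AE p in lborel \<Otimes>\<^sub>M lborel. 0 < fst p \<and> 0 < snd p \<longrightarrow> K (fst p) (snd p) = K' (fst p) (snd p))"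
proof -
  have q: "{0<..} \<times> {0<..} \<in> sets (borel :: (real \<times> real) measure)" by (simp add: borel_prod[symmetric])
  obtain k where k: "k \<in> borel_measurable (borel :: (real \<times> real) measure)"
    and eq: "AE p in lborel. p \<in> {0<..} \<times> {0<..} \<longrightarrow> (case p of (x, y) \<Rightarrow> K x y) = k p"
    using ex_borel_version[OF q K] by blast
  have [measurable]: "k \<in> borel_measurable (borel \<Otimes>\<^sub>M borel)" using k by (simp add: borel_prod)
  define k1 where "k1 x y = (if 0 < x \<and> 0 < y then min (max 0 (k (x, y))) (\<kappa> * (2 + x + y)) else 0)" for x y
  define K' where "K' x y = (k1 x y + k1 y x) / 2" for x y
  have eq': "AE p in lborel \<Otimes>\<^sub>M lborel. 0 < fst p \<and> 0 < snd p \<longrightarrow> K (fst p) (snd p) = k p"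
    using eq unfolding lborel_prod by eventually_elim auto
  have "coag_kernel K' \<kappa>"
  proof
    show "case_prod K' \<in> borel_measurable (borel \<Otimes>\<^sub>M borel)" unfolding K'_def k1_def by measurable
    fix x y
    have k1: "0 \<le> k1 x y" for x y using \<kappa> by (auto simp: k1_def)
    show "0 \<le> K' x y" using k1[of x y] k1[of y x] by (simp add: K'_def)
    show "K' x y = K' y x" by (simp add: K'_def add.commute)
    show "x \<le> 0 \<Longrightarrow> K' x y = 0" by (simp add: K'_def k1_def)
    show "K' x y \<le> \<kappa> * (2 + x + y)" if "0 < x" "0 < y"
    proof -
      have "k1 x y \<le> \<kappa> * (2 + x + y)" "k1 y x \<le> \<kappa> * (2 + y + x)" using that by (auto simp: k1_def)
      moreover have "2 + y + x = 2 + x + y" by simp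
      ultimately show ?thesis unfolding K'_def by simp
    qed
  qed (rule \<kappa>)
  moreover have "AE p in lborel \<Otimes>\<^sub>M lborel. 0 < fst p \<and> 0 < snd p \<longrightarrow> K (fst p) (snd p) = K' (fst p) (snd p)"
    using eq' AE_pair_swap[OF eq']
  proof eventually_elim
    case (elim p)
    show ?case
    proof
      assume p: "0 < fst p \<and> 0 < snd p"
      define a where "a = K (fst p) (snd p)"
      have a: "0 \<le> a" "K (snd p) (fst p) = a" "a \<le> \<kappa> * (2 + fst p + snd p)"
        using bd[of "fst p" "snd p"] p by (auto simp: a_def)
      have "k (fst p, snd p) = a" "k (snd p, fst p) = a" using elim p a(2) by (simp_all add: a_def)
      moreover have "a \<le> \<kappa> * (2 + snd p + fst p)" using a(3) by (simp add: add_ac)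
      ultimately show "K (fst p) (snd p) = K' (fst p) (snd p)"
        using p a(1,3) unfolding a_def[symmetric] K'_def k1_def by simp
    qed
  qed
  ultimately show ?thesis by blast
qed

lemma ex_borel_density:
  assumes f: "f \<in> L1_weighted 1" and pos: "AE x in halfline. f x \<ge> 0"
  shows "\<exists>f'. size_density f' \<and> (AE x in lborel. 0 < x \<longrightarrow> f x = f' x)"
proof -
  have fi: "integrable halfline f" and wi: "integrable halfline (\<lambda>x. (1 + x powr 1) * \<bar>f x\<bar>)"
    using f by (auto simp: L1_weighted_def L1_def)
  obtain g where [measurable]: "g \<in> borel_measurable borel" and g: "AE x in lborel. x \<in> {0<..} \<longrightarrow> f x = g x"
    using ex_borel_version[OF _ borel_measurable_integrable[OF fi]] by auto
  define f' where "f' x = indicator {0<..} x * max 0 (g x)" for x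
  have f'm[measurable]: "f' \<in> borel_measurable borel" unfolding f'_def by measurable
  have pos': "AE x in lborel. x \<in> {0<..} \<longrightarrow> 0 \<le> f x" using pos by (simp add: AE_lebesgue_on_iff)
  have eq: "AE x in lborel. x \<in> {0<..} \<longrightarrow> f x = f' x" using g pos' by eventually_elim (auto simp: f'_def)
  have eqw: "AE x in lborel. x \<in> {0<..} \<longrightarrow> (1 + x powr 1) * \<bar>f x\<bar> = (1 + x) * f' x"
    using eq by eventually_elim (auto simp: f'_def)
  have e: "(\<lambda>x. indicator {0<..} x * f' x) = f'" "(\<lambda>x. indicator {0<..} x * ((1 + x) * f' x)) = (\<lambda>x. (1 + x) * f' x)"
    by (auto simp: f'_def indicator_def fun_eq_iff)
  have m: "(\<lambda>x. (1 + x) * f' x) \<in> borel_measurable borel" by measurable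
  have 1: "integrable lborel f'" using fi lebesgue_on_borel_version(1)[OF _ f'm eq] by (simp add: e)
  have 2: "integrable lborel (\<lambda>x. (1 + x) * f' x)" using wi lebesgue_on_borel_version(1)[OF _ m eqw] by (simp add: e)
  have "integrable lborel (\<lambda>x. (1 + x) * f' x - f' x)" by (intro Bochner_Integration.integrable_diff 1 2)
  hence "integrable lborel (\<lambda>x. x * f' x)" by (simp add: algebra_simps)
  hence "size_density f'" unfolding size_density_def using 1 by (auto simp: f'_def)
  thus ?thesis using eq by auto
qed

section \<open>Existence of mass-conserving solutions\<close>

theorem theorem3p6:
  fixes K :: "real \<Rightarrow> real \<Rightarrow> real" and \<kappa>\<^sub>1 :: real and f_in :: "real \<Rightarrow> real"
  assumes "(\<lambda>(x, y). K x y) \<in> borel_measurable quadrant"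
    and "\<kappa>\<^sub>1 > 0"
    and "\<And>x y. x > 0 \<Longrightarrow> y > 0 \<Longrightarrow>
           0 \<le> K x y \<and> K x y = K y x \<and> K x y \<le> \<kappa>\<^sub>1 * (2 + x + y)"
    and "f_in \<in> L1_weighted 1"
    and "AE x in halfline. f_in x \<ge> 0"
  shows "\<exists>f :: real \<Rightarrow> real \<Rightarrow> real.
     (\<forall>t\<ge>0. AE x in halfline. f t x \<ge> 0) \<and>
     continuous_L1 f \<and>
     f \<in> Linf_L1_weighted 1 \<and>
     (\<forall>t>0. \<forall>\<theta>\<in>Linf.
        (\<forall>s\<in>{0<..<t}.
           integrable quadrant (\<lambda>(x, y). tilde \<theta> x y * K x y * f s x * f s y)) \<and>
        integrable (lebesgue_on {0<..<t})
          (\<lambda>s. LINT x|halfline. LINT y|halfline. tilde \<theta> x y * K x y * f s x * f s y) \<and>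
        (LINT x|halfline. \<theta> x * (f t x - f_in x)) =
          1 / 2 * (LINT s|lebesgue_on {0<..<t}. LINT x|halfline. LINT y|halfline.
                     tilde \<theta> x y * K x y * f s x * f s y)) \<and>
     (\<forall>t\<ge>0. f t \<in> L1_weighted 1 \<and>
        moment 0 (f t) \<le> moment 0 f_in \<and>
        moment 1 (f t) = moment 1 f_in)"
proof -
  obtain F :: "nat filter" where F: "F \<noteq> bot" "F \<le> sequentially"
    "\<And>a :: nat \<Rightarrow> real. Bseq a \<Longrightarrow> \<exists>l. (a \<longlongrightarrow> l) F"
    using ex_generalized_limit by blast
  obtain K' where K': "coag_kernel K' \<kappa>\<^sub>1"
    "AE p in lborel \<Otimes>\<^sub>M lborel. 0 < fst p \<and> 0 < snd p \<longrightarrow> K (fst p) (snd p) = K' (fst p) (snd p)"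
    using ex_borel_kernel[OF assms(1-3)] by blast
  obtain f0 where data: "size_density f0" "AE x in lborel. 0 < x \<longrightarrow> f_in x = f0 x"
    using ex_borel_density[OF assms(4,5)] by blast
  interpret approximation K' \<kappa>\<^sub>1 F f0
    by (intro approximation.intro approximation_axioms.intro generalized_limit.intro K'(1) F data(1))
  show ?thesis
  proof (intro exI[of _ lim_density] conjI allI impI ballI)
    show "AE x in halfline. 0 \<le> lim_density t x" for t by (simp add: size_density_nonneg[OF lim_density])
    show "continuous_L1 lim_density" by (rule lim_continuous_L1)
    show "lim_density \<in> Linf_L1_weighted 1" by (rule lim_Linf_L1_weighted)
    show "lim_density t \<in> L1_weighted 1" for t by (rule size_density_L1_weighted(2)[OF lim_density])
    show "moment 0 (lim_density t) \<le> moment 0 f_in" "moment 1 (lim_density t) = moment 1 f_in" for t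
      using moments_dens[OF lim_density, of "lim_density t" t] moments_dens[OF data] lim_number[of t] lim_moment[of t] by simp_all
  qed (rule lim_solution[OF _ _ K'(2) data(2)]; assumption)+
qed

end
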